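(* Let $q\in H^\infty\cap C(\overline{\mathbb D})$ and $h(z)=\overline{z}+q(z)$. Then the Bergman-space Toeplitz operator $T_h$ satisfies Weyl's theorem, i.e. $$\omega(T_h)=\sigma(T_h)\setminus\pi_{00}(T_h).$$
   Context: $\mathbb D$ is the open unit disk, $dA$ normalized area measure on $\mathbb D$, $L^2_a$ the Bergman space of analytic functions in $L^2(\mathbb D,dA)$, $P$ the orthogonal projection onto $L^2_a$, and $T_\varphi f=P(\varphi f)$ for $\varphi\in L^\infty(\mathbb D)$, $f\in L^2_a$. $H^\infty\cap C(\overline{\mathbb D})$ is the disk algebra. For a bounded operator $T$ on a Hilbert space: $\sigma(T)$ is its spectrum; the Weyl spectrum is $\omega(T)=\bigcap_{K\text{ compact}}\sigma(T+K)$; $\pi_{00}(T)$ is the set of isolated points $\lambda$ of $\sigma(T)$ that are eigenvalues of finite geometric multiplicity, i.e. $0<\dim\ker(T-\lambda I)<\infty$. *)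

theory Defs
  imports "HOL-Analysis.Analysis"
begin

definition diskD :: "complex set" where
  "diskD = ball 0 1"

definition dA_int :: "(complex \<Rightarrow> complex) \<Rightarrow> complex" where
  "dA_int f = (LINT z:diskD|lborel. f z) / of_real pi"

text \<open>The Bergman space L^2_a.  Elements are represented by functions that are
  analytic and square integrable on the disk and vanish off the disk (so that
  each element has a unique representative).\<close>
definition bergman :: "(complex \<Rightarrow> complex) set" where
  "bergman = {f. f holomorphic_on diskD \<and>
                 set_integrable lborel diskD (\<lambda>z. (cmod (f z))\<^sup>2) \<and>
                 (\<forall>z. z \<notin> diskD \<longrightarrow> f z = 0)}"

definition bnorm :: "(complex \<Rightarrow> complex) \<Rightarrow> real" where
  "bnorm f = sqrt ((LINT z:diskD|lborel. (cmod (f z))\<^sup>2) / pi)"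

definition bergman_proj :: "(complex \<Rightarrow> complex) \<Rightarrow> (complex \<Rightarrow> complex)" where
  "bergman_proj g = (THE h. h \<in> bergman \<and>
      (\<forall>k\<in>bergman. dA_int (\<lambda>z. (g z - h z) * cnj (k z)) = 0))"

definition toeplitz :: "(complex \<Rightarrow> complex) \<Rightarrow> (complex \<Rightarrow> complex) \<Rightarrow> (complex \<Rightarrow> complex)" where
  "toeplitz \<phi> f = bergman_proj (\<lambda>z. \<phi> z * f z)"

definition bounded_op :: "((complex \<Rightarrow> complex) \<Rightarrow> (complex \<Rightarrow> complex)) \<Rightarrow> bool" where
  "bounded_op T \<longleftrightarrow>
     (\<forall>f\<in>bergman. T f \<in> bergman) \<and>
     (\<forall>f\<in>bergman. \<forall>g\<in>bergman. \<forall>a b. T (\<lambda>z. a * f z + b * g z) = (\<lambda>z. a * T f z + b * T g z)) \<and>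
     (\<exists>C. \<forall>f\<in>bergman. bnorm (T f) \<le> C * bnorm f)"

definition invertible_op :: "((complex \<Rightarrow> complex) \<Rightarrow> (complex \<Rightarrow> complex)) \<Rightarrow> bool" where
  "invertible_op T \<longleftrightarrow> bounded_op T \<and>
     (\<exists>S. bounded_op S \<and> (\<forall>f\<in>bergman. S (T f) = f \<and> T (S f) = f))"

definition op_spectrum :: "((complex \<Rightarrow> complex) \<Rightarrow> (complex \<Rightarrow> complex)) \<Rightarrow> complex set" where
  "op_spectrum T = {w. \<not> invertible_op (\<lambda>f z. T f z - w * f z)}"

definition compact_op :: "((complex \<Rightarrow> complex) \<Rightarrow> (complex \<Rightarrow> complex)) \<Rightarrow> bool" where
  "compact_op K \<longleftrightarrow> bounded_op K \<and>
     (\<forall>u::nat \<Rightarrow> complex \<Rightarrow> complex. (\<forall>n. u n \<in> bergman) \<and> (\<exists>M. \<forall>n. bnorm (u n) \<le> M) \<longrightarrow>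
        (\<exists>r g. strict_mono r \<and> g \<in> bergman \<and>
              (\<lambda>n. bnorm (\<lambda>z. K (u (r n)) z - g z)) \<longlonglongrightarrow> 0))"

definition weyl_spectrum :: "((complex \<Rightarrow> complex) \<Rightarrow> (complex \<Rightarrow> complex)) \<Rightarrow> complex set" where
  "weyl_spectrum T = (\<Inter>K\<in>{K. compact_op K}. op_spectrum (\<lambda>f z. T f z + K f z))"

definition eigenspace_op :: "((complex \<Rightarrow> complex) \<Rightarrow> (complex \<Rightarrow> complex)) \<Rightarrow> complex \<Rightarrow> (complex \<Rightarrow> complex) set" where
  "eigenspace_op T w = {f\<in>bergman. \<forall>z. T f z - w * f z = 0}"

definition fin_dim_C :: "(complex \<Rightarrow> complex) set \<Rightarrow> bool" where
  "fin_dim_C S \<longleftrightarrow> (\<exists>B. finite B \<and> (\<forall>f\<in>S. \<exists>c. f = (\<lambda>z. \<Sum>b\<in>B. c b * b z)))"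

definition pi00 :: "((complex \<Rightarrow> complex) \<Rightarrow> (complex \<Rightarrow> complex)) \<Rightarrow> complex set" where
  "pi00 T = {w\<in>op_spectrum T. \<not> (w islimpt op_spectrum T) \<and>
               eigenspace_op T w \<noteq> {\<lambda>z. 0} \<and> fin_dim_C (eigenspace_op T w)}"

end

theory Submission
  imports Defs "HOL-Complex_Analysis.Complex_Analysis"
begin

text \<open>
  Put \<open>h z = cnj z + q z\<close> and \<open>p w z = 1 + z (q z - w)\<close>, so that \<open>p w z = z (h z - w)\<close> on the unit circle.
  Modulo compact operators \<open>T\<^sub>h - w\<close> only depends on the values of \<open>h - w\<close> on the circle, and
  one compares it with \<open>(1 - a cnj z) m\<close>, where \<open>p w = (z - a) m\<close>. This shows that \<open>w\<close> lies outside the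
  Weyl spectrum if \<open>p w\<close> has exactly one zero in the closed disk, this zero being simple and interior; and that
  \<open>w\<close> belongs to the Weyl spectrum if \<open>p w\<close> has a zero on the circle, no zero at all, or two distinct
  interior zeros.

  Writing \<open>f = (z g)'\<close> one has \<open>T\<^bsub>cnj z\<^esub> f = g'\<close>, so an eigenvector for \<open>w\<close> is a solution of
  \<open>p w g' + (q - w) g = 0\<close>. Hence eigenspaces are at most one-dimensional, and at a zero \<open>a\<close> of \<open>p w\<close> the
  order \<open>n\<close> of \<open>g\<close> satisfies \<open>n (a\<^sup>2 q' a - 1) = 1\<close>. Eigenvalues outside the Weyl spectrum that
  accumulated at a point outside the Weyl spectrum would make \<open>a\<^sup>2 q' a - 1\<close> a positive constant, contradicting its
  value \<open>-1\<close> at the origin. Conversely, in each of the cases where \<open>w\<close> belongs to the Weyl spectrum, it is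
  not an isolated point of the spectrum: the image of the circle under \<open>h\<close> is connected and not a point, and the other
  two cases are stable under small changes of \<open>w\<close>.
\<close>


subsection \<open>Compact perturbations of isomorphisms of a Banach space\<close>

text \<open>For \<open>w\<close> off the image of the circle, the Fredholm index of the operator
  with symbol \<open>h - w\<close> is one minus the number of zeros of \<open>p w\<close> in the
  disk. No index is computed here. Index zero is encoded as being a compact perturbation of an
  isomorphism, and two facts do the work: such an operator is invertible once it is injective, and
  it can be cancelled on the left of a product. Contradictions arise from multiplication by an
  analytic function with a zero, which is injective but not surjective. The price is that a single
  multiple zero falls under none of the listed cases. It is excluded only for eigenvalues, where the
  indicial equation makes the zero simple; points of \<open>pi00\<close> have eigenvectors by
  definition. A second obstacle is the linear structure. The Bergman space becomes a real Banach
  space type, while the definitions demand complex linear operators. Inverses recover complex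
  linearity automatically; compact perturbations do not, so the one that puts \<open>w\<close>
  outside the Weyl spectrum is exhibited as a Toeplitz operator.\<close>

definition compact_linear :: "('a::real_normed_vector \<Rightarrow> 'b::real_normed_vector) \<Rightarrow> bool" where
  "compact_linear K \<longleftrightarrow> bounded_linear K \<and>
     (\<forall>u::nat \<Rightarrow> 'a. (\<exists>M. \<forall>n. norm (u n) \<le> M) \<longrightarrow>
        (\<exists>r g. strict_mono r \<and> (\<lambda>n. K (u (r n))) \<longlonglongrightarrow> g))"

definition linear_iso :: "('a::real_normed_vector \<Rightarrow> 'a) \<Rightarrow> bool" where
  "linear_iso A \<longleftrightarrow> bounded_linear A \<and>
     (\<exists>S. bounded_linear S \<and> (\<forall>x. S (A x) = x \<and> A (S x) = x))"

text \<open>Index zero without an index: on a Banach space these are the Fredholm operators of index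
  zero. \<open>K\<close> need only be real linear here.\<close>

definition weyl_linear :: "('a::real_normed_vector \<Rightarrow> 'a) \<Rightarrow> bool" where
  "weyl_linear A \<longleftrightarrow> bounded_linear A \<and> (\<exists>K. compact_linear K \<and> linear_iso (\<lambda>x. A x + K x))"

lemma compact_linearD:
  assumes "compact_linear K" "\<And>n::nat. norm (u n) \<le> M"
  obtains r g where "strict_mono r" "(\<lambda>n. K (u (r n))) \<longlonglongrightarrow> g"
  using assms unfolding compact_linear_def by blast

lemma compact_linear_comp_left:
  assumes "compact_linear K" "bounded_linear S"
  shows "compact_linear (\<lambda>x. S (K x))"
  unfolding compact_linear_def
proof (intro conjI allI impI)
  show "bounded_linear (\<lambda>x. S (K x))"
    using assms by (auto simp: compact_linear_def intro: bounded_linear_compose)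
  fix u :: "nat \<Rightarrow> 'a" assume "\<exists>M. \<forall>n. norm (u n) \<le> M"
  then obtain r g where "strict_mono r" "(\<lambda>n. K (u (r n))) \<longlonglongrightarrow> g"
    using compact_linearD[OF assms(1)] by blast
  then show "\<exists>r g. strict_mono r \<and> (\<lambda>n. S (K (u (r n)))) \<longlonglongrightarrow> g"
    using bounded_linear.tendsto[OF assms(2)] by blast
qed

lemma compact_linear_comp_right:
  assumes "compact_linear K" "bounded_linear S"
  shows "compact_linear (\<lambda>x. K (S x))"
  unfolding compact_linear_def
proof (intro conjI allI impI)
  show "bounded_linear (\<lambda>x. K (S x))"
    using assms by (auto simp: compact_linear_def intro: bounded_linear_compose)
  fix u :: "nat \<Rightarrow> 'c" assume "\<exists>M. \<forall>n. norm (u n) \<le> M"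
  then obtain M where M: "\<And>n. norm (u n) \<le> M" by blast
  obtain C where C: "C > 0" "\<And>x. norm (S x) \<le> norm x * C"
    using bounded_linear.pos_bounded[OF assms(2)] by blast
  have "norm (S (u n)) \<le> M * C" for n
    using C(2)[of "u n"] mult_right_mono[OF M[of n], of C] C(1) by linarith
  then show "\<exists>r g. strict_mono r \<and> (\<lambda>n. K (S (u (r n)))) \<longlonglongrightarrow> g"
    using compact_linearD[OF assms(1), of "\<lambda>n. S (u n)"] by blast
qed

lemma compact_linear_add:
  assumes "compact_linear K" "compact_linear L"
  shows "compact_linear (\<lambda>x. K x + L x)"
  unfolding compact_linear_def
proof (intro conjI allI impI)
  show "bounded_linear (\<lambda>x. K x + L x)"
    using assms by (auto simp: compact_linear_def intro: bounded_linear_add)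
  fix u :: "nat \<Rightarrow> 'a" assume "\<exists>M. \<forall>n. norm (u n) \<le> M"
  then obtain M where M: "\<And>n. norm (u n) \<le> M" by blast
  obtain r g where r: "strict_mono r" "(\<lambda>n. K (u (r n))) \<longlonglongrightarrow> g"
    by (rule compact_linearD[OF assms(1), of u M]) (use M in auto)
  obtain s g' where s: "strict_mono s" "(\<lambda>n. L (u (r (s n)))) \<longlonglongrightarrow> g'"
    by (rule compact_linearD[OF assms(2), of "\<lambda>n. u (r n)" M]) (use M in auto)
  have "(\<lambda>n. K (u (r (s n))) + L (u (r (s n)))) \<longlonglongrightarrow> g + g'"
    using LIMSEQ_subseq_LIMSEQ[OF r(2) s(1)] s(2) by (auto intro!: tendsto_add simp: o_def)
  moreover have "strict_mono (\<lambda>n. r (s n))"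
    using strict_mono_o[OF r(1) s(1)] by (simp add: o_def)
  ultimately show "\<exists>r g. strict_mono r \<and> (\<lambda>n. K (u (r n)) + L (u (r n))) \<longlonglongrightarrow> g"
    by (intro exI[of _ "\<lambda>n. r (s n)"] exI[of _ "g + g'"]) auto
qed

lemma compact_linear_uminus:
  "compact_linear K \<Longrightarrow> compact_linear (\<lambda>x. - K x)"
  by (rule compact_linear_comp_left) (auto intro: bounded_linear_minus bounded_linear_ident)

lemma linear_iso_intro:
  fixes A :: "'a::real_normed_vector \<Rightarrow> 'a"
  assumes A: "bounded_linear A" and "surj A"
    and c: "c > 0" "\<And>x. c * norm x \<le> norm (A x)"
  shows "linear_iso A"
proof -
  interpret A: bounded_linear A by fact
  have inj: "inj A"
    unfolding linear_injective_0[OF A.linear_axioms]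
  proof (intro allI impI)
    fix x assume "A x = 0"
    then show "x = 0" using c(1) c(2)[of x] by (simp add: mult_le_0_iff)
  qed
  define S where "S = inv A"
  have AS: "A (S x) = x" for x
    using \<open>surj A\<close> by (simp add: S_def surj_f_inv_f)
  have SA: "S (A x) = x" for x
    using inj by (simp add: S_def)
  have "bounded_linear S"
  proof (rule bounded_linear_intro)
    show "S (x + y) = S x + S y" for x y
      by (metis A.add AS SA)
    show "S (r *\<^sub>R x) = r *\<^sub>R S x" for r x
      by (metis A.scaleR AS SA)
    show "norm (S x) \<le> norm x * (1 / c)" for x
      using c(2)[of "S x"] c(1) by (simp add: AS field_simps)
  qed
  then show ?thesis
    unfolding linear_iso_def using A AS SA by blast
qed

text \<open>Solving \<open>A x + E x = y\<close> means finding a fixed point of the map taking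
  \<open>x\<close> to \<open>S (y - E x)\<close>, a contraction by the hypothesis on
  \<open>S (E x)\<close>. The same hypothesis bounds the sum from below, which makes the inverse
  bounded.\<close>

lemma linear_iso_perturb:
  fixes A E :: "'a::banach \<Rightarrow> 'a"
  assumes A: "bounded_linear A" "bounded_linear S" "\<And>x. S (A x) = x" "\<And>x. A (S x) = x"
    and E: "bounded_linear E" and c: "0 \<le> c" "c < 1" "\<And>x. norm (S (E x)) \<le> c * norm x"
  shows "linear_iso (\<lambda>x. A x + E x)"
proof -
  interpret S: bounded_linear S by fact
  interpret E: bounded_linear E by fact
  interpret A: bounded_linear A by fact
  obtain M where M: "M > 0" "\<And>x. norm (S x) \<le> norm x * M"
    using S.pos_bounded by blast
  show ?thesis
  proof (rule linear_iso_intro)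
    show "bounded_linear (\<lambda>x. A x + E x)"
      using A(1) E by (rule bounded_linear_add)
    show "surj (\<lambda>x. A x + E x)"
    proof (rule surjI, rule someI_ex)
      fix y
      have "\<exists>!x. S (y - E x) = x"
      proof (rule banach_fix_type[OF c(1,2)], intro allI)
        fix x x'
        have "S (y - E x) - S (y - E x') = - S (E (x - x'))"
          by (simp add: S.diff E.diff)
        then show "dist (S (y - E x)) (S (y - E x')) \<le> c * dist x x'"
          using c(3)[of "x - x'"] by (simp add: dist_norm)
      qed
      then obtain x where "S (y - E x) = x" by blast
      then have "A x = y - E x" using A(4) by metis
      then show "\<exists>x. A x + E x = y" by (intro exI[of _ x]) simp
    qed
    show "(1 - c) / M > 0" using M c by simp
    fix x
    have "norm x \<le> norm (S (A x + E x)) + norm (S (E x))"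
      using norm_triangle_ineq4[of "S (A x + E x)" "S (E x)"] by (simp add: S.add A(3))
    also have "\<dots> \<le> norm (A x + E x) * M + c * norm x"
      using M(2) c(3) by (intro add_mono) auto
    finally show "(1 - c) / M * norm x \<le> norm (A x + E x)"
      using M by (simp add: field_simps)
  qed
qed

text \<open>The unit vector is the direction of \<open>x - y\<close> for some \<open>y\<close> in
  \<open>Y\<close> that nearly realises the distance of \<open>x\<close>. A best approximation need
  not exist; the slack of a factor 2 becomes the bound 1/2.\<close>

lemma riesz_almost_orthogonal:
  fixes Y :: "'a::real_normed_vector set"
  assumes "closed Y" "subspace Y" "subspace X" "Y \<subseteq> X" "x \<in> X" "x \<notin> Y"
  obtains u where "u \<in> X" "norm u = 1" "\<And>y. y \<in> Y \<Longrightarrow> 1/2 \<le> norm (u - y)"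
proof -
  have ne: "Y \<noteq> {}" using assms(2) subspace_0 by auto
  define d where "d = infdist x Y"
  have d: "d > 0"
    unfolding d_def using infdist_pos_not_in_closed[OF assms(1) ne assms(6)] .
  have "\<exists>y\<in>Y. dist x y < 2 * d"
  proof (rule ccontr)
    assume "\<not> ?thesis"
    then have "2 * d \<le> infdist x Y"
      unfolding infdist_notempty[OF ne] by (intro cINF_greatest ne) force
    then show False using d by (simp add: d_def)
  qed
  then obtain y where y: "y \<in> Y" "dist x y < 2 * d" by blast
  define u where "u = (1 / norm (x - y)) *\<^sub>R (x - y)"
  have xy: "norm (x - y) > 0" using y(1) assms(6) by auto
  show ?thesis
  proof
    show "u \<in> X"
      unfolding u_def using assms y by (intro subspace_scale subspace_diff) auto
    show "norm u = 1" using xy by (simp add: u_def)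
    fix z assume "z \<in> Y"
    then have "y + norm (x - y) *\<^sub>R z \<in> Y"
      using assms(2) y(1) by (intro subspace_add subspace_scale) auto
    then have "d \<le> dist x (y + norm (x - y) *\<^sub>R z)"
      unfolding d_def by (rule infdist_le)
    also have "x - (y + norm (x - y) *\<^sub>R z) = norm (x - y) *\<^sub>R (u - z)"
      using xy by (simp add: u_def algebra_simps)
    then have "dist x (y + norm (x - y) *\<^sub>R z) = norm (x - y) * norm (u - z)"
      by (simp add: dist_norm)
    finally have "d \<le> norm (x - y) * norm (u - z)" .
    moreover have "norm (x - y) * norm (u - z) \<le> 2 * d * norm (u - z)"
      using y(2) by (intro mult_right_mono) (auto simp: dist_norm)
    ultimately have "d * 1 \<le> d * (2 * norm (u - z))" by simp
    then show "1/2 \<le> norm (u - z)" using d by (simp only: mult_le_cancel_left_pos)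
  qed
qed

text \<open>Riesz's argument. Compactness and injectivity bound \<open>L = I - K\<close> from below,
  so the ranges of its powers are closed. If \<open>L\<close> were not surjective they would
  decrease strictly, and almost orthogonal unit vectors chosen in them would have images under
  \<open>K\<close> without a convergent subsequence.\<close>

theorem fredholm_alternative:
  fixes K :: "'a::banach \<Rightarrow> 'a"
  assumes K: "compact_linear K" and inj: "\<And>x. x - K x = 0 \<Longrightarrow> x = 0"
  shows "linear_iso (\<lambda>x. x - K x)"
proof -
  define L where "L = (\<lambda>x. x - K x)"
  have bK: "bounded_linear K" using K by (simp add: compact_linear_def)
  then have bL: "bounded_linear L"
    unfolding L_def by (intro bounded_linear_sub bounded_linear_ident)
  interpret L: bounded_linear L by fact
  interpret K: bounded_linear K by fact
  have "\<exists>c>0. \<forall>x. c * norm x \<le> norm (L x)"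
  proof (rule ccontr)
    assume "\<not> ?thesis"
    then have *: "\<exists>x. norm (L x) < c * norm x" if "c > 0" for c
      using that by (meson not_le)
    have "\<exists>x. norm x = 1 \<and> norm (L x) < 1 / Suc n" for n
    proof -
      obtain x where x: "norm (L x) < 1 / Suc n * norm x" using *[of "1 / Suc n"] by auto
      then have "norm x > 0" by (metis L.zero mult_zero_right norm_zero zero_less_norm_iff order_less_irrefl)
      then show ?thesis using x
        by (intro exI[of _ "x /\<^sub>R norm x"]) (auto simp: L.scaleR field_simps)
    qed
    then obtain x where x: "\<And>n. norm (x n) = 1" "\<And>n. norm (L (x n)) < 1 / Suc n" by metis
    obtain r g where r: "strict_mono r" "(\<lambda>n. K (x (r n))) \<longlonglongrightarrow> g"
      using compact_linearD[OF K, of x 1] x by auto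
    have "(\<lambda>n. L (x n)) \<longlonglongrightarrow> 0"
      by (rule LIMSEQ_norm_0) (use x(2) in simp)
    from LIMSEQ_subseq_LIMSEQ[OF this r(1)] have L0: "(\<lambda>n. L (x (r n))) \<longlonglongrightarrow> 0"
      by (simp add: o_def)
    \<comment> \<open>\<open>L x + K x = x\<close>, so convergence of both summands is norm
      convergence of the unit vectors themselves.\<close>
    have "(\<lambda>n. L (x (r n)) + K (x (r n))) \<longlonglongrightarrow> 0 + g"
      by (intro tendsto_add L0 r)
    then have g: "(\<lambda>n. x (r n)) \<longlonglongrightarrow> g" by (simp add: L_def)
    have "L g = 0" using L.tendsto[OF g] L0 LIMSEQ_unique by blast
    then have "g = 0" using inj by (simp add: L_def)
    moreover have "norm g = 1"
      using tendsto_norm[OF g] x(1) by (simp add: LIMSEQ_const_iff)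
    ultimately show False by simp
  qed
  then obtain c where c: "c > 0" "\<And>x. c * norm x \<le> norm (L x)" by blast
  have injL: "inj L"
    unfolding linear_injective_0[OF L.linear_axioms] using inj by (auto simp: L_def)
  have "surj L"
  proof (rule ccontr)
    assume "\<not> surj L"
    then obtain y where y: "y \<notin> range L" by auto
    define R where "R n = range (L ^^ n)" for n
    have sub: "subspace (R n)" and compl: "complete (R n)" for n
    proof (induction n)
      case 0
      show "subspace (R 0)" "complete (R 0)" by (auto simp: R_def complete_UNIV)
    next
      case (Suc n)
      have RS: "R (Suc n) = L ` R n" by (auto simp: R_def image_comp)
      show "subspace (R (Suc n))"
        unfolding RS by (rule linear_subspace_image[OF L.linear_axioms Suc(1)])
      show "complete (R (Suc n))"
        unfolding RS using complete_isometric_image[OF c(1) Suc(1) bL _ Suc(2)] c(2) by blast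
    qed
    have dec1: "R (Suc n) \<subseteq> R n" for n
      by (auto simp: R_def funpow_swap1)
    have dec: "R m \<subseteq> R n" if "n \<le> m" for m n
      using lift_Suc_antimono_le[of R n m] dec1 that by blast
    have injn: "inj (L ^^ n)" for n
      using injL by (simp add: inj_fn)
    \<comment> \<open>Injectivity of \<open>L ^^ n\<close> transports \<open>y\<close>, which is
      outside the range of \<open>L\<close>, to a witness that \<open>R (Suc n)\<close> is strictly
      smaller than \<open>R n\<close>.\<close>
    have notin: "(L ^^ n) y \<notin> R (Suc n)" for n
    proof
      assume "(L ^^ n) y \<in> R (Suc n)"
      then obtain x where "(L ^^ n) y = (L ^^ n) (L x)"
        by (auto simp: R_def funpow_swap1)
      then show False using injn y by (metis injD rangeI)
    qed
    have "\<exists>u. u \<in> R n \<and> norm u = 1 \<and> (\<forall>z\<in>R (Suc n). 1/2 \<le> norm (u - z))" for n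
      using riesz_almost_orthogonal[OF complete_imp_closed[OF compl] sub sub dec1 _ notin, of n]
      by (metis R_def rangeI)
    then obtain u where u: "\<And>n. u n \<in> R n" "\<And>n. norm (u n) = 1"
      "\<And>n z. z \<in> R (Suc n) \<Longrightarrow> 1/2 \<le> norm (u n - z)" by metis
    have LR: "L x \<in> R (Suc n)" if "x \<in> R n" for x n
      using that by (auto simp: R_def)
    have far: "1/2 \<le> norm (K (u n) - K (u m))" if "n < m" for n m
    proof -
      \<comment> \<open>\<open>K (u n) - K (u m)\<close> is \<open>u n\<close> minus this vector,
        all of which lies one range further down.\<close>
      have "L (u n) + u m - L (u m) \<in> R (Suc n)"
      proof (intro subspace_diff subspace_add sub)
        show "L (u n) \<in> R (Suc n)" by (rule LR[OF u(1)])
        show "u m \<in> R (Suc n)" using dec[of "Suc n" m] that u(1) by auto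
        show "L (u m) \<in> R (Suc n)" using dec[of "Suc n" "Suc m"] that LR[OF u(1)] by auto
      qed
      from u(3)[OF this] show ?thesis by (simp add: L_def algebra_simps)
    qed
    obtain r g where r: "strict_mono r" "(\<lambda>n. K (u (r n))) \<longlonglongrightarrow> g"
      using compact_linearD[OF K, of u 1] u(2) by auto
    from metric_CauchyD[OF LIMSEQ_imp_Cauchy[OF r(2)], of "1/2"]
    obtain N where N: "\<And>m n. m \<ge> N \<Longrightarrow> n \<ge> N \<Longrightarrow> dist (K (u (r m))) (K (u (r n))) < 1/2"
      by auto
    show False
      using N[of N "Suc N"] far[of "r N" "r (Suc N)"] r(1) by (simp add: dist_norm strict_mono_def)
  qed
  then show ?thesis
    using linear_iso_intro[OF bL _ c] by (simp add: L_def)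
qed

section \<open>Index zero: compact perturbations of isomorphisms\<close>

lemma weyl_linear_iso_add_compact:
  assumes "linear_iso S" "compact_linear K"
  shows "weyl_linear (\<lambda>x. S x + K x)"
  unfolding weyl_linear_def
proof (intro conjI exI[of _ "\<lambda>x. - K x"])
  show "bounded_linear (\<lambda>x. S x + K x)"
    using assms by (auto intro!: bounded_linear_add simp: linear_iso_def compact_linear_def)
qed (use assms compact_linear_uminus in auto)

lemma linear_iso_imp_weyl: "linear_iso A \<Longrightarrow> weyl_linear A"
  using weyl_linear_iso_add_compact[of A "\<lambda>x. 0"]
  by (auto simp: compact_linear_def intro: strict_monoI exI[of _ "\<lambda>n::nat. n"])

text \<open>With \<open>S\<close> inverse to \<open>A + K\<close>, the operator
  \<open>S A = I - S K\<close> is injective, hence invertible by the Fredholm alternative, and the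
  injective \<open>S\<close> can then be removed. This is the conclusion usually drawn from index
  zero.\<close>

lemma weyl_linear_inj_imp_iso:
  fixes A :: "'a::banach \<Rightarrow> 'a"
  assumes A: "weyl_linear A" and inj: "\<And>x. A x = 0 \<Longrightarrow> x = 0"
  shows "linear_iso A"
proof -
  obtain K S where K: "compact_linear K" and S: "bounded_linear S"
    "\<And>x. S (A x + K x) = x" "\<And>x. A (S x) + K (S x) = x"
    and bA: "bounded_linear A" and bAK: "bounded_linear (\<lambda>x. A x + K x)"
    using A unfolding weyl_linear_def linear_iso_def by auto
  interpret S: bounded_linear S by fact
  interpret A: bounded_linear A by fact
  have eq: "x - S (K x) = S (A x)" for x
    using S(2)[of x] by (simp add: S.add algebra_simps)
  have eq0: "S x = 0 \<longleftrightarrow> x = 0" for x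
  proof
    assume "S x = 0"
    with S(3)[of x] K show "x = 0"
      by (simp add: A.zero compact_linear_def linear_0 bounded_linear.linear)
  qed (simp add: S.zero)
  have "linear_iso (\<lambda>x. x - S (K x))"
    by (rule fredholm_alternative[OF compact_linear_comp_left[OF K S(1)]])
       (use eq eq0 inj in auto)
  then obtain R where R: "bounded_linear R" "\<And>x. R (S (A x)) = x" "\<And>x. S (A (R x)) = x"
    unfolding linear_iso_def eq by auto
  have "A (R (S x)) = x" for x
    using R(3)[of "S x"] eq0[of "A (R (S x)) - x"] by (simp add: S.diff)
  then show ?thesis
    unfolding linear_iso_def using bA R bounded_linear_compose[OF R(1) S(1)]
    by (intro conjI exI[of _ "\<lambda>x. R (S x)"]) auto
qed

text \<open>In terms of indices: if \<open>A\<close> and \<open>A M\<close> have index zero, so has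
  \<open>M\<close>. Concretely, \<open>S (A M + L) = M + K'\<close> is a product of two
  isomorphisms, and \<open>K'\<close> collects the compact terms.\<close>

lemma weyl_linear_left_cancel:
  fixes A :: "'a::banach \<Rightarrow> 'a"
  assumes A: "weyl_linear A" and M: "bounded_linear M" and B: "weyl_linear (\<lambda>x. A (M x))"
  shows "weyl_linear M"
proof -
  obtain K where K: "compact_linear K" and isoA: "linear_iso (\<lambda>x. A x + K x)"
    using A unfolding weyl_linear_def by auto
  obtain S where S: "bounded_linear S" "\<And>x. S (A x + K x) = x" "\<And>x. A (S x) + K (S x) = x"
    using isoA unfolding linear_iso_def by auto
  obtain L where L: "compact_linear L" and isoB: "linear_iso (\<lambda>x. A (M x) + L x)"
    using B unfolding weyl_linear_def by auto
  obtain R where R: "bounded_linear R" "\<And>x. R (A (M x) + L x) = x" "\<And>x. A (M (R x)) + L (R x) = x"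
    using isoB unfolding linear_iso_def by auto
  interpret S: bounded_linear S by fact
  define K' where "K' = (\<lambda>x. S (L x) + - S (K (M x)))"
  have K': "compact_linear K'"
    unfolding K'_def
    by (intro compact_linear_add compact_linear_uminus compact_linear_comp_left[OF _ S(1)]
        L compact_linear_comp_right[OF K M])
  have eq: "M x + K' x = S (A (M x) + L x)" for x
  proof -
    have "S (A (M x)) + S (K (M x)) = M x" using S(2)[of "M x"] by (simp add: S.add)
    then have "M x - S (K (M x)) = S (A (M x))" by (simp add: diff_eq_eq)
    then show ?thesis by (simp add: K'_def S.add)
  qed
  have "linear_iso (\<lambda>x. M x + K' x)"
    unfolding eq linear_iso_def
  proof (intro conjI exI[of _ "\<lambda>x. R (A x + K x)"] allI)
    show "bounded_linear (\<lambda>x. S (A (M x) + L x))"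
      using isoB unfolding linear_iso_def by (intro bounded_linear_compose[OF S(1)]) auto
    show "bounded_linear (\<lambda>x. R (A x + K x))"
      using isoA unfolding linear_iso_def by (intro bounded_linear_compose[OF R(1)]) auto
  qed (use S R in auto)
  then show ?thesis
    unfolding weyl_linear_def using M K' by blast
qed

text \<open>\<open>M\<close> inherits index zero from \<open>A\<close> and \<open>I + K\<close>, and
  injectivity then forces surjectivity. This will be contradicted by a multiplication whose
  multiplier vanishes at 0.\<close>

lemma weyl_linear_right_factor:
  fixes A :: "'a::banach \<Rightarrow> 'a"
  assumes A: "weyl_linear A" and M: "bounded_linear M" and K: "compact_linear K"
    and AM: "\<And>x. A (M x) = x + K x"
    and inj: "\<And>x. M x = 0 \<Longrightarrow> x = 0"
  shows "surj M"
proof -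
  have "linear_iso (\<lambda>x::'a. x)"
    unfolding linear_iso_def by (auto intro!: exI[of _ "\<lambda>x. x"])
  then have "weyl_linear (\<lambda>x. A (M x))"
    unfolding AM using K by (rule weyl_linear_iso_add_compact)
  then have "weyl_linear M" by (rule weyl_linear_left_cancel[OF A M])
  then have "linear_iso M" by (rule weyl_linear_inj_imp_iso) (use inj in auto)
  then show ?thesis unfolding linear_iso_def by (metis surjI)
qed


subsection \<open>Area integrals of monomials over disks\<close>

lemma measurable_Complex [measurable]: "(\<lambda>(x, y). Complex x y) \<in> borel_measurable (lborel \<Otimes>\<^sub>M lborel)"
proof -
  have "(\<lambda>p. Complex (fst p) (snd p)) = (\<lambda>p. complex_of_real (fst p) + \<i> * complex_of_real (snd p))"
    by (simp add: complex_eq_iff fun_eq_iff)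
  moreover have "\<dots> \<in> borel_measurable (lborel \<Otimes>\<^sub>M lborel)" by measurable
  ultimately show ?thesis by (simp add: case_prod_beta')
qed

text \<open>Makes Fubini's theorem in the two real coordinates available for the measure on the
  plane.\<close>

lemma lborel_complex_eq: "(lborel :: complex measure) = distr (lborel \<Otimes>\<^sub>M lborel) borel (\<lambda>(x, y). Complex x y)"
proof (rule lborel_eqI)
  fix l u :: complex
  assume *: "\<And>b. b \<in> Basis \<Longrightarrow> l \<bullet> b \<le> u \<bullet> b"
  have le: "Re l \<le> Re u" "Im l \<le> Im u"
    using *[of 1] *[of \<i>] by (auto simp: Basis_complex_def inner_complex_def)
  have eq: "(\<lambda>(x, y). Complex x y) -` box l u = {Re l <..< Re u} \<times> {Im l <..< Im u}"
    by (auto simp: box_def Basis_complex_def inner_complex_def)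
  have "emeasure (distr (lborel \<Otimes>\<^sub>M lborel) borel (\<lambda>(x, y). Complex x y)) (box l u)
      = emeasure (lborel \<Otimes>\<^sub>M lborel) ({Re l <..< Re u} \<times> {Im l <..< Im u})"
    by (subst emeasure_distr) (auto simp: eq space_pair_measure)
  also have "\<dots> = ennreal ((Re u - Re l) * (Im u - Im l))"
    using le by (subst lborel.emeasure_pair_measure_Times) (auto simp: ennreal_mult)
  also have "(Re u - Re l) * (Im u - Im l) = (\<Prod>b\<in>Basis. (u - l) \<bullet> b)"
    by (simp add: Basis_complex_def inner_complex_def complex_eq_iff)
  finally show "emeasure (distr (lborel \<Otimes>\<^sub>M lborel) borel (\<lambda>(x, y). Complex x y)) (box l u)
      = ennreal (\<Prod>b\<in>Basis. (u - l) \<bullet> b)" .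
qed simp

lemma nn_integral_real_translate:
  fixes F :: "real \<Rightarrow> ennreal"
  assumes [measurable]: "F \<in> borel_measurable borel"
  shows "(\<integral>\<^sup>+x. F (x + c) \<partial>lborel) = (\<integral>\<^sup>+x. F x \<partial>lborel)"
proof -
  have "(\<integral>\<^sup>+x. F x \<partial>lborel) = (\<integral>\<^sup>+x. F x \<partial>distr lborel borel ((+) c))"
    by (simp only: lborel_distr_plus)
  also have "\<dots> = (\<integral>\<^sup>+x. F (c + x) \<partial>lborel)"
    by (rule nn_integral_distr) auto
  finally show ?thesis by (simp add: add.commute)
qed

lemma nn_integral_complex_iterated:
  fixes F :: "complex \<Rightarrow> ennreal"
  assumes [measurable]: "F \<in> borel_measurable borel"
  shows "(\<integral>\<^sup>+z. F z \<partial>lborel) = (\<integral>\<^sup>+y. \<integral>\<^sup>+x. F (Complex x y) \<partial>lborel \<partial>lborel)"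
    and "(\<integral>\<^sup>+z. F z \<partial>lborel) = (\<integral>\<^sup>+x. \<integral>\<^sup>+y. F (Complex x y) \<partial>lborel \<partial>lborel)"
proof -
  have m: "(\<lambda>(x,y). F (Complex x y)) \<in> borel_measurable (lborel \<Otimes>\<^sub>M lborel)"
    using measurable_compose[OF measurable_Complex assms] by (simp add: case_prod_beta')
  have "(\<integral>\<^sup>+z. F z \<partial>lborel) = (\<integral>\<^sup>+p. F (case p of (x, y) \<Rightarrow> Complex x y) \<partial>(lborel \<Otimes>\<^sub>M lborel))"
    by (subst lborel_complex_eq, rule nn_integral_distr) auto
  also have "\<dots> = (\<integral>\<^sup>+(x,y). F (Complex x y) \<partial>(lborel \<Otimes>\<^sub>M lborel))"
    by (simp add: case_prod_beta')
  finally have *: "(\<integral>\<^sup>+z. F z \<partial>lborel) = (\<integral>\<^sup>+(x,y). F (Complex x y) \<partial>(lborel \<Otimes>\<^sub>M lborel))" .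
  show "(\<integral>\<^sup>+z. F z \<partial>lborel) = (\<integral>\<^sup>+y. \<integral>\<^sup>+x. F (Complex x y) \<partial>lborel \<partial>lborel)"
    using lborel_pair.nn_integral_snd[OF m] * by simp
  show "(\<integral>\<^sup>+z. F z \<partial>lborel) = (\<integral>\<^sup>+x. \<integral>\<^sup>+y. F (Complex x y) \<partial>lborel \<partial>lborel)"
    using lborel.nn_integral_fst[OF m] * by simp
qed

lemma measurable_Complex1 [measurable]: "(\<lambda>x. Complex x y) \<in> borel_measurable borel"
  and measurable_Complex2 [measurable]: "(\<lambda>y. Complex x y) \<in> borel_measurable borel"
proof -
  have "(\<lambda>x. Complex x y) = (\<lambda>x. complex_of_real x + \<i> * complex_of_real y)"
    "(\<lambda>y. Complex x y) = (\<lambda>y. complex_of_real x + \<i> * complex_of_real y)"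
    by (simp_all add: complex_eq_iff fun_eq_iff)
  then show "(\<lambda>x. Complex x y) \<in> borel_measurable borel" "(\<lambda>y. Complex x y) \<in> borel_measurable borel"
    by simp_all
qed

text \<open>On each horizontal line the shear is a translation.\<close>

lemma nn_integral_shear_Re:
  fixes F :: "complex \<Rightarrow> ennreal"
  assumes [measurable]: "F \<in> borel_measurable borel"
  shows "(\<integral>\<^sup>+z. F (z + of_real (t * Im z)) \<partial>lborel) = (\<integral>\<^sup>+z. F z \<partial>lborel)"
proof -
  have "(\<integral>\<^sup>+z. F (z + of_real (t * Im z)) \<partial>lborel)
      = (\<integral>\<^sup>+y. \<integral>\<^sup>+x. F (Complex x y + of_real (t * Im (Complex x y))) \<partial>lborel \<partial>lborel)"
    by (rule nn_integral_complex_iterated(1)) measurable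
  also have "\<dots> = (\<integral>\<^sup>+y. \<integral>\<^sup>+x. F (Complex (x + t * y) y) \<partial>lborel \<partial>lborel)"
  proof -
    have "Complex x y + of_real (t * y) = Complex (x + t * y) y" for x y
      by (simp add: complex_eq_iff)
    then show ?thesis by simp
  qed
  also have "\<dots> = (\<integral>\<^sup>+y. \<integral>\<^sup>+x. F (Complex x y) \<partial>lborel \<partial>lborel)"
    by (intro nn_integral_cong nn_integral_real_translate[of "\<lambda>x. F (Complex x _)"]) measurable
  also have "\<dots> = (\<integral>\<^sup>+z. F z \<partial>lborel)"
    by (rule nn_integral_complex_iterated(1)[symmetric]) measurable
  finally show ?thesis .
qed

lemma nn_integral_shear_Im:
  fixes F :: "complex \<Rightarrow> ennreal"
  assumes [measurable]: "F \<in> borel_measurable borel"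
  shows "(\<integral>\<^sup>+z. F (z + \<i> * of_real (t * Re z)) \<partial>lborel) = (\<integral>\<^sup>+z. F z \<partial>lborel)"
proof -
  have "(\<integral>\<^sup>+z. F (z + \<i> * of_real (t * Re z)) \<partial>lborel)
      = (\<integral>\<^sup>+x. \<integral>\<^sup>+y. F (Complex x y + \<i> * of_real (t * Re (Complex x y))) \<partial>lborel \<partial>lborel)"
    by (rule nn_integral_complex_iterated(2)) measurable
  also have "\<dots> = (\<integral>\<^sup>+x. \<integral>\<^sup>+y. F (Complex x (y + t * x)) \<partial>lborel \<partial>lborel)"
  proof -
    have "Complex x y + \<i> * of_real (t * x) = Complex x (y + t * x)" for x y
      by (simp add: complex_eq_iff)
    then show ?thesis by simp
  qed
  also have "\<dots> = (\<integral>\<^sup>+x. \<integral>\<^sup>+y. F (Complex x y) \<partial>lborel \<partial>lborel)"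
    by (intro nn_integral_cong nn_integral_real_translate[of "\<lambda>y. F (Complex _ y)"]) measurable
  also have "\<dots> = (\<integral>\<^sup>+z. F z \<partial>lborel)"
    by (rule nn_integral_complex_iterated(2)[symmetric]) measurable
  finally show ?thesis .
qed

text \<open>A plane rotation other than the half turn is a product of three shears.\<close>
lemma lborel_distr_rotation:
  fixes c :: complex
  assumes "cmod c = 1" "c \<noteq> - 1"
  shows "distr lborel borel ((*) c) = lborel"
proof (rule measure_eqI)
  show "sets (distr lborel borel ((*) c)) = sets lborel" by simp
  fix A assume "A \<in> sets (distr lborel borel ((*) c))"
  then have A[measurable]: "A \<in> sets borel" by simp
  have c1: "(Re c)\<^sup>2 + (Im c)\<^sup>2 = 1"
    using assms(1) by (simp add: cmod_def)
  have a: "1 + Re c \<noteq> 0"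
  proof
    assume "1 + Re c = 0"
    then have "Re c = -1" by simp
    with c1 have "c = -1" by (simp add: complex_eq_iff)
    with assms(2) show False by simp
  qed
  \<comment> \<open>For \<open>c = cis \<theta>\<close> this is \<open>- tan (\<theta> / 2)\<close>;
    the denominator vanishes only at the half turn.\<close>
  define t where "t = - (Im c / (1 + Re c))"
  define s1 where "s1 = (\<lambda>z. z + complex_of_real (t * Im z))"
  define s2 where "s2 = (\<lambda>z. z + \<i> * complex_of_real (Im c * Re z))"
  have [measurable]: "s1 \<in> borel_measurable borel" "s2 \<in> borel_measurable borel"
    unfolding s1_def s2_def by measurable
  have t1: "1 + t * Im c = Re c"
    using a c1 by (simp add: t_def field_simps power2_eq_square)
  have t2: "t * (1 + Re c) = - Im c"
    using a by (simp add: t_def)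
  have rot: "c * z = s1 (s2 (s1 z))" for z
  proof -
    have "Im (s1 (s2 (s1 z))) = Im z + Im c * (Re z + t * Im z)"
      by (simp add: s1_def s2_def)
    also have "\<dots> = Im c * Re z + (1 + t * Im c) * Im z"
      by (simp add: algebra_simps)
    finally have im: "Im (s1 (s2 (s1 z))) = Im (c * z)"
      by (simp add: t1 algebra_simps)
    have "Re (s1 (s2 (s1 z))) = Re z + t * Im z + t * (Im z + Im c * (Re z + t * Im z))"
      by (simp add: s1_def s2_def)
    also have "\<dots> = (1 + t * Im c) * Re z + t * (1 + (1 + t * Im c)) * Im z"
      by (simp add: algebra_simps)
    also have "\<dots> = Re (c * z)"
      using t2 by (simp add: t1)
    finally show ?thesis using im by (simp add: complex_eq_iff)
  qed
  have "emeasure (distr lborel borel ((*) c)) A = (\<integral>\<^sup>+z. indicator A z \<partial>distr lborel borel ((*) c))"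
    by simp
  also have "\<dots> = (\<integral>\<^sup>+z. indicator A (c * z) \<partial>lborel)"
    by (rule nn_integral_distr) auto
  also have "\<dots> = (\<integral>\<^sup>+z. indicator A (s1 (s2 (s1 z))) \<partial>lborel)"
    by (simp only: rot)
  also have "\<dots> = (\<integral>\<^sup>+z. indicator A (s1 (s2 z)) \<partial>lborel)"
    using nn_integral_shear_Re[of "\<lambda>z. indicator A (s1 (s2 z))" t] by (simp add: s1_def)
  also have "\<dots> = (\<integral>\<^sup>+z. indicator A (s1 z) \<partial>lborel)"
    using nn_integral_shear_Im[of "\<lambda>z. indicator A (s1 z)" "Im c"] by (simp add: s2_def)
  also have "\<dots> = (\<integral>\<^sup>+z. indicator A z \<partial>lborel)"
    using nn_integral_shear_Re[of "\<lambda>z. indicator A z" t] by (simp add: s1_def)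
  finally show "emeasure (distr lborel borel ((*) c)) A = emeasure lborel A" by simp
qed

section \<open>Moments of disks from rotation and scaling\<close>

lemma set_integrable_ball_continuous:
  fixes F :: "complex \<Rightarrow> 'b::{banach, second_countable_topology}"
  assumes "continuous_on (cball 0 r) F"
  shows "set_integrable lborel (ball 0 r) F"
  using set_integrable_subset[of lborel "cball 0 r" F "ball 0 r"] borel_integrable_compact[OF compact_cball assms]
  by (simp add: set_integrable_def)

text \<open>A rotation by \<open>c\<close> leaves the integral unchanged but multiplies the
  integrand by \<open>c ^ j * cnj c ^ n\<close>, which can be made different from 1.\<close>

lemma monomial_integral_ball_neq:
  assumes "j \<noteq> n"
  shows "(LINT z:ball 0 r|lborel. z ^ j * cnj z ^ n) = 0"
proof -
  \<comment> \<open>The value \<open>\<i>\<close> keeps \<open>c\<close> away from the half turn,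
    which the rotation lemma excludes; for \<open>k = 1\<close> the value -1 would not.\<close>
  have gen: "\<exists>c. cmod c = 1 \<and> c \<noteq> -1 \<and> c ^ k = \<i>" if "k > 0" for k
  proof (intro exI conjI)
    show "cmod (cis (pi / (2 * real k))) = 1" by simp
    have "sin (pi / (2 * k)) > 0"
      using that by (intro sin_gt_zero) (auto simp: field_simps)
    then show "cis (pi / (2 * real k)) \<noteq> -1" by (auto simp: complex_eq_iff)
    have "real k * (pi / (2 * real k)) = pi / 2" using that by simp
    then have "cis (pi / (2 * real k)) ^ k = cis (pi / 2)"
      using Complex.DeMoivre[of "pi / (2 * real k)" k] by metis
    then show "cis (pi / (2 * real k)) ^ k = \<i>" by simp
  qed
  have "\<exists>c. cmod c = 1 \<and> c \<noteq> -1 \<and> c ^ j * cnj c ^ n \<noteq> 1"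
  proof (cases "j > n")
    case True
    then obtain c where c: "cmod c = 1" "c \<noteq> -1" "c ^ (j - n) = \<i>" using gen[of "j - n"] by auto
    have "c ^ j = c ^ (j - n) * c ^ n" using True by (simp flip: power_add)
    then have "c ^ j * cnj c ^ n = c ^ (j - n) * (c * cnj c) ^ n"
      by (simp add: power_mult_distrib)
    then have "c ^ j * cnj c ^ n = \<i>" using c complex_norm_square[of c] by simp
    then show ?thesis using c by (intro exI[of _ c]) simp
  next
    case False
    then obtain c where c: "cmod c = 1" "c \<noteq> -1" "c ^ (n - j) = \<i>" using gen[of "n - j"] assms by auto
    have "cnj c ^ n = cnj c ^ (n - j) * cnj c ^ j" using False by (simp flip: power_add)
    then have "c ^ j * cnj c ^ n = cnj (c ^ (n - j)) * (c * cnj c) ^ j"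
      by (simp add: power_mult_distrib)
    then have "c ^ j * cnj c ^ n = - \<i>" using c complex_norm_square[of c] by simp
    moreover have "- \<i> \<noteq> 1" by (simp add: complex_eq_iff)
    ultimately show ?thesis using c by (intro exI[of _ c]) simp
  qed
  then obtain c where c: "cmod c = 1" "c \<noteq> -1" "c ^ j * cnj c ^ n \<noteq> 1" by blast
  define F where "F = (\<lambda>z. indicator (ball 0 r) z *\<^sub>R (z ^ j * cnj z ^ n))"
  have [measurable]: "F \<in> borel_measurable borel"
    unfolding F_def by (intro borel_measurable_continuous_on_indicator continuous_intros) auto
  have "F (c * z) = (c ^ j * cnj c ^ n) * F z" for z
    using c(1) by (auto simp: F_def indicator_def norm_mult power_mult_distrib)
  then have "(LINT z|lborel. F (c * z)) = (c ^ j * cnj c ^ n) * (LINT z|lborel. F z)"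
    by simp
  moreover have "(LINT z|lborel. F (c * z)) = (LINT z|lborel. F z)"
    by (subst (2) lborel_distr_rotation[OF c(1,2), symmetric], rule integral_distr[symmetric]) auto
  ultimately have "(LINT z|lborel. F z) = 0" using c(3) by simp
  then show ?thesis by (simp add: F_def set_lebesgue_integral_def)
qed

lemma radial_integral_ball_scale:
  assumes "r > 0"
  shows "(LINT z:ball (0::complex) r|lborel. cmod z ^ k) = r ^ (k + 2) * (LINT z:ball (0::complex) 1|lborel. cmod z ^ k)"
proof -
  define F where "F s = (\<lambda>z::complex. indicator (ball 0 s) z *\<^sub>R cmod z ^ k)" for s
  have [measurable]: "F s \<in> borel_measurable borel" for s
    unfolding F_def by (intro borel_measurable_continuous_on_indicator continuous_intros) auto
  have "(LINT z|lborel. F r z) = (LINT z|density (distr lborel borel (\<lambda>x. 0 + r *\<^sub>R x)) (\<lambda>_. \<bar>r\<bar>^DIM(complex)). F r z)"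
    using assms by (subst lborel_affine[of r 0]) auto
  also have "\<dots> = (LINT z|lborel. r\<^sup>2 * F r (r *\<^sub>R z))"
    using assms by (subst integral_density) (auto simp: integral_distr)
  also have "\<dots> = (LINT z|lborel. r ^ (k + 2) * F 1 z)"
    using assms by (intro Bochner_Integration.integral_cong)
      (auto simp: F_def indicator_def power_mult_distrib power_add power2_eq_square)
  finally show ?thesis by (simp add: F_def set_lebesgue_integral_def)
qed

text \<open>Polar coordinates are replaced by self-similarity. Scaling expresses the integral over
  the annulus of radii \<open>r\<close> and 1 through the unknown integral, while on it the
  integrand lies between \<open>r ^ (2 * n)\<close> and 1. Comparison with the area of the annulus,
  as \<open>r\<close> tends to 1, determines the value.\<close>

lemma radial_integral_unit_ball:
  "(LINT z:ball (0::complex) 1|lborel. cmod z ^ (2 * n)) = pi / (n + 1)"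
proof -
  define I where "I k r = (LINT z:ball (0::complex) r|lborel. cmod z ^ (2 * k))" for k r
  have int: "set_integrable lborel (ball (0::complex) r) (\<lambda>z. cmod z ^ k)" for k r
    by (intro set_integrable_ball_continuous continuous_intros)
  have I0: "I 0 1 = pi"
  proof -
    have "measure lborel (ball (0::complex) 1) = pi"
      using content_ball[of 1 "0::complex"] by (simp add: unit_ball_vol_2)
    then show ?thesis by (simp add: I_def set_lebesgue_integral_def)
  qed
  have scale: "I k r = r ^ (2 * k + 2) * I k 1" if "r > 0" for k r
    unfolding I_def using radial_integral_ball_scale[OF that] by simp
  have annulus: "I k 1 - I k r = (LINT z:(ball 0 1 - ball 0 r :: complex set)|lborel. cmod z ^ (2 * k))"
    if "r < 1" for k r
  proof -
    have "ball (0::complex) 1 = (ball 0 1 - ball 0 r) \<union> ball 0 r" using that by auto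
    then have "I k 1 = (LINT z:(ball 0 1 - ball 0 r) \<union> ball 0 r :: complex set|lborel. cmod z ^ (2 * k))"
      by (simp add: I_def)
    also have "\<dots> = (LINT z:(ball 0 1 - ball 0 r :: complex set)|lborel. cmod z ^ (2 * k)) + I k r"
      unfolding I_def by (rule set_integral_Un) (auto intro: set_integrable_subset[OF int] int)
    finally show ?thesis by simp
  qed
  have intA: "set_integrable lborel (ball 0 1 - ball 0 r :: complex set) (\<lambda>z. cmod z ^ k)" for k r
    by (rule set_integrable_subset[OF int]) auto
  \<comment> \<open>With \<open>x = r\<^sup>2\<close> every term of the estimate carries the factor
    \<open>1 - x\<close>; the geometric sum makes it explicit, so that it cancels before the limit
    is taken.\<close>
  have bounds: "x ^ n * pi \<le> I n 1 * (\<Sum>k\<le>n. x ^ k) \<and> I n 1 * (\<Sum>k\<le>n. x ^ k) \<le> pi"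
    if x: "0 < x" "x < 1" for x :: real
  proof -
    define r where "r = sqrt x"
    have r: "0 < r" "r < 1" "r\<^sup>2 = x" using x by (auto simp: r_def real_sqrt_lt_1_iff)
    have rp: "r ^ (2 * k + 2) = x ^ (k + 1)" for k
      using r(3) by (simp flip: power_mult power_add add: power_add power_mult power2_eq_square[symmetric])
    have geo: "1 - x ^ (n + 1) = (1 - x) * (\<Sum>k\<le>n. x ^ k)"
      using one_diff_power_eq[of x "n + 1"] by (simp add: lessThan_Suc_atMost)
    have An: "I n 1 - I n r = (1 - x) * (I n 1 * (\<Sum>k\<le>n. x ^ k))"
    proof -
      have "I n 1 - I n r = (1 - x ^ (n + 1)) * I n 1"
        using scale[OF r(1), of n] rp[of n] by (simp add: left_diff_distrib)
      then show ?thesis unfolding geo by simp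
    qed
    have A0: "I 0 1 - I 0 r = (1 - x) * pi"
      using scale[OF r(1), of 0] rp[of 0] I0 by (simp add: algebra_simps)
    have "x ^ n * (I 0 1 - I 0 r) \<le> I n 1 - I n r"
      unfolding annulus[OF r(2)] set_integral_mult_right[symmetric]
    proof (rule set_integral_mono)
      show "x ^ n * cmod z ^ (2 * 0) \<le> cmod z ^ (2 * n)" if "z \<in> ball 0 1 - ball 0 r" for z
        using that r by (auto simp: power_mult intro!: power_mono)
    qed (rule set_integrable_mult_right intA impI)+
    moreover have "I n 1 - I n r \<le> I 0 1 - I 0 r"
      unfolding annulus[OF r(2)]
      by (rule set_integral_mono) (use intA[of r 0] intA in \<open>auto intro!: power_le_one\<close>)
    ultimately have "(1 - x) * (x ^ n * pi) \<le> (1 - x) * (I n 1 * (\<Sum>k\<le>n. x ^ k))"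
      "(1 - x) * (I n 1 * (\<Sum>k\<le>n. x ^ k)) \<le> (1 - x) * pi"
      unfolding An A0 by (simp_all add: mult.left_commute)
    then show ?thesis using x by (simp only: mult_le_cancel_left_pos diff_gt_0_iff_gt)
  qed
  have l1: "((\<lambda>x::real. x ^ n * pi) \<longlongrightarrow> 1 ^ n * pi) (at_left 1)"
    and l2: "((\<lambda>x::real. I n 1 * (\<Sum>k\<le>n. x ^ k)) \<longlongrightarrow> I n 1 * (\<Sum>k\<le>n. 1 ^ k)) (at_left 1)"
    by (intro tendsto_intros)+
  have "\<forall>\<^sub>F x in at_left (1::real). 0 < x \<and> x < 1"
    using eventually_at_left_real[of 0 1] by (auto elim: eventually_mono)
  then have ev: "\<forall>\<^sub>F x in at_left 1. x ^ n * pi \<le> I n 1 * (\<Sum>k\<le>n. x ^ k)"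
    "\<forall>\<^sub>F x in at_left 1. I n 1 * (\<Sum>k\<le>n. x ^ k) \<le> pi"
    by (rule eventually_mono; use bounds in blast)+
  have "1 ^ n * pi \<le> I n 1 * (\<Sum>k\<le>n. 1 ^ k)"
    by (rule tendsto_le[OF _ l2 l1 ev(1)]) simp
  moreover have "I n 1 * (\<Sum>k\<le>n. 1 ^ k) \<le> pi"
    by (rule tendsto_upperbound[OF l2 ev(2)]) simp
  ultimately have "I n 1 * (\<Sum>k\<le>n. 1 ^ k) = pi" by simp
  then have "I n 1 * (n + 1) = pi" by simp
  then show ?thesis unfolding I_def by (simp add: field_simps)
qed

lemma monomial_integral_ball_eq:
  assumes "r > 0"
  shows "(LINT z:ball 0 r|lborel. z ^ n * cnj z ^ n) = of_real (pi * r ^ (2 * n + 2) / (n + 1))"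
proof -
  have "z ^ n * cnj z ^ n = complex_of_real (cmod z ^ (2 * n))" for z
  proof -
    have "complex_of_real (cmod z ^ (2 * n)) = complex_of_real ((cmod z)\<^sup>2) ^ n"
      by (simp add: power_mult)
    then show ?thesis unfolding complex_norm_square by (simp add: power_mult_distrib)
  qed
  then have "(LINT z:ball 0 r|lborel. z ^ n * cnj z ^ n)
      = complex_of_real (LINT z:ball (0::complex) r|lborel. cmod z ^ (2 * n))"
    by (simp only: set_integral_complex_of_real)
  then show ?thesis
    using radial_integral_ball_scale[OF assms, of "2 * n"] radial_integral_unit_ball[of n]
    by (simp add: algebra_simps)
qed


subsection \<open>The Bergman space as a Hilbert space\<close>

text \<open>Termwise integration of the power series; by rotation only the term \<open>j = n\<close>
  survives. The radius stays below \<open>R\<close> so that the series converges absolutely and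
  uniformly on the ball.\<close>

lemma taylor_coefficient_integral:
  assumes f: "f holomorphic_on ball 0 R" and r: "0 < r" "r < R"
  shows "(LINT z:ball 0 r|lborel. f z * cnj z ^ n)
       = (deriv ^^ n) f 0 / fact n * of_real (pi * r ^ (2 * n + 2) / (n + 1))"
proof -
  define a where "a j = (deriv ^^ j) f 0 / fact j" for j
  have sums: "(\<lambda>j. a j * z ^ j) sums f z" if "z \<in> ball 0 R" for z
    using holomorphic_power_series[OF f that] by (simp add: a_def)
  \<comment> \<open>Convergence at the midpoint gives absolute convergence at the smaller radius
    \<open>r\<close>.\<close>
  have "of_real ((r + R) / 2) \<in> ball (0::complex) R"
    using r by (simp only: mem_ball dist_0_norm norm_of_real) auto
  then have "summable (\<lambda>j. a j * of_real ((r + R) / 2) ^ j)" using sums sums_summable by blast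
  then have sm: "summable (\<lambda>j. norm (a j * of_real r ^ j))"
    by (rule powser_insidea) (use r in \<open>simp only: norm_of_real, auto\<close>)
  define F where "F j = (\<lambda>z. indicator (ball 0 r) z *\<^sub>R (a j * (z ^ j * cnj z ^ n)))" for j
  have int: "integrable lborel (F j)" for j
    unfolding F_def set_integrable_def[symmetric]
    by (intro set_integrable_ball_continuous continuous_intros)
  have bound: "norm (F j z) \<le> norm (a j * of_real r ^ j) * r ^ n" for j z
  proof (cases "z \<in> ball 0 r")
    case True
    then have "norm z ^ j * norm z ^ n \<le> r ^ j * r ^ n"
      using r by (intro mult_mono power_mono) auto
    then show ?thesis using True r
      by (simp add: F_def norm_mult norm_power mult_left_mono mult.assoc)
  qed (use r in \<open>auto simp: F_def\<close>)
  have bound': "norm (F j z) \<le> norm (a j * of_real r ^ j) * r ^ n * indicator (ball 0 r) z" for j z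
    using bound[of j z] by (auto simp: F_def indicator_def)
  have s1: "summable (\<lambda>j. norm (F j z))" for z
    by (rule summable_comparison_test'[OF summable_mult2[OF sm]]) (use bound in auto)
  have "(LINT z|lborel. norm (F j z)) \<le> norm (a j * of_real r ^ j) * (r ^ n * measure lborel (ball (0::complex) r))" for j
  proof -
    have "(LINT z|lborel. norm (F j z)) \<le> (LINT z|lborel. norm (a j * of_real r ^ j) * r ^ n * indicator (ball (0::complex) r) z)"
      using emeasure_bounded_finite[OF bounded_ball, of "0::complex" r]
      by (intro integral_mono integrable_norm int bound' integrable_mult_right integrable_real_indicator) auto
    then show ?thesis by (simp add: mult.assoc)
  qed
  then have s2: "summable (\<lambda>j. LINT z|lborel. norm (F j z))"
    by (intro summable_comparison_test'[OF summable_mult2[OF sm]]) auto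
  have "(LINT z:ball 0 r|lborel. f z * cnj z ^ n) = (LINT z|lborel. (\<Sum>j. F j z))"
    unfolding set_lebesgue_integral_def
  proof (rule Bochner_Integration.integral_cong[OF refl])
    fix z :: complex
    show "indicator (ball 0 r) z *\<^sub>R (f z * cnj z ^ n) = (\<Sum>j. F j z)"
    proof (cases "z \<in> ball 0 r")
      case True
      then have "(\<lambda>j. a j * z ^ j * cnj z ^ n) sums (f z * cnj z ^ n)"
        using r by (intro sums_mult2 sums) auto
      then show ?thesis using True by (simp add: F_def sums_iff mult.assoc)
    qed (simp add: F_def)
  qed
  also have "\<dots> = (\<Sum>j. LINT z|lborel. F j z)"
    by (rule integral_suminf) (use int s1 s2 in auto)
  also have "\<dots> = (\<Sum>j. if j = n then a n * of_real (pi * r ^ (2 * n + 2) / (n + 1)) else 0)"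
  proof (intro arg_cong[of _ _ suminf] ext)
    fix j
    have "(LINT z|lborel. F j z) = a j * (LINT z:ball 0 r|lborel. z ^ j * cnj z ^ n)"
      unfolding F_def set_lebesgue_integral_def[symmetric] by simp
    then show "(LINT z|lborel. F j z) = (if j = n then a n * of_real (pi * r ^ (2 * n + 2) / (n + 1)) else 0)"
      using monomial_integral_ball_neq[of j n r] monomial_integral_ball_eq[OF r(1), of n] by simp
  qed
  also have "\<dots> = a n * of_real (pi * r ^ (2 * n + 2) / (n + 1))"
    using suminf_finite[of "{n}" "\<lambda>j. if j = n then a n * of_real (pi * r ^ (2 * n + 2) / (n + 1)) else 0"]
    by simp
  finally show ?thesis by (simp add: a_def)
qed

lemma measurable_cnj [measurable]: "cnj \<in> borel_measurable borel"
  by (intro borel_measurable_continuous_onI continuous_intros)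

text \<open>The ambient space of the products \<open>\<phi> f\<close> before projection. Vanishing
  off the disk lets all integrals run over the plane.\<close>

definition L2_disk :: "(complex \<Rightarrow> complex) \<Rightarrow> bool" where
  "L2_disk g \<longleftrightarrow> g \<in> borel_measurable borel \<and> integrable lborel (\<lambda>z. (cmod (g z))\<^sup>2) \<and> (\<forall>z. z \<notin> diskD \<longrightarrow> g z = 0)"

lemma measurable_extend_zero:
  fixes g :: "complex \<Rightarrow> complex"
  assumes "continuous_on diskD g" "\<And>z. z \<notin> diskD \<Longrightarrow> g z = 0"
  shows "g \<in> borel_measurable borel"
proof -
  have "(\<lambda>z. indicator diskD z *\<^sub>R g z) \<in> borel_measurable borel"
    using assms(1) by (intro borel_measurable_continuous_on_indicator) (auto simp: diskD_def)
  moreover have "(\<lambda>z. indicator diskD z *\<^sub>R g z) = g"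
    using assms(2) by (auto simp: indicator_def fun_eq_iff)
  ultimately show ?thesis by simp
qed

lemma bergman_iff: "f \<in> bergman \<longleftrightarrow> f holomorphic_on diskD \<and> L2_disk f"
proof -
  have "(\<lambda>z. indicator diskD z *\<^sub>R (cmod (f z))\<^sup>2) = (\<lambda>z. (cmod (f z))\<^sup>2)" if "\<forall>z. z \<notin> diskD \<longrightarrow> f z = 0"
    using that by (auto simp: indicator_def fun_eq_iff)
  then show ?thesis
    unfolding bergman_def L2_disk_def set_integrable_def
    using measurable_extend_zero[of f] by (auto simp: holomorphic_on_imp_continuous_on)
qed

lemma bergman_L2: "f \<in> bergman \<Longrightarrow> L2_disk f"
  by (simp add: bergman_iff)

lemma set_integral_disk:
  fixes F :: "complex \<Rightarrow> 'b::{banach, second_countable_topology}"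
  assumes "\<And>z. z \<notin> diskD \<Longrightarrow> F z = 0"
  shows "(LINT z:diskD|lborel. F z) = (LINT z|lborel. F z)"
  unfolding set_lebesgue_integral_def using assms
  by (intro Bochner_Integration.integral_cong) (auto simp: indicator_def)

lemma bnorm_eq:
  assumes "L2_disk f"
  shows "bnorm f = sqrt ((LINT z|lborel. (cmod (f z))\<^sup>2) / pi)"
  unfolding bnorm_def using assms by (subst set_integral_disk) (auto simp: L2_disk_def)

lemma bnorm_power2:
  assumes "L2_disk f"
  shows "(bnorm f)\<^sup>2 = (LINT z|lborel. (cmod (f z))\<^sup>2) / pi"
  using assms by (simp add: bnorm_eq)

lemma bnorm_nonneg: "L2_disk f \<Longrightarrow> 0 \<le> bnorm f"
  by (simp add: bnorm_eq)

lemma L2_disk_mult_integrable: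
  assumes "L2_disk f" "L2_disk g"
  shows "integrable lborel (\<lambda>z. f z * cnj (g z))"
proof (rule Bochner_Integration.integrable_bound)
  show "integrable lborel (\<lambda>z. (cmod (f z))\<^sup>2 + (cmod (g z))\<^sup>2)"
    using assms by (auto simp: L2_disk_def)
  have [measurable]: "f \<in> borel_measurable borel" "g \<in> borel_measurable borel"
    using assms by (auto simp: L2_disk_def)
  show "(\<lambda>z. f z * cnj (g z)) \<in> borel_measurable lborel" by measurable
  show "AE z in lborel. norm (f z * cnj (g z)) \<le> norm ((cmod (f z))\<^sup>2 + (cmod (g z))\<^sup>2)"
  proof (rule AE_I2)
    fix z
    have "2 * (cmod (f z) * cmod (g z)) \<le> (cmod (f z))\<^sup>2 + (cmod (g z))\<^sup>2"
      using sum_squares_bound[of "cmod (f z)" "cmod (g z)"] by simp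
    moreover have "0 \<le> cmod (f z) * cmod (g z)" by simp
    ultimately have "cmod (f z) * cmod (g z) \<le> (cmod (f z))\<^sup>2 + (cmod (g z))\<^sup>2" by linarith
    then show "norm (f z * cnj (g z)) \<le> norm ((cmod (f z))\<^sup>2 + (cmod (g z))\<^sup>2)"
      by (simp add: norm_mult)
  qed
qed

lemma L2_disk_add:
  assumes "L2_disk f" "L2_disk g"
  shows "L2_disk (\<lambda>z. f z + g z)"
  unfolding L2_disk_def
proof (intro conjI)
  show [measurable]: "(\<lambda>z. f z + g z) \<in> borel_measurable borel"
    using assms by (auto simp: L2_disk_def)
  show "integrable lborel (\<lambda>z. (cmod (f z + g z))\<^sup>2)"
  proof (rule Bochner_Integration.integrable_bound)
    show "integrable lborel (\<lambda>z. 2 * (cmod (f z))\<^sup>2 + 2 * (cmod (g z))\<^sup>2)"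
      using assms by (auto simp: L2_disk_def)
    show "AE z in lborel. norm ((cmod (f z + g z))\<^sup>2) \<le> norm (2 * (cmod (f z))\<^sup>2 + 2 * (cmod (g z))\<^sup>2)"
    proof (rule AE_I2)
      fix z
      have "(cmod (f z + g z))\<^sup>2 \<le> (cmod (f z) + cmod (g z))\<^sup>2"
        by (intro power_mono norm_triangle_ineq) auto
      also have "\<dots> \<le> 2 * (cmod (f z))\<^sup>2 + 2 * (cmod (g z))\<^sup>2"
        using sum_squares_bound[of "cmod (f z)" "cmod (g z)"] by (simp add: power2_sum)
      finally show "norm ((cmod (f z + g z))\<^sup>2) \<le> norm (2 * (cmod (f z))\<^sup>2 + 2 * (cmod (g z))\<^sup>2)"
        by simp
    qed
  qed measurable
qed (use assms in \<open>auto simp: L2_disk_def\<close>)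

lemma L2_disk_mult_bounded:
  assumes "L2_disk f" "continuous_on diskD \<phi>" "\<And>z. z \<in> diskD \<Longrightarrow> cmod (\<phi> z) \<le> C"
  shows "L2_disk (\<lambda>z. \<phi> z * f z)" "bnorm (\<lambda>z. \<phi> z * f z) \<le> C * bnorm f"
proof -
  have C: "0 \<le> C" by (rule order_trans[OF norm_ge_zero assms(3)[of 0]]) (simp add: diskD_def)
  have f[measurable]: "f \<in> borel_measurable borel" and f0: "\<And>z. z \<notin> diskD \<Longrightarrow> f z = 0"
    and fi: "integrable lborel (\<lambda>z. (cmod (f z))\<^sup>2)"
    using assms(1) by (auto simp: L2_disk_def)
  \<comment> \<open>The symbol is controlled on the disk only; cutting it off there gives a Borel
    function with the same product with \<open>f\<close>.\<close>
  define \<psi> where "\<psi> z = (if z \<in> diskD then \<phi> z else 0)" for z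
  have \<psi>[measurable]: "\<psi> \<in> borel_measurable borel"
    by (rule measurable_extend_zero)
       (use assms(2) in \<open>auto simp: \<psi>_def cong: continuous_on_cong\<close>)
  have eq: "(\<lambda>z. \<phi> z * f z) = (\<lambda>z. \<psi> z * f z)"
    using f0 by (auto simp: \<psi>_def)
  have le: "(cmod (\<phi> z * f z))\<^sup>2 \<le> C\<^sup>2 * (cmod (f z))\<^sup>2" for z
  proof (cases "z \<in> diskD")
    case True
    then have "cmod (\<phi> z * f z) \<le> C * cmod (f z)"
      using assms(3) by (simp add: norm_mult mult_right_mono)
    then show ?thesis by (metis norm_ge_zero power_mono power_mult_distrib)
  qed (use f0 in auto)
  have m: "(\<lambda>z. \<phi> z * f z) \<in> borel_measurable borel"
    unfolding eq by measurable
  have i: "integrable lborel (\<lambda>z. (cmod (\<phi> z * f z))\<^sup>2)"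
  proof (rule Bochner_Integration.integrable_bound)
    show "integrable lborel (\<lambda>z. C\<^sup>2 * (cmod (f z))\<^sup>2)" using fi by simp
  qed (use le m in auto)
  show L: "L2_disk (\<lambda>z. \<phi> z * f z)"
    unfolding L2_disk_def using m i f0 by auto
  have "(LINT z|lborel. (cmod (\<phi> z * f z))\<^sup>2) \<le> (LINT z|lborel. C\<^sup>2 * (cmod (f z))\<^sup>2)"
    using fi i le by (intro integral_mono) auto
  then have "(bnorm (\<lambda>z. \<phi> z * f z))\<^sup>2 \<le> (C * bnorm f)\<^sup>2"
    unfolding power_mult_distrib bnorm_power2[OF assms(1)] bnorm_power2[OF L]
    by (simp add: divide_right_mono)
  then show "bnorm (\<lambda>z. \<phi> z * f z) \<le> C * bnorm f"
    using C bnorm_nonneg[OF assms(1)] by (auto intro: power2_le_imp_le)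
qed

lemma L2_disk_cmult: "L2_disk f \<Longrightarrow> L2_disk (\<lambda>z. c * f z)"
  using L2_disk_mult_bounded(1)[of f "\<lambda>_. c" "cmod c"] by auto

lemma bergman_lincomb:
  assumes "f \<in> bergman" "g \<in> bergman"
  shows "(\<lambda>z. a * f z + b * g z) \<in> bergman"
  using assms by (auto simp: bergman_iff intro!: holomorphic_intros L2_disk_add L2_disk_cmult)

text \<open>The mean value property is applied to \<open>f\<^sup>2\<close>, which bounds
  \<open>(cmod (f a))\<^sup>2\<close> by an average of \<open>(cmod (f z))\<^sup>2\<close> directly,
  without Cauchy-Schwarz.\<close>

lemma bergman_point_bound:
  assumes f: "f \<in> bergman" and a: "0 < r" "cmod a + r < 1"
  shows "cmod (f a) * r \<le> bnorm f"
proof -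
  define G where "G = (\<lambda>z. (f z)\<^sup>2)"
  have hol: "f holomorphic_on diskD" and L: "L2_disk f"
    using f by (auto simp: bergman_iff)
  have sub: "(\<lambda>z. a + z) ` ball 0 (1 - cmod a) \<subseteq> diskD"
  proof
    fix w assume "w \<in> (\<lambda>z. a + z) ` ball 0 (1 - cmod a)"
    then have "dist w a < 1 - cmod a" by (auto simp: dist_norm norm_minus_commute)
    then show "w \<in> diskD" using norm_triangle_sub[of w a] by (simp add: diskD_def dist_norm)
  qed
  have "(f \<circ> (\<lambda>z. a + z)) holomorphic_on ball 0 (1 - cmod a)"
    by (rule holomorphic_on_compose_gen[OF _ hol sub]) (intro holomorphic_intros)
  then have "(\<lambda>z. G (a + z)) holomorphic_on ball 0 (1 - cmod a)"
    by (auto simp: G_def o_def intro!: holomorphic_intros)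
  from taylor_coefficient_integral[OF this a(1), of 0] a(2)
  have "(LINT z:ball 0 r|lborel. G (a + z)) = G a * of_real (pi * r\<^sup>2)"
    by (simp add: power2_eq_square)
  then have "cmod (G a) * (pi * r\<^sup>2) = cmod (LINT z:ball 0 r|lborel. G (a + z))"
    by (simp add: norm_mult norm_power)
  also have "\<dots> \<le> (LINT z|lborel. norm (indicator (ball 0 r) z *\<^sub>R G (a + z)))"
    unfolding set_lebesgue_integral_def by (rule integral_norm_bound)
  also have "\<dots> \<le> (LINT z|lborel. (cmod (f (a + z)))\<^sup>2)"
  proof (rule integral_mono_AE')
    have "integrable (distr lborel borel ((+) a)) (\<lambda>z. (cmod (f z))\<^sup>2)"
      using L by (simp add: lborel_distr_plus L2_disk_def)
    then show "integrable lborel (\<lambda>z. (cmod (f (a + z)))\<^sup>2)"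
      using L by (subst (asm) integrable_distr_eq) (auto simp: L2_disk_def)
  qed (auto simp: G_def norm_power indicator_def)
  also have "\<dots> = (LINT z|distr lborel borel ((+) a). (cmod (f z))\<^sup>2)"
    using L by (subst integral_distr) (auto simp: L2_disk_def)
  also have "\<dots> = pi * (bnorm f)\<^sup>2"
    using L by (simp add: lborel_distr_plus bnorm_power2)
  finally have "pi * (cmod (f a) * r)\<^sup>2 \<le> pi * (bnorm f)\<^sup>2"
    by (simp add: G_def norm_power power_mult_distrib mult_ac)
  then have "(cmod (f a) * r)\<^sup>2 \<le> (bnorm f)\<^sup>2" by simp
  then show ?thesis using bnorm_nonneg[OF L] by (rule power2_le_imp_le)
qed

text \<open>Fatou's lemma: a norm bound survives a merely pointwise limit.\<close>

lemma bergman_fatou: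
  assumes v: "\<And>n::nat. v n \<in> bergman" "\<And>n. bnorm (v n) \<le> M"
    and lim: "\<And>z. z \<in> diskD \<Longrightarrow> (\<lambda>n. v n z) \<longlonglongrightarrow> g z"
    and g: "g holomorphic_on diskD" "\<And>z. z \<notin> diskD \<Longrightarrow> g z = 0"
  shows "g \<in> bergman" "bnorm g \<le> M"
proof -
  have L: "L2_disk (v n)" for n using v(1) by (rule bergman_L2)
  have M: "0 \<le> M" using bnorm_nonneg[OF L] v(2) order_trans by blast
  have gm[measurable]: "g \<in> borel_measurable borel"
    using g by (intro measurable_extend_zero holomorphic_on_imp_continuous_on)
  have vm[measurable]: "v n \<in> borel_measurable borel" for n
    using L by (auto simp: L2_disk_def)
  have lim': "(\<lambda>n. v n z) \<longlonglongrightarrow> g z" for z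
    using lim[of z] g(2)[of z] L by (cases "z \<in> diskD") (auto simp: L2_disk_def)
  have "(\<integral>\<^sup>+z. ennreal ((cmod (g z))\<^sup>2) \<partial>lborel) = (\<integral>\<^sup>+z. liminf (\<lambda>n. ennreal ((cmod (v n z))\<^sup>2)) \<partial>lborel)"
  proof (rule nn_integral_cong)
    fix z
    have "(\<lambda>n. ennreal ((cmod (v n z))\<^sup>2)) \<longlonglongrightarrow> ennreal ((cmod (g z))\<^sup>2)"
      by (intro tendsto_intros lim')
    then show "ennreal ((cmod (g z))\<^sup>2) = liminf (\<lambda>n. ennreal ((cmod (v n z))\<^sup>2))"
      using lim_imp_Liminf[of sequentially] by (metis sequentially_bot)
  qed
  also have "\<dots> \<le> liminf (\<lambda>n. \<integral>\<^sup>+z. ennreal ((cmod (v n z))\<^sup>2) \<partial>lborel)"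
    by (rule nn_integral_liminf) measurable
  also have "\<dots> \<le> ennreal (pi * M\<^sup>2)"
  proof (rule Liminf_le[OF sequentially_bot], rule always_eventually, rule allI)
    fix n
    have "(\<integral>\<^sup>+z. ennreal ((cmod (v n z))\<^sup>2) \<partial>lborel) = ennreal (LINT z|lborel. (cmod (v n z))\<^sup>2)"
      using L by (intro nn_integral_eq_integral) (auto simp: L2_disk_def)
    also have "(LINT z|lborel. (cmod (v n z))\<^sup>2) = pi * (bnorm (v n))\<^sup>2"
      using bnorm_power2[OF L] by simp
    also have "\<dots> \<le> pi * M\<^sup>2"
      using v(2) bnorm_nonneg[OF L] by (intro mult_left_mono power_mono) auto
    finally show "(\<integral>\<^sup>+z. ennreal ((cmod (v n z))\<^sup>2) \<partial>lborel) \<le> ennreal (pi * M\<^sup>2)"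
      by (simp add: ennreal_leI)
  qed
  finally have le: "(\<integral>\<^sup>+z. ennreal ((cmod (g z))\<^sup>2) \<partial>lborel) \<le> ennreal (pi * M\<^sup>2)" .
  have i: "integrable lborel (\<lambda>z. (cmod (g z))\<^sup>2)"
    by (rule integrableI_nonneg) (use le in \<open>auto simp: top_unique less_top intro: le_less_trans\<close>)
  then have gL: "L2_disk g" unfolding L2_disk_def using g by auto
  then show "g \<in> bergman" using g by (simp add: bergman_iff)
  have "ennreal (LINT z|lborel. (cmod (g z))\<^sup>2) \<le> ennreal (pi * M\<^sup>2)"
    using le nn_integral_eq_integral[OF i] by simp
  then have "(LINT z|lborel. (cmod (g z))\<^sup>2) \<le> pi * M\<^sup>2"
    by (simp add: ennreal_le_iff)
  then have "(bnorm g)\<^sup>2 \<le> M\<^sup>2"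
    by (simp add: bnorm_power2[OF gL] field_simps)
  then show "bnorm g \<le> M" using M by (rule power2_le_imp_le)
qed

lemma bergman_compact_bound:
  assumes "compact K" "K \<subseteq> diskD"
  obtains C where "C > 0" "\<And>f z. f \<in> bergman \<Longrightarrow> z \<in> K \<Longrightarrow> cmod (f z) \<le> C * bnorm f"
proof -
  have "\<exists>s<1. \<forall>z\<in>K. cmod z \<le> s"
  proof (cases "K = {}")
    case False
    then obtain w where "w \<in> K" "\<forall>z\<in>K. cmod z \<le> cmod w"
      using continuous_attains_sup[OF assms(1), of cmod] continuous_on_norm_id by blast
    then show ?thesis using assms(2) by (auto simp: diskD_def intro!: exI[of _ "cmod w"])
  qed (auto intro!: exI[of _ 0])
  then obtain s where s: "s < 1" "\<forall>z\<in>K. cmod z \<le> s" by blast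
  show ?thesis
  proof
    show "2 / (1 - s) > 0" using s by simp
    fix f z assume "f \<in> bergman" "z \<in> K"
    then have "cmod (f z) * ((1 - s) / 2) \<le> bnorm f"
      using s by (intro bergman_point_bound) (auto simp: field_simps intro: le_less_trans[of _ "s * 2 + (1 - s)"])
    then show "cmod (f z) \<le> 2 / (1 - s) * bnorm f" using s(1) by (simp add: field_simps)
  qed
qed

text \<open>Takes the place of weak compactness of bounded sets. The point bounds make the sequence
  locally bounded, Montel's theorem extracts a locally uniform limit, and Fatou returns it to the
  space.\<close>

lemma bergman_montel:
  assumes u: "\<And>n::nat. u n \<in> bergman" "\<And>n. bnorm (u n) \<le> M"
  obtains r g where "strict_mono r" "g \<in> bergman"
    "\<And>K. compact K \<Longrightarrow> K \<subseteq> diskD \<Longrightarrow> uniform_limit K (\<lambda>n. u (r n)) g sequentially"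
    "\<And>z. (\<lambda>n. u (r n) z) \<longlonglongrightarrow> g z"
proof -
  have op: "open diskD" by (simp add: diskD_def)
  have hol: "\<And>h. h \<in> range u \<Longrightarrow> h holomorphic_on diskD"
    using u by (auto simp: bergman_iff)
  have bd: "\<exists>B. \<forall>h\<in>range u. \<forall>z\<in>K. norm (h z) \<le> B" if K: "compact K" "K \<subseteq> diskD" for K
  proof -
    obtain C where C: "C > 0" "\<And>f z. f \<in> bergman \<Longrightarrow> z \<in> K \<Longrightarrow> cmod (f z) \<le> C * bnorm f"
      using bergman_compact_bound[OF K] by blast
    have "norm (u n z) \<le> C * M" if "z \<in> K" for n z
      using C(2)[OF u(1) that, of n] mult_left_mono[OF u(2)[of n], of C] C(1) by linarith
    then show ?thesis by blast
  qed
  obtain g r where g: "g holomorphic_on diskD" "strict_mono (r :: nat \<Rightarrow> nat)"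
      "\<And>x. x \<in> diskD \<Longrightarrow> (\<lambda>n. u (r n) x) \<longlonglongrightarrow> g x"
      "\<And>K. \<lbrakk>compact K; K \<subseteq> diskD\<rbrakk> \<Longrightarrow> uniform_limit K (u \<circ> r) g sequentially"
    by (rule Montel[OF op hol bd subset_refl]; (rule that; assumption)?)
  define g' where "g' z = (if z \<in> diskD then g z else 0)" for z
  have g': "g' holomorphic_on diskD"
    using g(1) by (rule holomorphic_transform) (auto simp: g'_def)
  have lim: "(\<lambda>n. u (r n) z) \<longlonglongrightarrow> g' z" for z
    using g(3)[of z] u(1) by (cases "z \<in> diskD") (auto simp: g'_def bergman_def)
  show ?thesis
  proof
    show "strict_mono r" by fact
    show "g' \<in> bergman"
      by (rule bergman_fatou(1)[OF u(1) u(2) lim g']) (simp add: g'_def)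
    show "uniform_limit K (\<lambda>n. u (r n)) g' sequentially" if "compact K" "K \<subseteq> diskD" for K
      using g(4)[OF that] that(2)
      by (subst uniform_limit_cong'[of K _ "u \<circ> r" _ g]) (auto simp: g'_def)
    show "\<And>z. (\<lambda>n. u (r n) z) \<longlonglongrightarrow> g' z" by (rule lim)
  qed
qed


section \<open>The Bergman space as a Banach space type\<close>

lemma zero_in_bergman: "(\<lambda>z. 0) \<in> bergman"
  by (auto simp: bergman_iff L2_disk_def)

text \<open>Operators on the set \<open>bergman\<close> become maps of a type, so that the results
  on Banach spaces apply. The inner product below is the real part of the Hermitian one and the
  scalars are real; complex multiples are taken on the underlying functions.\<close>

typedef berg = bergman morphisms bfun Bfun
  using zero_in_bergman by blast

lemma bergman_add: "f \<in> bergman \<Longrightarrow> g \<in> bergman \<Longrightarrow> (\<lambda>z. f z + g z) \<in> bergman"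
  using bergman_lincomb[of f g 1 1] by simp

lemma bergman_diff: "f \<in> bergman \<Longrightarrow> g \<in> bergman \<Longrightarrow> (\<lambda>z. f z - g z) \<in> bergman"
  using bergman_lincomb[of f g 1 "-1"] by simp

lemma bergman_cmult: "f \<in> bergman \<Longrightarrow> (\<lambda>z. c * f z) \<in> bergman"
  using bergman_lincomb[of f f c 0] by simp

lemma bfun_L2: "L2_disk (bfun f)"
  using bfun[of f] by (rule bergman_L2)

lemma bfun_outside: "z \<notin> diskD \<Longrightarrow> bfun f z = 0"
  using bfun_L2[of f] by (auto simp: L2_disk_def)

instantiation berg :: real_inner
begin

definition zero_berg :: berg where "zero_berg = Bfun (\<lambda>z. 0)"
definition plus_berg :: "berg \<Rightarrow> berg \<Rightarrow> berg" where "plus_berg f g = Bfun (\<lambda>z. bfun f z + bfun g z)"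
definition minus_berg :: "berg \<Rightarrow> berg \<Rightarrow> berg" where "minus_berg f g = Bfun (\<lambda>z. bfun f z - bfun g z)"
definition uminus_berg :: "berg \<Rightarrow> berg" where "uminus_berg f = Bfun (\<lambda>z. (- 1) * bfun f z)"
definition scaleR_berg :: "real \<Rightarrow> berg \<Rightarrow> berg" where "scaleR_berg r f = Bfun (\<lambda>z. of_real r * bfun f z)"
definition inner_berg :: "berg \<Rightarrow> berg \<Rightarrow> real" where
  "inner_berg f g = Re (LINT z|lborel. bfun f z * cnj (bfun g z)) / pi"
definition norm_berg :: "berg \<Rightarrow> real" where "norm_berg f = bnorm (bfun f)"
definition dist_berg :: "berg \<Rightarrow> berg \<Rightarrow> real" where "dist_berg f g = norm (f - g)"
definition sgn_berg :: "berg \<Rightarrow> berg" where "sgn_berg f = inverse (norm f) *\<^sub>R f"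
definition uniformity_berg :: "(berg \<times> berg) filter" where
  "uniformity_berg = (INF e\<in>{0<..}. principal {(x, y). dist x y < e})"
definition open_berg :: "berg set \<Rightarrow> bool" where
  "open_berg U \<longleftrightarrow> (\<forall>x\<in>U. eventually (\<lambda>(x', y). x' = x \<longrightarrow> y \<in> U) uniformity)"

lemma bfun_simps:
  "bfun 0 = (\<lambda>z. 0)"
  "bfun (f + g) = (\<lambda>z. bfun f z + bfun g z)"
  "bfun (f - g) = (\<lambda>z. bfun f z - bfun g z)"
  "bfun (- f) = (\<lambda>z. - bfun f z)"
  "bfun (r *\<^sub>R f) = (\<lambda>z. of_real r * bfun f z)"
  using bergman_cmult[OF bfun, of "-1" f]
  by (simp_all add: zero_berg_def plus_berg_def minus_berg_def uminus_berg_def scaleR_berg_def Bfun_inverse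
      zero_in_bergman bergman_add bergman_diff bergman_cmult bfun)

instance
proof
  fix f g h :: berg and r s :: real
  note eqs = bfun_inject[symmetric] bfun_simps fun_eq_iff
  have int: "integrable lborel (\<lambda>z. bfun f z * cnj (bfun g z))" for f g
    by (rule L2_disk_mult_integrable[OF bfun_L2 bfun_L2])
  show "f + g + h = f + (g + h)" "f + g = g + f" "0 + f = f" "- f + f = 0" "f - g = f + - g"
    "r *\<^sub>R (f + g) = r *\<^sub>R f + r *\<^sub>R g" "(r + s) *\<^sub>R f = r *\<^sub>R f + s *\<^sub>R f"
    "r *\<^sub>R s *\<^sub>R f = (r * s) *\<^sub>R f" "1 *\<^sub>R f = f"
    by (simp_all add: eqs algebra_simps)
  show "dist f g = norm (f - g)" "sgn f = inverse (norm f) *\<^sub>R f"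
    by (simp_all add: dist_berg_def sgn_berg_def)
  show "(uniformity :: (berg \<times> berg) filter) = (INF e\<in>{0<..}. principal {(x, y). dist x y < e})"
    by (rule uniformity_berg_def)
  show "open U \<longleftrightarrow> (\<forall>x\<in>U. eventually (\<lambda>(x', y). x' = x \<longrightarrow> y \<in> U) uniformity)" for U :: "berg set"
    by (rule open_berg_def)
  show "inner f g = inner g f"
  proof -
    have "(LINT z|lborel. bfun f z * cnj (bfun g z)) = cnj (LINT z|lborel. bfun g z * cnj (bfun f z))"
      unfolding Bochner_Integration.integral_cnj[symmetric] by (simp add: mult.commute)
    then show ?thesis by (simp add: inner_berg_def)
  qed
  show "inner (f + g) h = inner f h + inner g h"
    using int by (simp add: inner_berg_def bfun_simps distrib_right add_divide_distrib)
  show "inner (r *\<^sub>R f) g = r * inner f g"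
    using int by (simp add: inner_berg_def bfun_simps mult.assoc)
  have ff: "inner f f = (LINT z|lborel. (cmod (bfun f z))\<^sup>2) / pi" for f
  proof -
    have "(LINT z|lborel. bfun f z * cnj (bfun f z)) = (LINT z|lborel. complex_of_real ((cmod (bfun f z))\<^sup>2))"
      by (simp only: complex_norm_square)
    then have "(LINT z|lborel. bfun f z * cnj (bfun f z)) = complex_of_real (LINT z|lborel. (cmod (bfun f z))\<^sup>2)"
      by (simp only: integral_complex_of_real)
    then show ?thesis by (simp add: inner_berg_def)
  qed
  then show "0 \<le> inner f f" by simp
  show norm: "norm f = sqrt (inner f f)"
    by (simp add: norm_berg_def bnorm_eq[OF bfun_L2] ff)
  show "inner f f = 0 \<longleftrightarrow> f = 0"
  proof
    assume "inner f f = 0"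
    then have 0: "bnorm (bfun f) = 0" using norm by (simp add: norm_berg_def)
    have "bfun f z = 0" for z
    proof (cases "z \<in> diskD")
      case True
      then have "cmod (bfun f z) * ((1 - cmod z) / 2) \<le> bnorm (bfun f)"
        by (intro bergman_point_bound bfun) (auto simp: diskD_def field_simps)
      then show ?thesis using 0 True by (auto simp: mult_le_0_iff diskD_def)
    qed (rule bfun_outside)
    then show "f = 0" by (simp add: eqs)
  qed (simp add: ff bfun_simps)
qed

end

lemma norm_bfun: "norm f = bnorm (bfun f)"
  by (simp add: norm_berg_def)

lemma norm_Bfun: "f \<in> bergman \<Longrightarrow> norm (Bfun f) = bnorm f"
  by (simp add: norm_berg_def Bfun_inverse)

lemma tendsto_bfun:
  assumes "u \<longlonglongrightarrow> g"
  shows "(\<lambda>n. bfun (u n) z) \<longlonglongrightarrow> bfun g z"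
proof (cases "z \<in> diskD")
  case True
  obtain C where C: "C > 0" "\<And>f w. f \<in> bergman \<Longrightarrow> w \<in> {z} \<Longrightarrow> cmod (f w) \<le> C * bnorm f"
    using bergman_compact_bound[of "{z}"] True by auto
  have "cmod (bfun (u n) z - bfun g z) \<le> C * norm (u n - g)" for n
    using C(2)[OF bfun, of z "u n - g"] by (simp add: bfun_simps norm_bfun)
  moreover have "(\<lambda>n. C * norm (u n - g)) \<longlonglongrightarrow> 0"
    using assms by (intro tendsto_mult_right_zero tendsto_norm_zero LIM_zero)
  ultimately have "(\<lambda>n. bfun (u n) z - bfun g z) \<longlonglongrightarrow> 0"
    by (rule Lim_null_comparison[OF always_eventually[OF allI]])
  then show ?thesis by (rule LIM_zero_cancel)
qed (simp add: bfun_outside)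

text \<open>Montel's theorem supplies the candidate for the limit. The Cauchy estimate for
  \<open>u n - u (r (m + N))\<close> passes to the limit in \<open>m\<close> by Fatou, which
  upgrades pointwise to norm convergence.\<close>

instance berg :: banach
proof
  fix u :: "nat \<Rightarrow> berg" assume u: "Cauchy u"
  then obtain M where M: "\<And>n. norm (u n) \<le> M"
    using Cauchy_Bseq Bseq_def by blast
  obtain r g where r: "strict_mono r" "g \<in> bergman"
    and lim: "\<And>z. (\<lambda>n. bfun (u (r n)) z) \<longlonglongrightarrow> g z"
  proof (rule bergman_montel[of "\<lambda>n. bfun (u n)" M])
    show "bfun (u n) \<in> bergman" "bnorm (bfun (u n)) \<le> M" for n
      using M[of n] by (auto simp: norm_bfun bfun)
  qed (rule that; assumption)
  have "u \<longlonglongrightarrow> Bfun g"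
  proof (rule LIMSEQ_I)
    fix e :: real assume "e > 0"
    then obtain N where N: "\<And>m n. m \<ge> N \<Longrightarrow> n \<ge> N \<Longrightarrow> norm (u m - u n) < e / 2"
      using CauchyD[OF u, of "e / 2"] by auto
    have "norm (u n - Bfun g) < e" if n: "n \<ge> N" for n
    proof -
      have "bnorm (\<lambda>z. bfun (u n) z - g z) \<le> e / 2"
      proof (rule bergman_fatou(2)[of "\<lambda>m. bfun (u n - u (r (m + N)))"])
        show "bfun (u n - u (r (m + N))) \<in> bergman" for m by (rule bfun)
        have "r (m + N) \<ge> N" for m
          using seq_suble[OF r(1), of "m + N"] by simp
        then show "bnorm (bfun (u n - u (r (m + N)))) \<le> e / 2" for m
          using N[OF n, of "r (m + N)"] by (simp add: norm_bfun less_imp_le)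
        show "(\<lambda>m. bfun (u n - u (r (m + N))) z) \<longlonglongrightarrow> bfun (u n) z - g z" for z
          unfolding bfun_simps by (intro tendsto_intros LIMSEQ_ignore_initial_segment[OF lim])
        have "(\<lambda>z. bfun (u n) z - g z) \<in> bergman"
          by (intro bergman_diff bfun r)
        then show "(\<lambda>z. bfun (u n) z - g z) holomorphic_on diskD"
          "\<And>z. z \<notin> diskD \<Longrightarrow> bfun (u n) z - g z = 0"
          by (auto simp: bergman_def)
      qed
      then have "norm (u n - Bfun g) \<le> e / 2"
        using r(2) by (simp add: norm_bfun bfun_simps Bfun_inverse)
      then show ?thesis using \<open>e > 0\<close> by simp
    qed
    then show "\<exists>N. \<forall>n\<ge>N. norm (u n - Bfun g) < e" by blast
  qed
  then show "convergent u" by (auto simp: convergent_def)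
qed


subsection \<open>The Bergman projection and Toeplitz operators\<close>

text \<open>The representing vector minimises \<open>\<parallel>x\<parallel>\<^sup>2 - 2 \<phi>(x)\<close>; a minimising sequence is Cauchy by the
  parallelogram law.\<close>
lemma riesz_representation:
  fixes \<phi> :: "'a::{real_inner, banach} \<Rightarrow> real"
  assumes "bounded_linear \<phi>"
  obtains k where "\<And>e. \<phi> e = inner k e"
proof -
  interpret \<phi>: bounded_linear \<phi> by fact
  obtain C where C: "C > 0" "\<And>x. norm (\<phi> x) \<le> norm x * C"
    using \<phi>.pos_bounded by blast
  define J where "J x = (norm x)\<^sup>2 - 2 * \<phi> x" for x
  have below: "- (C\<^sup>2) \<le> J x" for x
  proof -
    have "2 * \<phi> x \<le> 2 * (norm x * C)" using C(2)[of x] by simp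
    also have "\<dots> \<le> (norm x)\<^sup>2 + C\<^sup>2" using sum_squares_bound[of "norm x" C] by simp
    finally show ?thesis by (simp add: J_def)
  qed
  then have bdd: "bdd_below (range J)" by (intro bdd_belowI[of _ "- (C\<^sup>2)"]) auto
  define m where "m = Inf (range J)"
  have m_le: "m \<le> J x" for x
    unfolding m_def by (rule cInf_lower[OF _ bdd]) simp
  have "\<exists>x. J x < m + 1 / Suc n" for n
    using cInf_lessD[of "range J" "m + 1 / Suc n"] by (auto simp: m_def)
  then obtain x where x: "\<And>n. J (x n) < m + 1 / Suc n" by metis
  have par: "(norm (y - z))\<^sup>2 = 2 * J y + 2 * J z - 4 * J ((1/2) *\<^sub>R (y + z))" for y z
  proof -
    have "J ((1/2) *\<^sub>R (y + z)) = (norm (y + z))\<^sup>2 / 4 - \<phi> y - \<phi> z"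
      by (simp add: J_def \<phi>.scaleR \<phi>.add power2_eq_square add_divide_distrib)
    moreover have "(norm (y - z))\<^sup>2 + (norm (y + z))\<^sup>2 = 2 * (norm y)\<^sup>2 + 2 * (norm z)\<^sup>2"
      by (simp add: power2_norm_eq_inner inner_diff_left inner_diff_right inner_add_left inner_add_right)
    ultimately show ?thesis by (simp add: J_def)
  qed
  have dist: "(norm (x i - x j))\<^sup>2 < 4 / Suc N" if "i \<ge> N" "j \<ge> N" for i j N
  proof -
    have "1 / real (Suc i) \<le> 1 / Suc N" "1 / real (Suc j) \<le> 1 / Suc N"
      using that by (auto simp: field_simps)
    then show ?thesis
      using par[of "x i" "x j"] x[of i] x[of j] m_le[of "(1/2) *\<^sub>R (x i + x j)"] by simp
  qed
  have "Cauchy x"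
  proof (rule CauchyI)
    fix e :: real assume e: "e > 0"
    obtain N where N: "4 / e\<^sup>2 < real N" using reals_Archimedean2 by blast
    have "norm (x i - x j) < e" if "i \<ge> N" "j \<ge> N" for i j
    proof -
      have "(norm (x i - x j))\<^sup>2 < 4 / Suc N" by (rule dist[OF that])
      also have "4 / Suc N \<le> e\<^sup>2"
      proof -
        have "4 < real N * e\<^sup>2" using N e by (simp add: field_simps)
        also have "\<dots> \<le> real (Suc N) * e\<^sup>2" by (intro mult_right_mono) auto
        finally show ?thesis by (simp add: field_simps)
      qed
      finally show ?thesis using e by (simp add: power2_less_imp_less)
    qed
    then show "\<exists>M. \<forall>i\<ge>M. \<forall>j\<ge>M. norm (x i - x j) < e" by blast
  qed
  then obtain k where k: "x \<longlonglongrightarrow> k" by (auto simp: Cauchy_convergent_iff convergent_def)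
  have "(\<lambda>n. J (x n)) \<longlonglongrightarrow> J k"
    unfolding J_def by (intro tendsto_intros \<phi>.tendsto k)
  moreover have "(\<lambda>n. m + 1 / Suc n) \<longlonglongrightarrow> m + 0"
    by (intro tendsto_add tendsto_const LIMSEQ_inverse_real_of_nat[unfolded inverse_eq_divide])
  ultimately have Jk: "J k \<le> m"
    using x by (intro LIMSEQ_le[of "\<lambda>n. J (x n)" _ "\<lambda>n. m + 1 / Suc n" m]) (auto intro: less_imp_le)
  have "\<phi> e = inner k e" for e
  proof (rule ccontr)
    define d where "d = inner k e - \<phi> e"
    assume "\<phi> e \<noteq> inner k e"
    then have d: "d \<noteq> 0" by (simp add: d_def)
    then have e: "norm e \<noteq> 0" by (auto simp: d_def \<phi>.zero)
    \<comment> \<open>The minimiser of the quadratic \<open>J\<close> along the line through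
      \<open>k\<close> in direction \<open>e\<close>, if \<open>k\<close> had slope
      \<open>2 * d\<close> there.\<close>
    define t where "t = - d / (norm e)\<^sup>2"
    have "(norm (k + t *\<^sub>R e))\<^sup>2 = (norm k)\<^sup>2 + 2 * t * inner k e + t\<^sup>2 * (norm e)\<^sup>2"
      unfolding power2_norm_eq_inner
      by (simp add: inner_add_left inner_add_right inner_commute[of e k] power2_eq_square distrib_left)
    then have "J (k + t *\<^sub>R e) = J k + t\<^sup>2 * (norm e)\<^sup>2 + 2 * t * d"
      by (simp add: J_def d_def \<phi>.add \<phi>.scaleR algebra_simps)
    also have "\<dots> = J k - d\<^sup>2 / (norm e)\<^sup>2"
      using e by (simp add: t_def field_simps power2_eq_square)
    finally have "J (k + t *\<^sub>R e) < m" using Jk d e by (smt (verit) divide_pos_pos zero_less_power2)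
    then show False using m_le[of "k + t *\<^sub>R e"] by simp
  qed
  then show ?thesis using that by blast
qed

text \<open>The inequality of arithmetic and geometric means in place of Cauchy-Schwarz. It is
  applied to vectors of norm 1, or where half the squared norm can be moved to the other
  side.\<close>

lemma L2_disk_inner_bound:
  assumes "L2_disk f" "L2_disk g"
  shows "cmod (LINT z|lborel. f z * cnj (g z)) \<le> pi * ((bnorm f)\<^sup>2 + (bnorm g)\<^sup>2) / 2"
proof -
  have "cmod (LINT z|lborel. f z * cnj (g z)) \<le> (LINT z|lborel. cmod (f z * cnj (g z)))"
    by (rule integral_norm_bound)
  also have "\<dots> \<le> (LINT z|lborel. ((cmod (f z))\<^sup>2 + (cmod (g z))\<^sup>2) / 2)"
  proof (rule integral_mono)
    show "integrable lborel (\<lambda>z. cmod (f z * cnj (g z)))"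
      by (intro integrable_norm L2_disk_mult_integrable assms)
    show "integrable lborel (\<lambda>z. ((cmod (f z))\<^sup>2 + (cmod (g z))\<^sup>2) / 2)"
      using assms by (auto simp: L2_disk_def)
    show "cmod (f z * cnj (g z)) \<le> ((cmod (f z))\<^sup>2 + (cmod (g z))\<^sup>2) / 2" for z
      using sum_squares_bound[of "cmod (f z)" "cmod (g z)"] by (simp add: norm_mult)
  qed
  also have "\<dots> = pi * ((bnorm f)\<^sup>2 + (bnorm g)\<^sup>2) / 2"
    using assms by (simp add: bnorm_power2 L2_disk_def field_simps)
  finally show ?thesis .
qed

lemma dA_int_L2:
  assumes "L2_disk f" "L2_disk g"
  shows "dA_int (\<lambda>z. f z * cnj (g z)) = (LINT z|lborel. f z * cnj (g z)) / of_real pi"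
  unfolding dA_int_def using assms by (subst set_integral_disk) (auto simp: L2_disk_def)

lemma L2_disk_diff: "L2_disk f \<Longrightarrow> L2_disk g \<Longrightarrow> L2_disk (\<lambda>z. f z - g z)"
  using L2_disk_add[of f "\<lambda>z. (-1) * g z"] L2_disk_cmult[of g "-1"] by simp

lemma L2_disk_orthogonal_iff:
  assumes "L2_disk g" "L2_disk h" "L2_disk k"
  shows "dA_int (\<lambda>z. (g z - h z) * cnj (k z)) = 0 \<longleftrightarrow>
         (LINT z|lborel. g z * cnj (k z)) = (LINT z|lborel. h z * cnj (k z))"
  using L2_disk_mult_integrable[OF assms(1,3)] L2_disk_mult_integrable[OF assms(2,3)]
  unfolding dA_int_L2[OF L2_disk_diff[OF assms(1,2)] assms(3)] by (simp add: left_diff_distrib)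

text \<open>The real Riesz representation only matches real parts. Since the space is closed under
  multiplication by \<open>\<i>\<close>, testing against \<open>\<i> * k\<close> matches the
  imaginary parts as well.\<close>

lemma bergman_proj_exists:
  assumes g: "L2_disk g"
  obtains h where "h \<in> bergman"
    "\<And>k. k \<in> bergman \<Longrightarrow> (LINT z|lborel. g z * cnj (k z)) = (LINT z|lborel. h z * cnj (k z))"
proof -
  define \<phi> where "\<phi> e = Re (LINT z|lborel. g z * cnj (bfun e z)) / pi" for e
  have int: "integrable lborel (\<lambda>z. g z * cnj (bfun e z))" for e
    by (rule L2_disk_mult_integrable[OF g bfun_L2])
  have add: "\<phi> (x + y) = \<phi> x + \<phi> y" for x y
    using int by (simp add: \<phi>_def bfun_simps distrib_left add_divide_distrib)
  have scale: "\<phi> (r *\<^sub>R x) = r *\<^sub>R \<phi> x" for r x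
  proof -
    have "(LINT z|lborel. g z * cnj (bfun (r *\<^sub>R x) z)) = (LINT z|lborel. of_real r * (g z * cnj (bfun x z)))"
      by (simp add: bfun_simps mult_ac)
    also have "\<dots> = of_real r * (LINT z|lborel. g z * cnj (bfun x z))" by simp
    finally show ?thesis by (simp add: \<phi>_def)
  qed
  have unit: "\<bar>\<phi> x\<bar> \<le> ((bnorm g)\<^sup>2 + 1) / 2" if "norm x = 1" for x
  proof -
    have "\<bar>\<phi> x\<bar> \<le> cmod (LINT z|lborel. g z * cnj (bfun x z)) / pi"
      unfolding \<phi>_def using abs_Re_le_cmod by (simp add: divide_right_mono)
    also have "\<dots> \<le> ((bnorm g)\<^sup>2 + 1) / 2"
      using L2_disk_inner_bound[OF g bfun_L2[of x]] that by (simp add: norm_bfun field_simps)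
    finally show ?thesis .
  qed
  have "bounded_linear \<phi>"
  proof (rule bounded_linear_intro[OF add scale])
    fix x
    show "norm (\<phi> x) \<le> norm x * (((bnorm g)\<^sup>2 + 1) / 2)"
    proof (cases "x = 0")
      case True
      then show ?thesis using scale[of 0 x] by simp
    next
      case False
      have "\<phi> x = norm x * \<phi> (x /\<^sub>R norm x)"
        using False scale[of "norm x" "x /\<^sub>R norm x"] by simp
      then show ?thesis
        using unit[of "x /\<^sub>R norm x"] False by (simp add: abs_mult mult_left_mono)
    qed
  qed
  then obtain h where h: "\<And>e. \<phi> e = inner h e" using riesz_representation by blast
  have Re: "Re (LINT z|lborel. g z * cnj (k z)) = Re (LINT z|lborel. bfun h z * cnj (k z))" if "k \<in> bergman" for k
    using h[of "Bfun k"] that by (simp add: \<phi>_def inner_berg_def Bfun_inverse)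
  have Im: "Im (LINT z|lborel. f z * cnj (k z)) = Re (LINT z|lborel. f z * cnj (\<i> * k z))" for f k :: "complex \<Rightarrow> complex"
  proof -
    have "(LINT z|lborel. f z * cnj (\<i> * k z)) = (LINT z|lborel. - \<i> * (f z * cnj (k z)))"
      by (simp add: mult_ac)
    also have "\<dots> = - \<i> * (LINT z|lborel. f z * cnj (k z))"
      by (rule integral_mult_right_zero)
    finally show ?thesis by simp
  qed
  show ?thesis
  proof
    show "bfun h \<in> bergman" by (rule bfun)
    show "(LINT z|lborel. g z * cnj (k z)) = (LINT z|lborel. bfun h z * cnj (k z))" if "k \<in> bergman" for k
      using Re[OF that] Re[OF bergman_cmult[OF that, of \<i>]] by (simp add: complex_eq_iff Im)
  qed
qed

lemma bergman_eqI:
  assumes "f \<in> bergman" "g \<in> bergman"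
    "\<And>k. k \<in> bergman \<Longrightarrow> (LINT z|lborel. f z * cnj (k z)) = (LINT z|lborel. g z * cnj (k z))"
  shows "f = g"
proof -
  have "inner (Bfun f) k = inner (Bfun g) k" for k
    using assms(3)[OF bfun] assms(1,2) by (simp add: inner_berg_def Bfun_inverse)
  then have "Bfun f = Bfun g" by (metis inner_diff_left inner_eq_zero_iff eq_iff_diff_eq_0)
  then show ?thesis using assms by (metis Bfun_inverse)
qed

lemma bergman_proj_eqI:
  assumes g: "L2_disk g" and h: "h \<in> bergman"
    and eq: "\<And>k. k \<in> bergman \<Longrightarrow> (LINT z|lborel. g z * cnj (k z)) = (LINT z|lborel. h z * cnj (k z))"
  shows "bergman_proj g = h"
  unfolding bergman_proj_def
proof (rule the_equality)
  show "h \<in> bergman \<and> (\<forall>k\<in>bergman. dA_int (\<lambda>z. (g z - h z) * cnj (k z)) = 0)"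
    using L2_disk_orthogonal_iff[OF g bergman_L2[OF h] bergman_L2] h eq by blast
  fix h' assume h': "h' \<in> bergman \<and> (\<forall>k\<in>bergman. dA_int (\<lambda>z. (g z - h' z) * cnj (k z)) = 0)"
  then have "(LINT z|lborel. g z * cnj (k z)) = (LINT z|lborel. h' z * cnj (k z))" if "k \<in> bergman" for k
    using L2_disk_orthogonal_iff[OF g bergman_L2 bergman_L2[OF that], of h'] that by blast
  then show "h' = h"
    using h h' eq by (intro bergman_eqI) metis+
qed

lemma bergman_proj:
  assumes g: "L2_disk g"
  shows "bergman_proj g \<in> bergman"
    and "k \<in> bergman \<Longrightarrow> (LINT z|lborel. g z * cnj (k z)) = (LINT z|lborel. bergman_proj g z * cnj (k z))"
proof -
  obtain h where h: "h \<in> bergman"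
    "\<And>k. k \<in> bergman \<Longrightarrow> (LINT z|lborel. g z * cnj (k z)) = (LINT z|lborel. h z * cnj (k z))"
    using bergman_proj_exists[OF g] by blast
  moreover have "bergman_proj g = h" by (rule bergman_proj_eqI[OF g h])
  ultimately show "bergman_proj g \<in> bergman"
    "k \<in> bergman \<Longrightarrow> (LINT z|lborel. g z * cnj (k z)) = (LINT z|lborel. bergman_proj g z * cnj (k z))"
    by simp_all
qed

lemma bergman_proj_id: "f \<in> bergman \<Longrightarrow> bergman_proj f = f"
  by (rule bergman_proj_eqI) (auto simp: bergman_L2)

lemma bergman_proj_lincomb:
  assumes g: "L2_disk g" and h: "L2_disk h"
  shows "bergman_proj (\<lambda>z. a * g z + b * h z) = (\<lambda>z. a * bergman_proj g z + b * bergman_proj h z)"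
proof (rule bergman_proj_eqI)
  show "L2_disk (\<lambda>z. a * g z + b * h z)"
    by (intro L2_disk_add L2_disk_cmult g h)
  show "(\<lambda>z. a * bergman_proj g z + b * bergman_proj h z) \<in> bergman"
    by (intro bergman_lincomb bergman_proj g h)
  fix k assume k: "k \<in> bergman"
  have lin: "(LINT z|lborel. (a * u z + b * v z) * cnj (k z))
      = a * (LINT z|lborel. u z * cnj (k z)) + b * (LINT z|lborel. v z * cnj (k z))"
    if "L2_disk u" "L2_disk v" for u v
    using L2_disk_mult_integrable[OF that(1) bergman_L2[OF k]] L2_disk_mult_integrable[OF that(2) bergman_L2[OF k]]
    by (simp add: distrib_right mult.assoc)
  show "(LINT z|lborel. (a * g z + b * h z) * cnj (k z))
      = (LINT z|lborel. (a * bergman_proj g z + b * bergman_proj h z) * cnj (k z))"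
    by (simp add: lin g h bergman_L2 bergman_proj(1) bergman_proj(2)[OF _ k])
qed

lemma bnorm_bergman_proj_le:
  assumes g: "L2_disk g"
  shows "bnorm (bergman_proj g) \<le> bnorm g"
proof -
  define h where "h = bergman_proj g"
  have h: "h \<in> bergman" and L: "L2_disk h"
    using bergman_proj(1)[OF g] by (auto simp: h_def bergman_L2)
  have "(LINT z|lborel. h z * cnj (h z)) = complex_of_real (LINT z|lborel. (cmod (h z))\<^sup>2)"
    by (simp only: complex_norm_square[symmetric] integral_complex_of_real)
  then have "pi * (bnorm h)\<^sup>2 = cmod (LINT z|lborel. h z * cnj (h z))"
    by (simp add: bnorm_power2[OF L])
  also have "\<dots> = cmod (LINT z|lborel. g z * cnj (h z))"
    using bergman_proj(2)[OF g h] by (simp add: h_def)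
  also have "\<dots> \<le> pi * ((bnorm g)\<^sup>2 + (bnorm h)\<^sup>2) / 2"
    by (rule L2_disk_inner_bound[OF g L])
  finally have "pi * (bnorm h)\<^sup>2 \<le> pi * (bnorm g)\<^sup>2" by (simp add: field_simps)
  then have "(bnorm h)\<^sup>2 \<le> (bnorm g)\<^sup>2" by simp
  then show ?thesis unfolding h_def using bnorm_nonneg[OF g] by (rule power2_le_imp_le)
qed

section \<open>Toeplitz operators with bounded continuous symbols\<close>

definition disk_symbol :: "(complex \<Rightarrow> complex) \<Rightarrow> bool" where
  "disk_symbol \<phi> \<longleftrightarrow> continuous_on diskD \<phi> \<and> bounded (\<phi> ` diskD)"

definition lift_op :: "((complex \<Rightarrow> complex) \<Rightarrow> (complex \<Rightarrow> complex)) \<Rightarrow> berg \<Rightarrow> berg" where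
  "lift_op T f = Bfun (T (bfun f))"

abbreviation TT :: "(complex \<Rightarrow> complex) \<Rightarrow> berg \<Rightarrow> berg" where
  "TT \<phi> \<equiv> lift_op (toeplitz \<phi>)"

lemma bfun_lift_op: "bounded_op T \<Longrightarrow> bfun (lift_op T f) = T (bfun f)"
  by (simp add: lift_op_def bounded_op_def Bfun_inverse bfun)

lemma bounded_linear_lift_op:
  assumes "bounded_op T"
  shows "bounded_linear (lift_op T)"
proof -
  have lin: "T (\<lambda>z. a * bfun f z + b * bfun g z) = (\<lambda>z. a * T (bfun f) z + b * T (bfun g) z)" for a b f g
    using assms bfun unfolding bounded_op_def by blast
  obtain C where C: "\<And>f. f \<in> bergman \<Longrightarrow> bnorm (T f) \<le> C * bnorm f"
    using assms unfolding bounded_op_def by blast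
  show ?thesis
  proof (rule bounded_linear_intro)
    show "lift_op T (f + g) = lift_op T f + lift_op T g" for f g
      using lin[of 1 f 1 g] by (simp add: bfun_inject[symmetric] bfun_lift_op[OF assms] bfun_simps)
    show "lift_op T (r *\<^sub>R f) = r *\<^sub>R lift_op T f" for r f
      using lin[of "of_real r" f 0 f] by (simp add: bfun_inject[symmetric] bfun_lift_op[OF assms] bfun_simps)
    show "norm (lift_op T f) \<le> norm f * C" for f
      using C[OF bfun[of f]] by (simp add: norm_bfun bfun_lift_op[OF assms] mult.commute)
  qed
qed

lemma disk_symbol_mult_L2:
  assumes "disk_symbol \<phi>" "L2_disk f"
  shows "L2_disk (\<lambda>z. \<phi> z * f z)"
proof -
  obtain C where "\<And>z. z \<in> diskD \<Longrightarrow> cmod (\<phi> z) \<le> C"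
    using assms(1) by (auto simp: disk_symbol_def bounded_iff)
  then show ?thesis
    using assms L2_disk_mult_bounded(1)[of f \<phi> C] by (simp add: disk_symbol_def)
qed

lemma bounded_op_toeplitz:
  assumes "disk_symbol \<phi>"
  shows "bounded_op (toeplitz \<phi>)"
  unfolding bounded_op_def
proof (intro conjI ballI allI)
  note L = disk_symbol_mult_L2[OF assms bergman_L2]
  show "toeplitz \<phi> f \<in> bergman" if "f \<in> bergman" for f
    using bergman_proj(1)[OF L[OF that]] by (simp add: toeplitz_def)
  show "toeplitz \<phi> (\<lambda>z. a * f z + b * g z) = (\<lambda>z. a * toeplitz \<phi> f z + b * toeplitz \<phi> g z)"
    if "f \<in> bergman" "g \<in> bergman" for f g a b
    using bergman_proj_lincomb[OF L[OF that(1)] L[OF that(2)], of a b]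
    by (simp add: toeplitz_def algebra_simps)
  obtain C where C: "\<And>z. z \<in> diskD \<Longrightarrow> cmod (\<phi> z) \<le> C"
    using assms(1) by (auto simp: disk_symbol_def bounded_iff)
  have "bnorm (toeplitz \<phi> f) \<le> C * bnorm f" if "f \<in> bergman" for f
    unfolding toeplitz_def
    using bnorm_bergman_proj_le[OF L[OF that]] L2_disk_mult_bounded(2)[OF bergman_L2[OF that], of \<phi> C] C assms
    by (auto simp: disk_symbol_def)
  then show "\<exists>C. \<forall>f\<in>bergman. bnorm (toeplitz \<phi> f) \<le> C * bnorm f" by blast
qed

lemma bfun_TT: "disk_symbol \<phi> \<Longrightarrow> bfun (TT \<phi> f) = toeplitz \<phi> (bfun f)"
  by (simp add: bfun_lift_op bounded_op_toeplitz)

lemma bounded_linear_TT: "disk_symbol \<phi> \<Longrightarrow> bounded_linear (TT \<phi>)"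
  by (simp add: bounded_linear_lift_op bounded_op_toeplitz)

lemma toeplitz_cong:
  assumes "\<And>z. z \<in> diskD \<Longrightarrow> \<phi> z = \<psi> z" "f \<in> bergman"
  shows "toeplitz \<phi> f = toeplitz \<psi> f"
proof -
  have "(\<lambda>z. \<phi> z * f z) = (\<lambda>z. \<psi> z * f z)"
  proof
    fix z show "\<phi> z * f z = \<psi> z * f z"
      using assms by (cases "z \<in> diskD") (auto simp: bergman_def)
  qed
  then show ?thesis by (simp add: toeplitz_def)
qed

lemma TT_cong: "(\<And>z. z \<in> diskD \<Longrightarrow> \<phi> z = \<psi> z) \<Longrightarrow> TT \<phi> f = TT \<psi> f"
  unfolding lift_op_def using toeplitz_cong[OF _ bfun] by metis

lemma toeplitz_add:
  assumes "disk_symbol \<phi>" "disk_symbol \<psi>" "f \<in> bergman"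
  shows "toeplitz (\<lambda>z. \<phi> z + \<psi> z) f = (\<lambda>z. toeplitz \<phi> f z + toeplitz \<psi> f z)"
  using bergman_proj_lincomb[OF disk_symbol_mult_L2[OF assms(1)] disk_symbol_mult_L2[OF assms(2)],
      OF bergman_L2 bergman_L2, OF assms(3,3), of 1 1]
  by (simp add: toeplitz_def distrib_right)

lemma disk_symbol_add: "disk_symbol \<phi> \<Longrightarrow> disk_symbol \<psi> \<Longrightarrow> disk_symbol (\<lambda>z. \<phi> z + \<psi> z)"
  unfolding disk_symbol_def using continuous_on_add bounded_plus_comp by blast

lemma disk_symbol_mult:
  assumes "disk_symbol \<phi>" "disk_symbol \<psi>"
  shows "disk_symbol (\<lambda>z. \<phi> z * \<psi> z)"
proof -
  obtain A B where "\<And>z. z \<in> diskD \<Longrightarrow> cmod (\<phi> z) \<le> A" "\<And>z. z \<in> diskD \<Longrightarrow> cmod (\<psi> z) \<le> B"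
    using assms by (auto simp: disk_symbol_def bounded_iff)
  then have "cmod (\<phi> z * \<psi> z) \<le> A * B" if "z \<in> diskD" for z
    unfolding norm_mult using that by (intro mult_mono) (auto intro: order_trans[OF norm_ge_zero])
  then have "bounded ((\<lambda>z. \<phi> z * \<psi> z) ` diskD)" unfolding bounded_iff by blast
  then show ?thesis using assms unfolding disk_symbol_def by (simp add: continuous_on_mult)
qed

lemma TT_add:
  assumes "disk_symbol \<phi>" "disk_symbol \<psi>"
  shows "TT (\<lambda>z. \<phi> z + \<psi> z) f = TT \<phi> f + TT \<psi> f"
  using assms by (simp add: bfun_inject[symmetric] bfun_simps bfun_TT disk_symbol_add toeplitz_add bfun)

lemma toeplitz_holomorphic:
  assumes "disk_symbol m" "m holomorphic_on diskD" "f \<in> bergman"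
  shows "toeplitz m f = (\<lambda>z. m z * f z)"
proof -
  have "(\<lambda>z. m z * f z) \<in> bergman"
    using assms disk_symbol_mult_L2[OF assms(1) bergman_L2]
    by (auto simp: bergman_iff intro: holomorphic_intros)
  then show ?thesis by (simp add: toeplitz_def bergman_proj_id)
qed

lemma bfun_TT_holomorphic:
  assumes "disk_symbol m" "m holomorphic_on diskD"
  shows "bfun (TT m f) = (\<lambda>z. m z * bfun f z)"
  using assms by (simp add: bfun_TT toeplitz_holomorphic bfun)

text \<open>The inner projection is trivial because analytic multiplication preserves the Bergman
  space. The analytic factor has to act first.\<close>

lemma TT_mult_holomorphic:
  assumes "disk_symbol m" "m holomorphic_on diskD"
  shows "TT (\<lambda>z. \<phi> z * m z) f = TT \<phi> (TT m f)"
  unfolding lift_op_def[of "toeplitz \<phi>"] bfun_TT_holomorphic[OF assms]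
  by (simp only: lift_op_def toeplitz_def mult.assoc)

lemma norm_TT_le: "disk_symbol \<phi> \<Longrightarrow> norm (TT \<phi> f) \<le> bnorm (\<lambda>z. \<phi> z * bfun f z)"
  unfolding norm_bfun bfun_TT toeplitz_def
  by (rule bnorm_bergman_proj_le[OF disk_symbol_mult_L2[OF _ bfun_L2]])

text \<open>The measure is normalised, so a constant bound \<open>a\<close> contributes exactly
  \<open>a\<close>. In the applications \<open>a\<close> comes from the region where the function is
  uniformly small and \<open>b\<close> from the region where the symbol is small.\<close>

lemma bnorm_le_split:
  assumes "L2_disk v" "L2_disk w"
    and "\<And>z. z \<in> diskD \<Longrightarrow> (cmod (v z))\<^sup>2 \<le> a + b * (cmod (w z))\<^sup>2"
  shows "(bnorm v)\<^sup>2 \<le> a + b * (bnorm w)\<^sup>2"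
proof -
  have fin: "emeasure lborel diskD < \<infinity>"
    unfolding diskD_def by (rule emeasure_bounded_finite[OF bounded_ball])
  have ind: "integrable lborel (\<lambda>z. a * indicator diskD z)"
    using fin by (intro integrable_mult_right integrable_real_indicator) (auto simp: diskD_def)
  have wi: "integrable lborel (\<lambda>z. b * (cmod (w z))\<^sup>2)"
    using assms(2) by (auto simp: L2_disk_def)
  have meas: "measure lborel diskD = pi"
    using content_ball[of 1 "0::complex"] by (simp add: diskD_def unit_ball_vol_2)
  have "(LINT z|lborel. (cmod (v z))\<^sup>2) \<le> (LINT z|lborel. a * indicator diskD z + b * (cmod (w z))\<^sup>2)"
  proof (rule integral_mono)
    show "integrable lborel (\<lambda>z. (cmod (v z))\<^sup>2)" using assms(1) by (simp add: L2_disk_def)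
    show "integrable lborel (\<lambda>z. a * indicator diskD z + b * (cmod (w z))\<^sup>2)"
      by (intro Bochner_Integration.integrable_add ind wi)
    show "(cmod (v z))\<^sup>2 \<le> a * indicator diskD z + b * (cmod (w z))\<^sup>2" for z
      using assms by (cases "z \<in> diskD") (auto simp: L2_disk_def)
  qed
  also have "\<dots> = a * pi + b * (LINT z|lborel. (cmod (w z))\<^sup>2)"
    using ind wi meas by (simp add: diskD_def)
  finally show ?thesis
    unfolding bnorm_power2[OF assms(1)] bnorm_power2[OF assms(2)] by (simp add: field_simps)
qed

text \<open>A bounded sequence has a subsequence converging uniformly on compact subsets, and the
  symbol is small on the remaining boundary layer, so the products converge in norm.\<close>

lemma compact_linear_TT:
  assumes cont: "continuous_on diskD \<psi>" and le: "\<And>z. z \<in> diskD \<Longrightarrow> cmod (\<psi> z) \<le> C * (1 - cmod z)"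
  shows "disk_symbol \<psi>" "compact_linear (TT \<psi>)"
proof -
  have C: "0 \<le> C" using order_trans[OF norm_ge_zero le[of 0]] by (simp add: diskD_def)
  have leC: "cmod (\<psi> z) \<le> C" if "z \<in> diskD" for z
    using le[OF that] mult_left_mono[of "1 - cmod z" 1 C] C by simp
  then show sym: "disk_symbol \<psi>"
    using cont by (auto simp: disk_symbol_def bounded_iff)
  show "compact_linear (TT \<psi>)"
    unfolding compact_linear_def
  proof (intro conjI allI impI)
    show bl: "bounded_linear (TT \<psi>)" by (rule bounded_linear_TT[OF sym])
    fix u :: "nat \<Rightarrow> berg" assume "\<exists>M. \<forall>n. norm (u n) \<le> M"
    then obtain M where M: "\<And>n. norm (u n) \<le> M" by blast
    obtain r g where r: "strict_mono r" "g \<in> bergman"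
      and unif: "\<And>K. compact K \<Longrightarrow> K \<subseteq> diskD \<Longrightarrow> uniform_limit K (\<lambda>n. bfun (u (r n))) g sequentially"
    proof (rule bergman_montel[of "\<lambda>n. bfun (u n)" M])
      show "bfun (u n) \<in> bergman" "bnorm (bfun (u n)) \<le> M" for n
        using M[of n] by (auto simp: norm_bfun bfun)
    qed (rule that; assumption)
    define G where "G = Bfun g"
    have G: "bfun G = g" using r by (simp add: G_def Bfun_inverse)
    define B where "B = M + norm G + 1"
    have B: "norm (u n - G) \<le> B" "B > 0" for n
      using norm_triangle_ineq4[of "u n" G] M[of n] norm_ge_zero[of "u n"] norm_ge_zero[of G]
      unfolding B_def by linarith+
    have "(\<lambda>n. TT \<psi> (u (r n))) \<longlonglongrightarrow> TT \<psi> G"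
    proof (rule LIMSEQ_I)
      fix e :: real assume e: "e > 0"
      \<comment> \<open>\<open>d\<close> and \<open>s\<close> make the two contributions less than
        \<open>e / 2\<close> each; \<open>C + 1\<close> allows \<open>C = 0\<close>, and the minimum
        with 1 keeps \<open>s\<close> nonnegative.\<close>
      define d where "d = e / (2 * (C + 1))"
      have d: "d > 0" "C * d < e / 2"
        using e C by (auto simp: d_def field_simps)
      define s where "s = 1 - min 1 (e / (2 * (C + 1) * B))"
      have s: "0 \<le> s" "s < 1" "C * (1 - s) * B < e / 2"
      proof -
        have Q: "0 < e / (2 * (C + 1) * B)" using e C B by simp
        show "0 \<le> s" "s < 1" using Q by (auto simp: s_def)
        have "C * (1 - s) * B \<le> C * (e / (2 * (C + 1) * B)) * B"
          using C B by (intro mult_left_mono mult_right_mono) (auto simp: s_def)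
        also have "\<dots> = C / (C + 1) * (e / 2)" using B(2) by simp
        also have "\<dots> < 1 * (e / 2)" using C e by (intro mult_strict_right_mono) auto
        finally have "C * (1 - s) * B < 1 * (e / 2)" .
        then show "C * (1 - s) * B < e / 2" by simp
      qed
      have "uniform_limit (cball 0 s) (\<lambda>n. bfun (u (r n))) g sequentially"
        using s by (intro unif) (auto simp: diskD_def)
      then have "\<forall>\<^sub>F n in sequentially. \<forall>z\<in>cball 0 s. dist (bfun (u (r n)) z) (g z) < d"
        using d(1) by (rule uniform_limitD)
      then obtain N where N: "\<And>n z. n \<ge> N \<Longrightarrow> cmod z \<le> s \<Longrightarrow> cmod (bfun (u (r n)) z - g z) < d"
        unfolding eventually_sequentially dist_norm by fastforce
      have "norm (TT \<psi> (u (r n)) - TT \<psi> G) < e" if n: "n \<ge> N" for n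
      proof -
        define w where "w = u (r n) - G"
        have "(bnorm (\<lambda>z. \<psi> z * bfun w z))\<^sup>2 \<le> (C * d)\<^sup>2 + (C * (1 - s))\<^sup>2 * (bnorm (bfun w))\<^sup>2"
        proof (rule bnorm_le_split[OF disk_symbol_mult_L2[OF sym bfun_L2] bfun_L2])
          fix z assume z: "z \<in> diskD"
          show "(cmod (\<psi> z * bfun w z))\<^sup>2 \<le> (C * d)\<^sup>2 + (C * (1 - s))\<^sup>2 * (cmod (bfun w z))\<^sup>2"
          proof (cases "cmod z \<le> s")
            case True
            then have "cmod (bfun w z) \<le> d"
              using N[OF n] by (simp add: w_def bfun_simps G less_imp_le)
            then have "cmod (\<psi> z * bfun w z) \<le> C * d"
              using leC[OF z] C by (auto simp: norm_mult intro!: mult_mono)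
            then have "(cmod (\<psi> z * bfun w z))\<^sup>2 \<le> (C * d)\<^sup>2" by (intro power_mono) auto
            then show ?thesis by (simp add: add_increasing2)
          next
            case False
            then have "C * (1 - cmod z) \<le> C * (1 - s)" using C by (intro mult_left_mono) auto
            then have "cmod (\<psi> z * bfun w z) \<le> C * (1 - s) * cmod (bfun w z)"
              using le[OF z] by (auto simp: norm_mult intro!: mult_right_mono)
            then have "(cmod (\<psi> z * bfun w z))\<^sup>2 \<le> (C * (1 - s) * cmod (bfun w z))\<^sup>2" by (intro power_mono) auto
            then show ?thesis by (simp add: power_mult_distrib add_increasing)
          qed
        qed
        also have "(C * (1 - s))\<^sup>2 * (bnorm (bfun w))\<^sup>2 \<le> (C * (1 - s))\<^sup>2 * B\<^sup>2"
          using B(1)[of "r n"] by (intro mult_left_mono power_mono) (auto simp: w_def norm_bfun[symmetric])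
        also have "\<dots> = (C * (1 - s) * B)\<^sup>2" by (simp add: power_mult_distrib)
        also have "\<dots> \<le> (e / 2)\<^sup>2"
          using s C B by (intro power_mono) auto
        also have "(C * d)\<^sup>2 \<le> (e / 2)\<^sup>2"
          using d C by (intro power_mono) auto
        finally have "(bnorm (\<lambda>z. \<psi> z * bfun w z))\<^sup>2 \<le> (e / 2)\<^sup>2 + (e / 2)\<^sup>2" by simp
        also have "\<dots> < e\<^sup>2" using e by (simp add: power2_eq_square)
        finally have "bnorm (\<lambda>z. \<psi> z * bfun w z) < e"
          using e by (simp add: power2_less_imp_less)
        then have "norm (TT \<psi> w) < e" using norm_TT_le[OF sym, of w] by linarith
        then show ?thesis
          by (simp add: w_def linear_diff[OF bounded_linear.linear[OF bl]])
      qed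
      then show "\<exists>N. \<forall>n\<ge>N. norm (TT \<psi> (u (r n)) - TT \<psi> G) < e" by blast
    qed
    then show "\<exists>r g. strict_mono r \<and> (\<lambda>n. TT \<psi> (u (r n))) \<longlonglongrightarrow> g"
      using r(1) by blast
  qed
qed


subsection \<open>Spectra of Toeplitz operators via the lifted operators\<close>

lemma bounded_op_lincomb:
  assumes T: "bounded_op T" and S: "bounded_op S"
  shows "bounded_op (\<lambda>f z. T f z + c * S f z)"
  unfolding bounded_op_def
proof (intro conjI ballI allI)
  have TB: "T f \<in> bergman" and SB: "S f \<in> bergman" if "f \<in> bergman" for f
    using assms that by (auto simp: bounded_op_def)
  show "(\<lambda>z. T f z + c * S f z) \<in> bergman" if "f \<in> bergman" for f
    using bergman_lincomb[OF TB[OF that] SB[OF that], of 1 c] by simp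
  show "(\<lambda>z. T (\<lambda>z. a * f z + b * g z) z + c * S (\<lambda>z. a * f z + b * g z) z)
      = (\<lambda>z. a * (T f z + c * S f z) + b * (T g z + c * S g z))"
    if fg: "f \<in> bergman" "g \<in> bergman" for f g a b
  proof -
    have "T (\<lambda>z. a * f z + b * g z) = (\<lambda>z. a * T f z + b * T g z)"
      "S (\<lambda>z. a * f z + b * g z) = (\<lambda>z. a * S f z + b * S g z)"
      using assms fg by (auto simp: bounded_op_def)
    then show ?thesis by (simp add: algebra_simps)
  qed
  obtain C where C: "\<And>f. f \<in> bergman \<Longrightarrow> bnorm (T f) \<le> C * bnorm f"
    using T unfolding bounded_op_def by blast
  obtain D where D: "\<And>f. f \<in> bergman \<Longrightarrow> bnorm (S f) \<le> D * bnorm f"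
    using S unfolding bounded_op_def by blast
  have "bnorm (\<lambda>z. T f z + c * S f z) \<le> (C + cmod c * D) * bnorm f" if f: "f \<in> bergman" for f
  proof -
    have "bnorm (\<lambda>z. T f z + c * S f z) = norm (Bfun (T f) + Bfun (\<lambda>z. c * S f z))"
      using f by (simp add: norm_bfun bfun_simps Bfun_inverse TB SB bergman_cmult)
    also have "\<dots> \<le> bnorm (T f) + bnorm (\<lambda>z. c * S f z)"
      using norm_triangle_ineq[of "Bfun (T f)" "Bfun (\<lambda>z. c * S f z)"] f
      by (simp add: norm_Bfun TB SB bergman_cmult)
    also have "bnorm (\<lambda>z. c * S f z) \<le> cmod c * bnorm (S f)"
      using L2_disk_mult_bounded(2)[OF bergman_L2[OF SB[OF f]], of "\<lambda>_. c" "cmod c"] by simp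
    also have "\<dots> \<le> cmod c * (D * bnorm f)" using D[OF f] by (intro mult_left_mono) auto
    finally show ?thesis using C[OF f] by (simp add: algebra_simps)
  qed
  then show "\<exists>C. \<forall>f\<in>bergman. bnorm (\<lambda>z. T f z + c * S f z) \<le> C * bnorm f" by blast
qed

lemma bounded_op_id: "bounded_op (\<lambda>f. f)"
  unfolding bounded_op_def by (auto intro!: exI[of _ 1])

lemma bounded_op_add: "bounded_op T \<Longrightarrow> bounded_op S \<Longrightarrow> bounded_op (\<lambda>f z. T f z + S f z)"
  using bounded_op_lincomb[of T S 1] by simp

lemma bounded_op_shift: "bounded_op T \<Longrightarrow> bounded_op (\<lambda>f z. T f z - w * f z)"
  using bounded_op_lincomb[OF _ bounded_op_id, of T "-w"] by simp

text \<open>The inverse \<open>R\<close> on the type is only known to be real linear. Complex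
  linearity follows from that of \<open>U\<close> by cancelling \<open>U\<close>.\<close>

lemma invertible_op_iff:
  assumes U: "bounded_op U"
  shows "invertible_op U \<longleftrightarrow> linear_iso (lift_op U)"
proof
  assume "invertible_op U"
  then obtain S where S: "bounded_op S" "\<And>f. f \<in> bergman \<Longrightarrow> S (U f) = f" "\<And>f. f \<in> bergman \<Longrightarrow> U (S f) = f"
    unfolding invertible_op_def by blast
  then show "linear_iso (lift_op U)"
    unfolding linear_iso_def
    by (intro conjI exI[of _ "lift_op S"] bounded_linear_lift_op U)
       (auto simp: bfun_inject[symmetric] bfun_lift_op U bfun)
next
  assume "linear_iso (lift_op U)"
  then obtain R where R: "bounded_linear R" "\<And>x. R (lift_op U x) = x" "\<And>x. lift_op U (R x) = x"
    unfolding linear_iso_def by blast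
  define S where "S f = bfun (R (Bfun f))" for f
  have SB: "S f \<in> bergman" for f unfolding S_def by (rule bfun)
  have US: "U (S f) = f" if "f \<in> bergman" for f
    using R(3)[of "Bfun f"] that bfun_lift_op[OF U, of "R (Bfun f)"] by (simp add: S_def Bfun_inverse)
  have SU: "S (U f) = f" if "f \<in> bergman" for f
    using R(2)[of "Bfun f"] that U by (simp add: S_def lift_op_def Bfun_inverse)
  have "bounded_op S"
    unfolding bounded_op_def
  proof (intro conjI ballI allI)
    show "S f \<in> bergman" for f by (rule SB)
    fix f g a b assume fg: "f \<in> bergman" "g \<in> bergman"
    have "U (\<lambda>z. a * S f z + b * S g z) = (\<lambda>z. a * f z + b * g z)"
      using U SB US fg unfolding bounded_op_def by simp
    then show "S (\<lambda>z. a * f z + b * g z) = (\<lambda>z. a * S f z + b * S g z)"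
      using SU[OF bergman_lincomb[OF SB SB]] by metis
  next
    obtain C where "\<And>x. norm (R x) \<le> norm x * C"
      using bounded_linear.bounded[OF R(1)] by blast
    then have "bnorm (S f) \<le> C * bnorm f" if "f \<in> bergman" for f
      using that by (metis S_def norm_Bfun norm_bfun mult.commute)
    then show "\<exists>C. \<forall>f\<in>bergman. bnorm (S f) \<le> C * bnorm f" by blast
  qed
  then show "invertible_op U"
    unfolding invertible_op_def using U US SU by blast
qed

lemma compact_op_iff:
  assumes K: "bounded_op K"
  shows "compact_op K \<longleftrightarrow> compact_linear (lift_op K)"
proof
  assume *: "compact_op K"
  show "compact_linear (lift_op K)"
    unfolding compact_linear_def
  proof (intro conjI allI impI bounded_linear_lift_op K)
    fix u :: "nat \<Rightarrow> berg" assume "\<exists>M. \<forall>n. norm (u n) \<le> M"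
    then have "(\<forall>n. bfun (u n) \<in> bergman) \<and> (\<exists>M. \<forall>n. bnorm (bfun (u n)) \<le> M)"
      by (simp add: norm_bfun bfun)
    then have "\<exists>r g. strict_mono r \<and> g \<in> bergman \<and>
        (\<lambda>n. bnorm (\<lambda>z. K (bfun (u (r n))) z - g z)) \<longlonglongrightarrow> 0"
      by (rule *[unfolded compact_op_def, THEN conjunct2, THEN spec, THEN mp])
    then obtain r g where r: "strict_mono r" "g \<in> bergman"
      "(\<lambda>n. bnorm (\<lambda>z. K (bfun (u (r n))) z - g z)) \<longlonglongrightarrow> 0" by blast
    have "(\<lambda>n. norm (lift_op K (u (r n)) - Bfun g)) = (\<lambda>n. bnorm (\<lambda>z. K (bfun (u (r n))) z - g z))"
      using r(2) by (simp add: norm_bfun bfun_simps bfun_lift_op[OF K] Bfun_inverse)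
    with r(3) have "(\<lambda>n. norm (lift_op K (u (r n)) - Bfun g)) \<longlonglongrightarrow> 0" by metis
    then have "(\<lambda>n. lift_op K (u (r n)) - Bfun g) \<longlonglongrightarrow> 0"
      by (rule tendsto_norm_zero_cancel)
    then have "(\<lambda>n. lift_op K (u (r n))) \<longlonglongrightarrow> Bfun g"
      by (rule LIM_zero_cancel)
    then show "\<exists>r g. strict_mono r \<and> (\<lambda>n. lift_op K (u (r n))) \<longlonglongrightarrow> g"
      using r(1) by blast
  qed
next
  assume *: "compact_linear (lift_op K)"
  show "compact_op K"
    unfolding compact_op_def
  proof (intro conjI allI impI K)
    fix u :: "nat \<Rightarrow> complex \<Rightarrow> complex"
    assume u: "(\<forall>n. u n \<in> bergman) \<and> (\<exists>M. \<forall>n. bnorm (u n) \<le> M)"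
    then obtain M where M: "\<And>n. norm (Bfun (u n)) \<le> M" by (auto simp: norm_Bfun)
    obtain r g where r: "strict_mono r" "(\<lambda>n. lift_op K (Bfun (u (r n)))) \<longlonglongrightarrow> g"
      by (rule compact_linearD[OF *, of "\<lambda>n. Bfun (u n)" M]) (use M in auto)
    have "bnorm (\<lambda>z. K (u (r n)) z - bfun g z) = norm (lift_op K (Bfun (u (r n))) - g)" for n
      using u by (simp add: norm_bfun bfun_simps bfun_lift_op[OF K] Bfun_inverse)
    moreover have "(\<lambda>n. norm (lift_op K (Bfun (u (r n))) - g)) \<longlonglongrightarrow> 0"
      using r(2) by (intro tendsto_norm_zero LIM_zero)
    ultimately show "\<exists>r g. strict_mono r \<and> g \<in> bergman \<and> (\<lambda>n. bnorm (\<lambda>z. K (u (r n)) z - g z)) \<longlonglongrightarrow> 0"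
      using r(1) bfun[of g] by (intro exI[of _ r] exI[of _ "bfun g"]) simp
  qed
qed

lemma disk_symbol_const: "disk_symbol (\<lambda>z. c)"
  by (auto simp: disk_symbol_def bounded_iff)

lemma disk_symbol_diff_const: "disk_symbol h \<Longrightarrow> disk_symbol (\<lambda>z. h z - w)"
  using disk_symbol_add[OF _ disk_symbol_const, of h "-w"] by simp

lemma TT_const: "bfun (TT (\<lambda>z. c) f) = (\<lambda>z. c * bfun f z)"
  by (rule bfun_TT_holomorphic[OF disk_symbol_const]) simp

lemma toeplitz_diff_const:
  assumes "disk_symbol h" "f \<in> bergman"
  shows "toeplitz (\<lambda>z. h z - w) f = (\<lambda>z. toeplitz h f z - w * f z)"
proof -
  have "toeplitz (\<lambda>z. h z + (- w)) f = (\<lambda>z. toeplitz h f z + toeplitz (\<lambda>z. - w) f z)"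
    by (rule toeplitz_add[OF assms(1) disk_symbol_const assms(2)])
  also have "toeplitz (\<lambda>z. - w) f = (\<lambda>z. - w * f z)"
    by (rule toeplitz_holomorphic[OF disk_symbol_const _ assms(2)]) simp
  finally show ?thesis by simp
qed

lemma lift_op_toeplitz_shift:
  assumes "disk_symbol h"
  shows "lift_op (\<lambda>f z. toeplitz h f z - w * f z) = TT (\<lambda>z. h z - w)"
  unfolding lift_op_def by (simp add: toeplitz_diff_const[OF assms bfun])

lemma op_spectrum_toeplitz_iff:
  assumes "disk_symbol h"
  shows "w \<in> op_spectrum (toeplitz h) \<longleftrightarrow> \<not> linear_iso (TT (\<lambda>z. h z - w))"
  unfolding op_spectrum_def mem_Collect_eq
    invertible_op_iff[OF bounded_op_shift[OF bounded_op_toeplitz[OF assms]]] lift_op_toeplitz_shift[OF assms] ..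

lemma lift_op_toeplitz_shift_add:
  assumes "disk_symbol h" "bounded_op K"
  shows "lift_op (\<lambda>f z. toeplitz h f z + K f z - w * f z) = (\<lambda>f. TT (\<lambda>z. h z - w) f + lift_op K f)"
proof
  fix f
  have "bounded_op (\<lambda>f z. toeplitz h f z + K f z - w * f z)"
    by (intro bounded_op_shift bounded_op_add bounded_op_toeplitz assms)
  from bfun_lift_op[OF this] show "lift_op (\<lambda>f z. toeplitz h f z + K f z - w * f z) f = TT (\<lambda>z. h z - w) f + lift_op K f"
    by (simp add: bfun_inject[symmetric] bfun_simps bfun_TT disk_symbol_diff_const assms bfun_lift_op
        toeplitz_diff_const bfun algebra_simps)
qed

lemma not_in_weyl_spectrum_iff:
  assumes h: "disk_symbol h"
  shows "w \<notin> weyl_spectrum (toeplitz h) \<longleftrightarrow>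
    (\<exists>K. compact_op K \<and> linear_iso (\<lambda>f. TT (\<lambda>z. h z - w) f + lift_op K f))"
proof -
  have "w \<notin> op_spectrum (\<lambda>f z. toeplitz h f z + K f z) \<longleftrightarrow>
      linear_iso (\<lambda>f. TT (\<lambda>z. h z - w) f + lift_op K f)" if "compact_op K" for K
  proof -
    have K: "bounded_op K" using that by (simp add: compact_op_def)
    show ?thesis
      unfolding op_spectrum_def mem_Collect_eq not_not
        invertible_op_iff[OF bounded_op_shift[OF bounded_op_add[OF bounded_op_toeplitz[OF h] K]]]
        lift_op_toeplitz_shift_add[OF h K] ..
  qed
  then show ?thesis unfolding weyl_spectrum_def by blast
qed

text \<open>Stated in one direction only: \<open>weyl_linear\<close> admits real linear
  \<open>K\<close>, whereas \<open>compact_op\<close> asks for complex linearity.\<close>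

lemma not_in_weyl_spectrum_imp_weyl_linear:
  assumes "disk_symbol h" "w \<notin> weyl_spectrum (toeplitz h)"
  shows "weyl_linear (TT (\<lambda>z. h z - w))"
  using assms not_in_weyl_spectrum_iff[OF assms(1)] compact_op_iff
  unfolding weyl_linear_def by (metis bounded_linear_TT compact_op_def disk_symbol_diff_const)

text \<open>A Toeplitz perturbation is complex linear from the start, which makes it admissible in
  the definition of the Weyl spectrum.\<close>

lemma not_in_weyl_spectrumI:
  assumes h: "disk_symbol h" and \<psi>: "disk_symbol \<psi>" "compact_linear (TT \<psi>)"
    and iso: "linear_iso (\<lambda>f. TT (\<lambda>z. h z - w) f + TT \<psi> f)"
  shows "w \<notin> weyl_spectrum (toeplitz h)"
  using not_in_weyl_spectrum_iff[OF h] compact_op_iff[OF bounded_op_toeplitz[OF \<psi>(1)]] \<psi>(2) iso by blast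

lemma weyl_spectrum_subset:
  assumes h: "disk_symbol h"
  shows "weyl_spectrum (toeplitz h) \<subseteq> op_spectrum (toeplitz h)"
proof (rule subsetI, rule ccontr)
  fix w assume w: "w \<in> weyl_spectrum (toeplitz h)" "w \<notin> op_spectrum (toeplitz h)"
  have 0: "disk_symbol (\<lambda>z. 0)" "compact_linear (TT (\<lambda>z. 0))"
    by (auto intro!: compact_linear_TT[of _ 0])
  have "TT (\<lambda>z. 0) f = 0" for f
    by (simp add: bfun_inject[symmetric] TT_const bfun_simps)
  then show False
    using w not_in_weyl_spectrumI[OF h 0, of w] op_spectrum_toeplitz_iff[OF h] by simp
qed

lemma weyl_linear_add_compact:
  assumes "weyl_linear A" "compact_linear K"
  shows "weyl_linear (\<lambda>x. A x + K x)"
proof -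
  obtain L where L: "compact_linear L" "linear_iso (\<lambda>x. A x + L x)" and A: "bounded_linear A"
    using assms(1) unfolding weyl_linear_def by blast
  have "compact_linear (\<lambda>x. L x + - K x)"
    by (intro compact_linear_add compact_linear_uminus assms L)
  moreover have "linear_iso (\<lambda>x. A x + K x + (L x + - K x))" using L(2) by simp
  moreover have "bounded_linear (\<lambda>x. A x + K x)"
    using A assms(2) by (auto intro!: bounded_linear_add simp: compact_linear_def)
  ultimately show ?thesis unfolding weyl_linear_def by blast
qed

text \<open>The same compact \<open>K\<close> serves for all \<open>w'\<close> near
  \<open>w\<close>; the radius is the reciprocal of a bound for the inverse.\<close>

lemma weyl_spectrum_complement_open:
  fixes w :: complex
  assumes h: "disk_symbol h" and w: "w \<notin> weyl_spectrum (toeplitz h)"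
  obtains e where "e > 0" "\<And>w'. cmod (w' - w) < e \<Longrightarrow> w' \<notin> weyl_spectrum (toeplitz h)"
proof -
  obtain K where K: "compact_op K" "linear_iso (\<lambda>f. TT (\<lambda>z. h z - w) f + lift_op K f)"
    using w not_in_weyl_spectrum_iff[OF h] by blast
  then obtain S where bl: "bounded_linear (\<lambda>f. TT (\<lambda>z. h z - w) f + lift_op K f)" and S: "bounded_linear S"
    "\<And>x. S (TT (\<lambda>z. h z - w) x + lift_op K x) = x" "\<And>x. TT (\<lambda>z. h z - w) (S x) + lift_op K (S x) = x"
    unfolding linear_iso_def by blast
  obtain C where C: "C > 0" "\<And>x. norm (S x) \<le> norm x * C"
    using bounded_linear.pos_bounded[OF S(1)] by blast
  show ?thesis
  proof
    show "1 / C > 0" using C by simp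
    fix w' assume w': "cmod (w' - w) < 1 / C"
    have eq: "TT (\<lambda>z. h z - w') f = TT (\<lambda>z. h z - w) f + TT (\<lambda>z. w - w') f" for f
      using TT_add[OF disk_symbol_diff_const[OF h] disk_symbol_const, of w "w - w'" f] by simp
    have "linear_iso (\<lambda>f. (TT (\<lambda>z. h z - w) f + lift_op K f) + TT (\<lambda>z. w - w') f)"
    proof (rule linear_iso_perturb[OF bl S bounded_linear_TT[OF disk_symbol_const]])
      show "0 \<le> cmod (w' - w) * C" "cmod (w' - w) * C < 1"
        using C w' by (auto simp: field_simps)
      fix x
      have "norm (TT (\<lambda>z. w - w') x) \<le> cmod (w' - w) * norm x"
        using L2_disk_mult_bounded(2)[OF bfun_L2[of x], of "\<lambda>_. w - w'" "cmod (w' - w)"]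
        by (simp add: norm_bfun TT_const norm_minus_commute)
      then have "norm (TT (\<lambda>z. w - w') x) * C \<le> cmod (w' - w) * norm x * C"
        using C by (intro mult_right_mono) auto
      then show "norm (S (TT (\<lambda>z. w - w') x)) \<le> cmod (w' - w) * C * norm x"
        using C(2)[of "TT (\<lambda>z. w - w') x"] by (simp add: mult_ac)
    qed
    then have "linear_iso (\<lambda>f. TT (\<lambda>z. h z - w') f + lift_op K f)"
      by (simp add: eq add_ac)
    then show "w' \<notin> weyl_spectrum (toeplitz h)"
      using K(1) not_in_weyl_spectrum_iff[OF h] by blast
  qed
qed

lemma eigenspace_toeplitz_iff:
  assumes "disk_symbol h" "f \<in> bergman"
  shows "f \<in> eigenspace_op (toeplitz h) w \<longleftrightarrow> TT (\<lambda>z. h z - w) (Bfun f) = 0"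
  using assms
  by (simp add: eigenspace_op_def bfun_inject[symmetric] bfun_TT disk_symbol_diff_const toeplitz_diff_const
      Bfun_inverse bfun_simps fun_eq_iff)


subsection \<open>Zeros of a symbol on the circle\<close>

lemma one_in_bergman: "(\<lambda>z. if z \<in> diskD then 1 else 0) \<in> bergman"
proof -
  have "emeasure lborel diskD < \<infinity>"
    unfolding diskD_def by (rule emeasure_bounded_finite[OF bounded_ball])
  then have "integrable lborel (indicator diskD :: complex \<Rightarrow> real)"
    by (intro integrable_real_indicator) (auto simp: diskD_def)
  moreover have "(\<lambda>z. indicator diskD z *\<^sub>R (cmod (if z \<in> diskD then 1 else 0))\<^sup>2) = (indicator diskD :: complex \<Rightarrow> real)"
    by (auto simp: indicator_def fun_eq_iff)
  moreover have "(\<lambda>z. if z \<in> diskD then 1 else 0 :: complex) holomorphic_on diskD"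
    by (rule holomorphic_transform[of "\<lambda>_. 1"]) auto
  ultimately show ?thesis by (auto simp: bergman_def set_integrable_def)
qed

lemma bounded_holomorphic_in_bergman:
  assumes "disk_symbol m" "m holomorphic_on diskD"
  shows "(\<lambda>z. if z \<in> diskD then m z else 0) \<in> bergman"
proof -
  have "(\<lambda>z. m z * (if z \<in> diskD then 1 else 0)) \<in> bergman"
    using toeplitz_holomorphic[OF assms one_in_bergman] bounded_op_toeplitz[OF assms(1)] one_in_bergman
    unfolding bounded_op_def by metis
  moreover have "(\<lambda>z. m z * (if z \<in> diskD then 1 else 0)) = (\<lambda>z. if z \<in> diskD then m z else 0)"
    by auto
  ultimately show ?thesis by simp
qed

text \<open>Powers of \<open>(1 + cnj \<zeta> z) / 2\<close> peak at the boundary point \<open>\<zeta>\<close>: normalised, they tend to zero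
  uniformly away from it.\<close>
lemma peak_sequence:
  assumes \<zeta>: "cmod \<zeta> = 1"
  obtains u :: "nat \<Rightarrow> berg" where "\<And>n. norm (u n) = 1"
    "\<And>\<delta>. \<delta> > 0 \<Longrightarrow> \<exists>b. b \<longlonglongrightarrow> 0 \<and> (\<forall>n z. z \<in> diskD \<longrightarrow> \<delta> \<le> cmod (z - \<zeta>) \<longrightarrow> cmod (bfun (u n) z) \<le> b n)"
proof -
  define k where "k z = (1 + cnj \<zeta> * z) / 2" for z
  define e where "e n z = (if z \<in> diskD then k z ^ n else 0)" for n :: nat and z
  have kle: "cmod (k z) \<le> 1" if "z \<in> diskD" for z
  proof -
    have "cmod (1 + cnj \<zeta> * z) \<le> 1 + cmod z"
      using norm_triangle_ineq[of 1 "cnj \<zeta> * z"] \<zeta> by (simp add: norm_mult)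
    then show ?thesis using that by (simp add: k_def diskD_def norm_divide)
  qed
  have eB: "e n \<in> bergman" for n
  proof -
    have hol: "(\<lambda>z. k z ^ n) holomorphic_on diskD" unfolding k_def by (intro holomorphic_intros) auto
    have "disk_symbol (\<lambda>z. k z ^ n)"
      unfolding disk_symbol_def bounded_iff using hol kle
      by (auto intro!: holomorphic_on_imp_continuous_on exI[of _ 1] simp: norm_power power_le_one)
    from bounded_holomorphic_in_bergman[OF this hol] show ?thesis
      by (simp add: e_def[abs_def])
  qed
  \<comment> \<open>At \<open>a\<close>, the point of the radius towards \<open>\<zeta>\<close> with
    \<open>k a = \<rho>\<close>, the function has modulus \<open>\<rho> ^ n\<close>. The disk of
    radius \<open>1 - \<rho>\<close> about it stays inside the unit disk, so the point bound
    applies.\<close>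
  have lower: "\<rho> ^ n * (1 - \<rho>) \<le> bnorm (e n)" if \<rho>: "1/2 < \<rho>" "\<rho> < 1" for \<rho> :: real and n
  proof -
    define a where "a = of_real (2 * \<rho> - 1) * \<zeta>"
    have a: "cmod a = 2 * \<rho> - 1" unfolding a_def norm_mult norm_of_real using \<rho> \<zeta> by simp
    have "cnj \<zeta> * \<zeta> = 1" using complex_norm_square[of \<zeta>] \<zeta> by (simp add: mult.commute)
    then have "cnj \<zeta> * a = of_real (2 * \<rho> - 1)" by (simp add: a_def mult.left_commute)
    then have "k a = of_real \<rho>" by (simp add: k_def)
    moreover have "a \<in> diskD" using a \<rho> by (simp add: diskD_def)
    ultimately have "cmod (e n a) = \<rho> ^ n" using \<rho> by (simp add: e_def norm_power)
    moreover have "cmod (e n a) * (1 - \<rho>) \<le> bnorm (e n)"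
      by (rule bergman_point_bound[OF eB]) (use a \<rho> in auto)
    ultimately show ?thesis by simp
  qed
  have pos: "bnorm (e n) > 0" for n
    using lower[of "3/4" n] by (rule less_le_trans[rotated]) auto
  define u where "u n = Bfun (e n) /\<^sub>R bnorm (e n)" for n
  have bu: "bfun (u n) z = e n z / of_real (bnorm (e n))" for n z
    by (simp add: u_def bfun_simps Bfun_inverse[OF eB] field_simps)
  show ?thesis
  proof
    show "norm (u n) = 1" for n
      using pos[of n] by (simp add: u_def norm_Bfun[OF eB])
    fix \<delta> :: real assume \<delta>: "\<delta> > 0"
    \<comment> \<open>By the parallelogram law \<open>k\<close> has squared modulus at most
      \<open>1 - \<delta>\<^sup>2 / 4\<close> off the \<open>\<delta>\<close>-neighbourhood of
      \<open>\<zeta>\<close>; the maximum covers large \<open>\<delta>\<close>.\<close>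
    define s where "s = sqrt (max (1/4) (1 - \<delta>\<^sup>2 / 4))"
    have s: "1/2 \<le> s" "s < 1" "s\<^sup>2 \<ge> 1 - \<delta>\<^sup>2 / 4"
    proof -
      have "sqrt (1/4) \<le> s" unfolding s_def by (intro real_sqrt_le_mono) simp
      then show "1/2 \<le> s" by (simp add: real_sqrt_divide)
      show "s < 1" unfolding s_def using \<delta> by (simp add: real_sqrt_lt_1_iff)
      show "s\<^sup>2 \<ge> 1 - \<delta>\<^sup>2 / 4" unfolding s_def by simp
    qed
    have ks: "cmod (k z) \<le> s" if "z \<in> diskD" "\<delta> \<le> cmod (z - \<zeta>)" for z
    proof -
      define w where "w = cnj \<zeta> * z"
      have w1: "cmod w \<le> 1" using that(1) \<zeta> by (simp add: w_def norm_mult diskD_def)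
      have "cnj \<zeta> * \<zeta> = 1" using complex_norm_square[of \<zeta>] \<zeta> by (simp add: mult.commute)
      then have "w - 1 = cnj \<zeta> * (z - \<zeta>)" by (simp add: w_def algebra_simps)
      then have w2: "cmod (w - 1) = cmod (z - \<zeta>)" using \<zeta> by (simp add: norm_mult)
      have "(cmod (1 + w))\<^sup>2 + (cmod (w - 1))\<^sup>2 = 2 + 2 * (cmod w)\<^sup>2"
        unfolding cmod_power2 by (simp add: power2_eq_square algebra_simps)
      moreover have "(cmod w)\<^sup>2 \<le> 1" using w1 by (simp add: power_le_one)
      moreover have "\<delta>\<^sup>2 \<le> (cmod (w - 1))\<^sup>2" unfolding w2 using that(2) \<delta> by (intro power_mono) auto
      ultimately have "(cmod (1 + w))\<^sup>2 \<le> 4 * s\<^sup>2" using s(3) by simp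
      then have "(cmod (k z))\<^sup>2 \<le> s\<^sup>2" by (simp add: k_def w_def norm_divide power_divide)
      then show ?thesis by (rule power2_le_imp_le) (use s in simp)
    qed
    \<comment> \<open>Any value strictly between \<open>s\<close> and 1 makes the bound on the
      modulus, divided by the lower bound on the norm, decay geometrically.\<close>
    define \<rho> where "\<rho> = (1 + s) / 2"
    have \<rho>: "1/2 < \<rho>" "\<rho> < 1" "s < \<rho>" using s by (auto simp: \<rho>_def)
    show "\<exists>b. b \<longlonglongrightarrow> 0 \<and> (\<forall>n z. z \<in> diskD \<longrightarrow> \<delta> \<le> cmod (z - \<zeta>) \<longrightarrow> cmod (bfun (u n) z) \<le> b n)"
    proof (intro exI conjI allI impI)
      have "(\<lambda>n. (s / \<rho>) ^ n) \<longlonglongrightarrow> 0"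
        using \<rho> s by (intro LIMSEQ_realpow_zero) auto
      then show "(\<lambda>n. (s / \<rho>) ^ n / (1 - \<rho>)) \<longlonglongrightarrow> 0"
        by (intro tendsto_divide_zero)
      fix n z assume z: "z \<in> diskD" "\<delta> \<le> cmod (z - \<zeta>)"
      have "cmod (bfun (u n) z) = cmod (k z) ^ n / bnorm (e n)"
        using z(1) pos[of n] by (simp add: bu e_def norm_divide norm_power)
      also have "\<dots> \<le> s ^ n / (\<rho> ^ n * (1 - \<rho>))"
        using ks[OF z] lower[OF \<rho>(1,2), of n] \<rho> s by (intro frac_le power_mono) auto
      also have "\<dots> = (s / \<rho>) ^ n / (1 - \<rho>)" by (simp add: power_divide)
      finally show "cmod (bfun (u n) z) \<le> (s / \<rho>) ^ n / (1 - \<rho>)" .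
    qed
  qed
qed

lemma disk_symbol_cball:
  assumes "continuous_on (cball 0 1) \<phi>"
  shows "disk_symbol \<phi>"
proof -
  have "bounded (\<phi> ` cball 0 1)" by (intro compact_imp_bounded compact_continuous_image assms compact_cball)
  moreover have "diskD \<subseteq> cball 0 1" by (auto simp: diskD_def)
  ultimately show ?thesis
    unfolding disk_symbol_def using assms by (meson bounded_subset continuous_on_subset image_mono)
qed

text \<open>The peaking vectors are almost annihilated by \<open>TT \<phi>\<close>. Were
  \<open>TT \<phi> + K\<close> invertible, a subsequence of them would converge in norm, to a vector
  of norm 1; but their values tend to 0 at every point of the disk.\<close>

lemma boundary_zero_not_weyl:
  assumes cont: "continuous_on (cball 0 1) \<phi>" and \<zeta>: "cmod \<zeta> = 1" "\<phi> \<zeta> = 0"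
  shows "\<not> weyl_linear (TT \<phi>)"
proof
  assume "weyl_linear (TT \<phi>)"
  then obtain K S where K: "compact_linear K" and S: "bounded_linear S" "\<And>x. S (TT \<phi> x + K x) = x"
    unfolding weyl_linear_def linear_iso_def by blast
  have sym: "disk_symbol \<phi>" by (rule disk_symbol_cball[OF cont])
  obtain u :: "nat \<Rightarrow> berg" where u: "\<And>n. norm (u n) = 1"
    and peak: "\<And>\<delta>. \<delta> > 0 \<Longrightarrow> \<exists>b. b \<longlonglongrightarrow> 0 \<and> (\<forall>n z. z \<in> diskD \<longrightarrow> \<delta> \<le> cmod (z - \<zeta>) \<longrightarrow> cmod (bfun (u n) z) \<le> b n)"
    using peak_sequence[OF \<zeta>(1)] by blast
  obtain M where M: "\<And>z. z \<in> diskD \<Longrightarrow> cmod (\<phi> z) \<le> M"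
    using sym by (auto simp: disk_symbol_def bounded_iff)
  have TTu: "(\<lambda>n. TT \<phi> (u n)) \<longlonglongrightarrow> 0"
  proof (rule LIMSEQ_I)
    fix e :: real assume e: "e > 0"
    obtain \<delta> where \<delta>: "\<delta> > 0" "\<And>z. z \<in> cball 0 1 \<Longrightarrow> dist z \<zeta> < \<delta> \<Longrightarrow> dist (\<phi> z) (\<phi> \<zeta>) < e / 2"
      using cont[unfolded continuous_on_iff, rule_format, of \<zeta> "e / 2"] \<zeta>(1) e by auto
    obtain b where b: "b \<longlonglongrightarrow> 0"
      "\<And>n z. z \<in> diskD \<Longrightarrow> \<delta> \<le> cmod (z - \<zeta>) \<Longrightarrow> cmod (bfun (u n) z) \<le> b n"
      using peak[OF \<delta>(1)] by blast
    have "(\<lambda>n. M * b n) \<longlonglongrightarrow> 0" using b(1) by (rule tendsto_mult_right_zero)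
    from LIMSEQ_D[OF this, of "e / 2"] e obtain N where N: "\<And>n. n \<ge> N \<Longrightarrow> \<bar>M * b n\<bar> < e / 2" by auto
    have "norm (TT \<phi> (u n) - 0) < e" if n: "n \<ge> N" for n
    proof -
      have "(bnorm (\<lambda>z. \<phi> z * bfun (u n) z))\<^sup>2 \<le> (M * b n)\<^sup>2 + (e / 2)\<^sup>2 * (bnorm (bfun (u n)))\<^sup>2"
      proof (rule bnorm_le_split[OF disk_symbol_mult_L2[OF sym bfun_L2] bfun_L2])
        fix z assume z: "z \<in> diskD"
        show "(cmod (\<phi> z * bfun (u n) z))\<^sup>2 \<le> (M * b n)\<^sup>2 + (e / 2)\<^sup>2 * (cmod (bfun (u n) z))\<^sup>2"
        proof (cases "\<delta> \<le> cmod (z - \<zeta>)")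
          case True
          then have "cmod (\<phi> z * bfun (u n) z) \<le> M * b n"
            unfolding norm_mult using M[OF z] b(2)[OF z]
            by (intro mult_mono) (auto intro: order_trans[OF norm_ge_zero])
          then have "(cmod (\<phi> z * bfun (u n) z))\<^sup>2 \<le> (M * b n)\<^sup>2" by (intro power_mono) auto
          then show ?thesis by (simp add: add_increasing2)
        next
          case False
          then have "cmod (\<phi> z) \<le> e / 2"
            using \<delta>(2)[of z] z \<zeta>(2) by (simp add: dist_norm diskD_def)
          then have "cmod (\<phi> z * bfun (u n) z) \<le> e / 2 * cmod (bfun (u n) z)"
            unfolding norm_mult by (intro mult_right_mono) auto
          then have "(cmod (\<phi> z * bfun (u n) z))\<^sup>2 \<le> (e / 2 * cmod (bfun (u n) z))\<^sup>2"
            by (intro power_mono) auto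
          then show ?thesis
            unfolding power_mult_distrib[of "e / 2"] by (rule order_trans) simp
        qed
      qed
      also have "(M * b n)\<^sup>2 \<le> (e / 2)\<^sup>2"
        using N[OF n] by (metis abs_le_square_iff abs_of_pos e half_gt_zero less_imp_le)
      finally have "(bnorm (\<lambda>z. \<phi> z * bfun (u n) z))\<^sup>2 \<le> (e / 2)\<^sup>2 + (e / 2)\<^sup>2"
        using u[of n] by (simp add: norm_bfun)
      also have "\<dots> < e\<^sup>2" using e by (simp add: power2_eq_square)
      finally have "bnorm (\<lambda>z. \<phi> z * bfun (u n) z) < e" using e by (simp add: power2_less_imp_less)
      then show ?thesis using norm_TT_le[OF sym, of "u n"] by simp
    qed
    then show "\<exists>N. \<forall>n\<ge>N. norm (TT \<phi> (u n) - 0) < e" by blast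
  qed
  obtain r g where r: "strict_mono r" "(\<lambda>n. K (u (r n))) \<longlonglongrightarrow> g"
    by (rule compact_linearD[OF K, of u 1]) (use u in auto)
  have "(\<lambda>n. TT \<phi> (u (r n)) + K (u (r n))) \<longlonglongrightarrow> 0 + g"
    using LIMSEQ_subseq_LIMSEQ[OF TTu r(1)] r(2) by (intro tendsto_add) (auto simp: o_def)
  from bounded_linear.tendsto[OF S(1) this]
  have lim: "(\<lambda>n. u (r n)) \<longlonglongrightarrow> S g" by (simp add: S(2))
  have "bfun (S g) z = 0" for z
  proof (cases "z \<in> diskD")
    case True
    then have "cmod (z - \<zeta>) > 0" using \<zeta>(1) by (auto simp: diskD_def)
    then obtain b where b: "b \<longlonglongrightarrow> 0" "\<And>n. cmod (bfun (u n) z) \<le> b n"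
      using peak[of "cmod (z - \<zeta>)"] True by blast
    have "(\<lambda>n. bfun (u n) z) \<longlonglongrightarrow> 0"
      by (rule Lim_null_comparison[OF always_eventually[OF allI] b(1)]) (rule b(2))
    from LIMSEQ_subseq_LIMSEQ[OF this r(1)] tendsto_bfun[OF lim, of z]
    show ?thesis by (simp add: o_def LIMSEQ_unique)
  qed (rule bfun_outside)
  then have "S g = 0" by (simp add: bfun_inject[symmetric] bfun_simps fun_eq_iff)
  moreover have "norm (S g) = 1"
    using tendsto_norm[OF lim] u by (simp add: LIMSEQ_const_iff)
  ultimately show False by simp
qed

subsection \<open>Symbols \<open>cnj z + q z\<close>\<close>

lemma TT_holomorphic_inj:
  assumes m: "disk_symbol m" "m holomorphic_on diskD" and z0: "z0 \<in> diskD" "m z0 \<noteq> 0"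
    and f: "TT m f = 0"
  shows "f = 0"
proof -
  have 0: "m z * bfun f z = 0" for z
    using f bfun_TT_holomorphic[OF m, of f] by (simp add: bfun_simps fun_eq_iff)
  have opn: "open diskD" "connected diskD" by (auto simp: diskD_def)
  have "open {z \<in> diskD. m z \<noteq> 0}"
    using continuous_open_preimage[OF holomorphic_on_imp_continuous_on[OF m(2)] opn(1), of "-{0}"]
    by (simp add: vimage_def Int_def open_Compl)
  then have lim: "z0 islimpt {z \<in> diskD. m z \<noteq> 0}"
    using z0 by (intro interior_limit_point) (simp add: interior_open)
  have hol: "bfun f holomorphic_on diskD" using bfun[of f] by (simp add: bergman_iff)
  have z: "bfun f z = 0" if "z \<in> {z \<in> diskD. m z \<noteq> 0}" for z using that 0[of z] by simp
  have "bfun f z = 0" if "z \<in> diskD" for z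
    by (rule analytic_continuation[OF hol opn _ z0(1) lim z that]) auto
  then have "bfun f z = 0" for z using bfun_outside by blast
  then show ?thesis by (simp add: bfun_inject[symmetric] bfun_simps fun_eq_iff)
qed

text \<open>The constant 1 is not in the range. Injectivity of \<open>TT m\<close> together with
  this failure is what rules out index zero.\<close>

lemma TT_holomorphic_not_surj:
  assumes m: "disk_symbol m" "m holomorphic_on diskD" and a: "a \<in> diskD" "m a = 0"
  shows "\<not> surj (TT m)"
proof
  assume "surj (TT m)"
  then obtain f where "Bfun (\<lambda>z. if z \<in> diskD then 1 else 0) = TT m f" by (meson surjD)
  then have "(\<lambda>z. if z \<in> diskD then 1 else 0) = (\<lambda>z. m z * bfun f z)"
    using bfun_TT_holomorphic[OF m, of f] Bfun_inverse[OF one_in_bergman] by metis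
  from fun_cong[OF this, of a] show False using a by simp
qed

text \<open>A perturbation of the identity of norm at most \<open>cmod a\<close>, hence
  invertible.\<close>

lemma linear_iso_TT_affine:
  assumes "cmod a < 1"
  shows "disk_symbol (\<lambda>z. 1 - a * cnj z)" "linear_iso (TT (\<lambda>z. 1 - a * cnj z))"
proof -
  have cont: "continuous_on (cball 0 1) (\<lambda>z. - a * cnj z)" "continuous_on (cball 0 1) (\<lambda>z. 1 - a * cnj z)"
    by (intro continuous_intros)+
  then show "disk_symbol (\<lambda>z. 1 - a * cnj z)" by (intro disk_symbol_cball)
  have sym: "disk_symbol (\<lambda>z. - a * cnj z)" by (rule disk_symbol_cball[OF cont(1)])
  have id: "TT (\<lambda>z. 1) f = f" for f
    by (simp add: bfun_inject[symmetric] TT_const)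
  have eq: "TT (\<lambda>z. 1 - a * cnj z) f = f + TT (\<lambda>z. - a * cnj z) f" for f
    using TT_add[OF disk_symbol_const sym, of 1 f] by (simp add: id)
  have "linear_iso (\<lambda>f. f + TT (\<lambda>z. - a * cnj z) f)"
  proof (rule linear_iso_perturb[of "\<lambda>x. x" "\<lambda>x. x" _ "cmod a"])
    show "bounded_linear (TT (\<lambda>z. - a * cnj z))" by (rule bounded_linear_TT[OF sym])
    fix f
    have "bnorm (\<lambda>z. - a * cnj z * bfun f z) \<le> cmod a * bnorm (bfun f)"
    proof (rule L2_disk_mult_bounded(2)[OF bfun_L2])
      show "continuous_on diskD (\<lambda>z. - a * cnj z)" by (intro continuous_intros)
      show "cmod (- a * cnj z) \<le> cmod a" if "z \<in> diskD" for z
        using that mult_left_mono[of "cmod z" 1 "cmod a"] by (simp add: norm_mult diskD_def)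
    qed
    then show "norm (TT (\<lambda>z. - a * cnj z) f) \<le> cmod a * norm f"
      using norm_TT_le[OF sym, of f] by (simp add: norm_bfun)
  qed (use assms in auto)
  then show "linear_iso (TT (\<lambda>z. 1 - a * cnj z))"
    unfolding eq[abs_def] by (simp add: eq[abs_def])
qed

text \<open>The factor \<open>z * cnj z - 1\<close> is of the order of the distance to the circle.
  Writing it as a polynomial in \<open>z\<close> and \<open>cnj z\<close> lets symbols be compared
  by algebra.\<close>

lemma compact_linear_TT_radial:
  assumes "continuous_on (cball 0 1) v"
  shows "disk_symbol (\<lambda>z. (z * cnj z - 1) * v z)" "compact_linear (TT (\<lambda>z. (z * cnj z - 1) * v z))"
proof -
  have sub: "diskD \<subseteq> cball 0 1" by (auto simp: diskD_def)
  have cont: "continuous_on diskD (\<lambda>z. (z * cnj z - 1) * v z)"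
    by (intro continuous_intros continuous_on_subset[OF assms sub])
  obtain C where C: "\<And>z. z \<in> diskD \<Longrightarrow> cmod (v z) \<le> C"
    using disk_symbol_cball[OF assms] by (auto simp: disk_symbol_def bounded_iff)
  have le: "cmod ((z * cnj z - 1) * v z) \<le> (2 * C) * (1 - cmod z)" if z: "z \<in> diskD" for z
  proof -
    have "z * cnj z - 1 = of_real ((cmod z)\<^sup>2 - 1)"
      unfolding of_real_diff complex_norm_square by simp
    then have "cmod (z * cnj z - 1) = \<bar>(cmod z)\<^sup>2 - 1\<bar>" by (simp only: norm_of_real)
    also have "(cmod z)\<^sup>2 - 1 = - ((1 + cmod z) * (1 - cmod z))"
      by (simp add: power2_eq_square algebra_simps)
    also have "\<bar>\<dots>\<bar> = (1 + cmod z) * (1 - cmod z)"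
      using z by (simp add: diskD_def abs_mult)
    also have "\<dots> \<le> 2 * (1 - cmod z)" using z by (intro mult_right_mono) (auto simp: diskD_def)
    finally have "cmod (z * cnj z - 1) * cmod (v z) \<le> 2 * (1 - cmod z) * C"
      using C[OF z] z by (intro mult_mono) (auto simp: diskD_def)
    then show ?thesis by (simp add: norm_mult mult_ac)
  qed
  show "disk_symbol (\<lambda>z. (z * cnj z - 1) * v z)" "compact_linear (TT (\<lambda>z. (z * cnj z - 1) * v z))"
    using compact_linear_TT[OF cont le] by auto
qed

text \<open>The quotient has a removable singularity at \<open>a\<close> and is continuous elsewhere
  up to the boundary. Its value at \<open>a\<close> is recorded because it tells whether the zero is
  simple.\<close>

lemma factor_zero:
  assumes p: "p holomorphic_on ball 0 1" "continuous_on (cball 0 1) p" and a: "cmod a < 1" "p a = 0"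
  obtains m where "m holomorphic_on ball 0 1" "continuous_on (cball 0 1) m"
    "\<And>z. p z = (z - a) * m z" "m a = deriv p a"
proof -
  define m where "m z = (if z = a then deriv p a else p z / (z - a))" for z
  have aB: "a \<in> ball 0 1" using a by simp
  have "(\<lambda>z. if z = a then deriv p a else (p z - p a) / (z - a)) holomorphic_on ball 0 1"
    by (rule pole_lemma_open[OF p(1)]) simp
  then have hol: "m holomorphic_on ball 0 1"
    by (rule holomorphic_transform) (auto simp: m_def a)
  have "continuous_on (cball 0 1) m"
    unfolding continuous_on_eq_continuous_within
  proof
    fix x :: complex assume x: "x \<in> cball 0 1"
    show "continuous (at x within cball 0 1) m"
    proof (cases "x = a")
      case True
      then have "isCont m x"
        using holomorphic_on_imp_continuous_on[OF hol] aB by (simp add: continuous_on_eq_continuous_at)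
      then show ?thesis by (rule continuous_at_imp_continuous_at_within)
    next
      case False
      have "continuous (at x within cball 0 1) (\<lambda>z. p z / (z - a))"
        using p(2) x False by (intro continuous_intros) (auto simp: continuous_on_eq_continuous_within)
      then have "((\<lambda>z. p z / (z - a)) \<longlongrightarrow> m x) (at x within cball 0 1)"
        using False by (simp add: continuous_within m_def)
      moreover have "\<forall>\<^sub>F z in at x within cball 0 1. p z / (z - a) = m z"
        using eventually_neq_at_within[of a] by (rule eventually_mono) (simp add: m_def)
      ultimately show ?thesis
        unfolding continuous_within by (rule Lim_transform_eventually)
    qed
  qed
  then show ?thesis
    using that[OF hol] a by (auto simp: m_def)
qed

section \<open>The zeros of \<open>p w\<close> and the Weyl spectrum\<close>

locale disk_algebra_symbol =
  fixes q :: "complex \<Rightarrow> complex"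
  assumes q_hol: "q holomorphic_on ball 0 1" and q_cont: "continuous_on (cball 0 1) q"
begin

definition h :: "complex \<Rightarrow> complex" where "h z = cnj z + q z"

text \<open>On the unit circle \<open>p w z = z * (h z - w)\<close>.\<close>
definition p :: "complex \<Rightarrow> complex \<Rightarrow> complex" where "p w z = 1 + z * (q z - w)"

lemma h_cont: "continuous_on (cball 0 1) h"
  unfolding h_def by (intro continuous_intros q_cont)

lemma h_sym: "disk_symbol h"
  by (rule disk_symbol_cball[OF h_cont])

lemma p_hol: "p w holomorphic_on ball 0 1"
  unfolding p_def by (intro holomorphic_intros q_hol)

lemma p_cont: "continuous_on (cball 0 1) (p w)"
  unfolding p_def by (intro continuous_intros q_cont)

lemma p_0 [simp]: "p w 0 = 1"
  by (simp add: p_def)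

lemma boundary_zero_in_weyl_spectrum:
  assumes "cmod \<zeta> = 1" "p w \<zeta> = 0"
  shows "w \<in> weyl_spectrum (toeplitz h)"
proof (rule ccontr)
  assume "w \<notin> weyl_spectrum (toeplitz h)"
  then have "weyl_linear (TT (\<lambda>z. h z - w))"
    by (rule not_in_weyl_spectrum_imp_weyl_linear[OF h_sym])
  moreover have "h \<zeta> - w = 0"
  proof -
    have "cnj \<zeta> * \<zeta> = 1" using complex_norm_square[of \<zeta>] assms(1) by (simp add: mult.commute)
    moreover have "cnj \<zeta> * p w \<zeta> = cnj \<zeta> + cnj \<zeta> * \<zeta> * (q \<zeta> - w)"
      unfolding p_def by (simp add: algebra_simps)
    ultimately have "cnj \<zeta> * p w \<zeta> = h \<zeta> - w"
      unfolding h_def by simp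
    then show ?thesis using assms(2) by simp
  qed
  ultimately show False
    using boundary_zero_not_weyl[of "\<lambda>z. h z - w" \<zeta>] assms(1) h_cont by (simp add: continuous_on_diff)
qed

text \<open>Multiplication by \<open>z / p w\<close> is an inverse of the operator on the right up
  to a compact term. It is injective, so index zero would make it surjective, but its multiplier
  vanishes at 0.\<close>

lemma no_zero_in_weyl_spectrum:
  assumes nz: "\<And>z. cmod z \<le> 1 \<Longrightarrow> p w z \<noteq> 0"
  shows "w \<in> weyl_spectrum (toeplitz h)"
proof (rule ccontr)
  assume "w \<notin> weyl_spectrum (toeplitz h)"
  then have A: "weyl_linear (TT (\<lambda>z. h z - w))"
    by (rule not_in_weyl_spectrum_imp_weyl_linear[OF h_sym])
  define m where "m z = z / p w z" for z
  have mc: "continuous_on (cball 0 1) m" and ic: "continuous_on (cball 0 1) (\<lambda>z. 1 / p w z)"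
    unfolding m_def using nz by (auto intro!: continuous_intros p_cont)
  have mh: "m holomorphic_on diskD"
    unfolding m_def diskD_def using nz by (intro holomorphic_intros p_hol) auto
  note ms = disk_symbol_cball[OF mc]
  note \<psi> = compact_linear_TT_radial[OF ic]
  have "TT (\<lambda>z. h z - w) (TT m f) = f + TT (\<lambda>z. (z * cnj z - 1) * (1 / p w z)) f" for f
  proof -
    have "TT (\<lambda>z. h z - w) (TT m f) = TT (\<lambda>z. (h z - w) * m z) f"
      by (rule TT_mult_holomorphic[OF ms mh, symmetric])
    also have "\<dots> = TT (\<lambda>z. 1 + (z * cnj z - 1) * (1 / p w z)) f"
    proof (rule TT_cong)
      fix z assume "z \<in> diskD"
      then have nz': "p w z \<noteq> 0" using nz by (simp add: diskD_def)
      \<comment> \<open>Inside the disk the relation between \<open>h\<close> and \<open>p\<close>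
        has a defect, which vanishes on the circle and yields the compact term.\<close>
      have "(h z - w) * z = p w z + (z * cnj z - 1)"
        by (simp add: h_def p_def algebra_simps)
      then show "(h z - w) * m z = 1 + (z * cnj z - 1) * (1 / p w z)"
        using nz' by (simp add: m_def field_simps)
    qed
    also have "\<dots> = TT (\<lambda>z. 1) f + TT (\<lambda>z. (z * cnj z - 1) * (1 / p w z)) f"
      by (rule TT_add[OF disk_symbol_const \<psi>(1)])
    also have "TT (\<lambda>z. 1) f = f" by (simp add: bfun_inject[symmetric] TT_const)
    finally show ?thesis .
  qed
  then have "surj (TT m)"
  proof (rule weyl_linear_right_factor[OF A bounded_linear_TT[OF ms] \<psi>(2)])
    fix f assume "TT m f = 0"
    then show "f = 0"
      by (rule TT_holomorphic_inj[OF ms mh, rotated 2, of _ "1/2"])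
         (use nz[of "1/2"] in \<open>auto simp: m_def diskD_def\<close>)
  qed
  moreover have "\<not> surj (TT m)"
    by (rule TT_holomorphic_not_surj[OF ms mh, of 0]) (auto simp: m_def diskD_def)
  ultimately show False by blast
qed

text \<open>If \<open>p w = (z - a) m\<close>, then \<open>h - w\<close> and \<open>(1 - a cnj z) m\<close> agree on the circle; the factor
  \<open>1 - a cnj z\<close> contributes an invertible operator.\<close>
lemma zero_decomposition:
  assumes m: "m holomorphic_on ball 0 1" "continuous_on (cball 0 1) m" "\<And>z. p w z = (z - a) * m z"
  shows "TT (\<lambda>z. h z - w) f = TT (\<lambda>z. 1 - a * cnj z) (TT m f) + TT (\<lambda>z. (z * cnj z - 1) * (m z - q z + w)) f"
    and "disk_symbol (\<lambda>z. (z * cnj z - 1) * (m z - q z + w))"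
    and "compact_linear (TT (\<lambda>z. (z * cnj z - 1) * (m z - q z + w)))"
proof -
  have c: "continuous_on (cball 0 1) (\<lambda>z. m z - q z + w)"
    by (intro continuous_intros m q_cont)
  show \<psi>: "disk_symbol (\<lambda>z. (z * cnj z - 1) * (m z - q z + w))"
    "compact_linear (TT (\<lambda>z. (z * cnj z - 1) * (m z - q z + w)))"
    using compact_linear_TT_radial[OF c] by auto
  have aff: "disk_symbol (\<lambda>z. 1 - a * cnj z)"
    by (intro disk_symbol_cball continuous_intros)
  note ms = disk_symbol_cball[OF m(2)]
  have "TT (\<lambda>z. h z - w) f = TT (\<lambda>z. (1 - a * cnj z) * m z + (z * cnj z - 1) * (m z - q z + w)) f"
  proof (rule TT_cong)
    fix z
    \<comment> \<open>The summand \<open>m z - q z + w\<close> is chosen so that the identity holds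
      on the whole disk and not only on the circle.\<close>
    have "(1 - a * cnj z) * m z + (z * cnj z - 1) * (m z - q z + w)
        = cnj z * ((z - a) * m z) - z * cnj z * (q z - w) + (q z - w)"
      by (simp add: algebra_simps)
    also have "\<dots> = h z - w"
      unfolding m(3)[symmetric] by (simp add: p_def h_def algebra_simps)
    finally show "h z - w = (1 - a * cnj z) * m z + (z * cnj z - 1) * (m z - q z + w)" by simp
  qed
  also have "\<dots> = TT (\<lambda>z. (1 - a * cnj z) * m z) f + TT (\<lambda>z. (z * cnj z - 1) * (m z - q z + w)) f"
    by (rule TT_add[OF disk_symbol_mult[OF aff ms] \<psi>(1)])
  also have "TT (\<lambda>z. (1 - a * cnj z) * m z) f = TT (\<lambda>z. 1 - a * cnj z) (TT m f)"
    by (rule TT_mult_holomorphic[OF ms]) (use m in \<open>simp add: diskD_def\<close>)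
  finally show "TT (\<lambda>z. h z - w) f = TT (\<lambda>z. 1 - a * cnj z) (TT m f) + TT (\<lambda>z. (z * cnj z - 1) * (m z - q z + w)) f" .
qed

text \<open>Splitting off the zero \<open>a\<close> and cancelling the invertible factor leaves
  \<open>TT m\<close> with index zero. It is injective, hence would be onto, although
  \<open>m\<close> still vanishes at \<open>b\<close>.\<close>

lemma two_zeros_in_weyl_spectrum:
  assumes a: "cmod a < 1" "p w a = 0" and b: "cmod b < 1" "p w b = 0" "a \<noteq> b"
  shows "w \<in> weyl_spectrum (toeplitz h)"
proof (rule ccontr)
  assume "w \<notin> weyl_spectrum (toeplitz h)"
  then have A: "weyl_linear (TT (\<lambda>z. h z - w))"
    by (rule not_in_weyl_spectrum_imp_weyl_linear[OF h_sym])
  obtain m where m: "m holomorphic_on ball 0 1" "continuous_on (cball 0 1) m" "\<And>z. p w z = (z - a) * m z"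
    using factor_zero[OF p_hol p_cont a] by blast
  note ms = disk_symbol_cball[OF m(2)]
  have mh: "m holomorphic_on diskD" using m by (simp add: diskD_def)
  have "weyl_linear (\<lambda>f. TT (\<lambda>z. h z - w) f + - TT (\<lambda>z. (z * cnj z - 1) * (m z - q z + w)) f)"
    by (intro weyl_linear_add_compact A compact_linear_uminus zero_decomposition(3)[OF m])
  then have "weyl_linear (\<lambda>f. TT (\<lambda>z. 1 - a * cnj z) (TT m f))"
    by (simp add: zero_decomposition(1)[OF m])
  then have W: "weyl_linear (TT m)"
    by (rule weyl_linear_left_cancel[OF linear_iso_imp_weyl[OF linear_iso_TT_affine(2)[OF a(1)]] bounded_linear_TT[OF ms]])
  have "linear_iso (TT m)"
  proof (rule weyl_linear_inj_imp_iso[OF W])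
    have "m 0 \<noteq> 0" using m(3)[of 0] by auto
    then show "f = 0" if "TT m f = 0" for f
      using TT_holomorphic_inj[OF ms mh, of 0 f] that by (simp add: diskD_def)
  qed
  then have "surj (TT m)" unfolding linear_iso_def by (metis surjI)
  moreover have "\<not> surj (TT m)"
    by (rule TT_holomorphic_not_surj[OF ms mh, of b]) (use m(3)[of b] b in \<open>auto simp: diskD_def\<close>)
  ultimately show False by blast
qed

text \<open>Here \<open>m\<close> has no zero on the closed disk, so \<open>TT m\<close> is inverted
  by multiplication with \<open>1 / m\<close>, and the operator without its compact term is
  invertible.\<close>

lemma one_simple_zero_not_in_weyl_spectrum:
  assumes a: "cmod a < 1" "p w a = 0" "deriv (p w) a \<noteq> 0"
    and only: "\<And>z. cmod z \<le> 1 \<Longrightarrow> p w z = 0 \<Longrightarrow> z = a"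
  shows "w \<notin> weyl_spectrum (toeplitz h)"
proof -
  obtain m where m: "m holomorphic_on ball 0 1" "continuous_on (cball 0 1) m" "\<And>z. p w z = (z - a) * m z"
    and ma: "m a = deriv (p w) a"
    using factor_zero[OF p_hol p_cont a(1,2)] by blast
  have nz: "m z \<noteq> 0" if "cmod z \<le> 1" for z
    using only[OF that] ma a(3) m(3)[of z] by (cases "z = a") auto
  have ic: "continuous_on (cball 0 1) (\<lambda>z. 1 / m z)"
    using nz by (auto intro!: continuous_intros m)
  have mh: "m holomorphic_on diskD" and ih: "(\<lambda>z. 1 / m z) holomorphic_on diskD"
    using m nz by (auto simp: diskD_def intro!: holomorphic_intros)
  note ms = disk_symbol_cball[OF m(2)]
  note js = disk_symbol_cball[OF ic]
  have inv: "1 / m z * (m z * bfun f z) = bfun f z" "m z * (1 / m z * bfun f z) = bfun f z" for f z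
    using nz[of z] bfun_outside[of z f] by (cases "z \<in> diskD"; simp add: diskD_def)+
  have m_iso: "TT (\<lambda>z. 1 / m z) (TT m f) = f" "TT m (TT (\<lambda>z. 1 / m z) f) = f" for f
    unfolding bfun_inject[symmetric] bfun_TT_holomorphic[OF ms mh] bfun_TT_holomorphic[OF js ih]
    by (rule ext, rule inv)+
  obtain R where R: "bounded_linear R" "\<And>x. R (TT (\<lambda>z. 1 - a * cnj z) x) = x" "\<And>x. TT (\<lambda>z. 1 - a * cnj z) (R x) = x"
    using linear_iso_TT_affine(2)[OF a(1)] unfolding linear_iso_def by blast
  have iso: "linear_iso (\<lambda>f. TT (\<lambda>z. 1 - a * cnj z) (TT m f))"
    unfolding linear_iso_def
  proof (intro conjI exI[of _ "\<lambda>f. TT (\<lambda>z. 1 / m z) (R f)"] allI)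
    show "bounded_linear (\<lambda>f. TT (\<lambda>z. 1 - a * cnj z) (TT m f))"
      by (intro bounded_linear_compose[OF bounded_linear_TT bounded_linear_TT] linear_iso_TT_affine a ms)
    show "bounded_linear (\<lambda>f. TT (\<lambda>z. 1 / m z) (R f))"
      by (intro bounded_linear_compose[OF bounded_linear_TT] R js)
  qed (simp_all add: R m_iso)
  \<comment> \<open>The compact term is removed by adding the Toeplitz operator of the opposite
    symbol.\<close>
  define v where "v z = (z * cnj z - 1) * (- (m z - q z + w))" for z
  have vc: "continuous_on (cball 0 1) (\<lambda>z. - (m z - q z + w))"
    by (intro continuous_intros m q_cont)
  have vs: "disk_symbol v" "compact_linear (TT v)"
    using compact_linear_TT_radial[OF vc] by (simp_all add: v_def[abs_def])
  have "TT (\<lambda>z. (z * cnj z - 1) * (m z - q z + w)) f + TT v f = 0" for f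
  proof -
    have "TT (\<lambda>z. (z * cnj z - 1) * (m z - q z + w)) f + TT v f
        = TT (\<lambda>z. (z * cnj z - 1) * (m z - q z + w) + v z) f"
      by (rule TT_add[symmetric, OF zero_decomposition(2)[OF m] vs(1)])
    also have "\<dots> = TT (\<lambda>z. 0) f"
      by (rule TT_cong) (simp add: v_def algebra_simps)
    finally show ?thesis by (simp add: bfun_inject[symmetric] TT_const bfun_simps)
  qed
  then have "(\<lambda>f. TT (\<lambda>z. h z - w) f + TT v f) = (\<lambda>f. TT (\<lambda>z. 1 - a * cnj z) (TT m f))"
    by (simp add: zero_decomposition(1)[OF m] add.assoc)
  then show ?thesis
    using not_in_weyl_spectrumI[OF h_sym vs, of w] iso by simp
qed

end


subsection \<open>The eigenvalue equation as a differential equation\<close>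

definition monomial_disk :: "nat \<Rightarrow> complex \<Rightarrow> complex" where
  "monomial_disk n z = (if z \<in> diskD then z ^ n else 0)"

lemma monomial_disk_in_bergman: "monomial_disk n \<in> bergman"
proof -
  have "disk_symbol (\<lambda>z. z ^ n)" by (intro disk_symbol_cball continuous_intros)
  from bounded_holomorphic_in_bergman[OF this] show ?thesis
    unfolding monomial_disk_def[abs_def] by (simp add: holomorphic_on_power)
qed

text \<open>The formula on smaller balls is carried to the whole disk by letting the radius tend to
  1. As \<open>f\<close> may be unbounded near the circle, convergence rests on the integrability of
  the product.\<close>

lemma bergman_taylor_coefficient:
  assumes f: "f \<in> bergman"
  shows "(LINT z|lborel. f z * cnj (monomial_disk n z)) = (deriv ^^ n) f 0 / fact n * of_real (pi / (n + 1))"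
proof -
  \<comment> \<open>Adding 2 keeps every radius positive.\<close>
  define r where "r k = 1 - 1 / real (k + 2)" for k :: nat
  have r: "0 < r k" "r k < 1" for k by (auto simp: r_def field_simps)
  have rlim: "r \<longlonglongrightarrow> 1 - 0"
    unfolding r_def[abs_def]
    by (intro tendsto_diff tendsto_const)
       (use LIMSEQ_ignore_initial_segment[OF lim_1_over_n, of 2] in simp)
  have inc: "incseq (\<lambda>k. ball (0::complex) (r k))"
    unfolding incseq_def by (auto simp: r_def field_simps intro!: subset_ball)
  have un: "(\<Union>k. ball (0::complex) (r k)) = diskD"
  proof
    show "(\<Union>k. ball (0::complex) (r k)) \<subseteq> diskD"
      using r(2) less_trans by (fastforce simp: diskD_def)
    show "diskD \<subseteq> (\<Union>k. ball (0::complex) (r k))"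
    proof
      fix z :: complex assume "z \<in> diskD"
      then have "cmod z < 1 - 0" by (simp add: diskD_def)
      from order_tendstoD(1)[OF rlim this] obtain k where "cmod z < r k"
        using eventually_happens'[OF sequentially_bot] by blast
      then show "z \<in> (\<Union>k. ball (0::complex) (r k))" by auto
    qed
  qed
  have int: "set_integrable lborel (\<Union>k. ball (0::complex) (r k)) (\<lambda>z. f z * cnj z ^ n)"
  proof -
    have "integrable lborel (\<lambda>z. f z * cnj (monomial_disk n z))"
      by (intro L2_disk_mult_integrable bergman_L2 f monomial_disk_in_bergman)
    moreover have "(\<lambda>z. indicator diskD z *\<^sub>R (f z * cnj z ^ n)) = (\<lambda>z. f z * cnj (monomial_disk n z))"
      by (auto simp: monomial_disk_def indicator_def)
    ultimately show ?thesis unfolding un set_integrable_def by simp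
  qed
  have "(\<lambda>k. LINT z:ball 0 (r k)|lborel. f z * cnj z ^ n) \<longlonglongrightarrow> (LINT z:diskD|lborel. f z * cnj z ^ n)"
    using set_integral_cont_up[OF _ inc int] by (simp add: un)
  moreover have "(LINT z:diskD|lborel. f z * cnj z ^ n) = (LINT z|lborel. f z * cnj (monomial_disk n z))"
    unfolding set_lebesgue_integral_def
    by (intro Bochner_Integration.integral_cong) (auto simp: monomial_disk_def indicator_def)
  moreover have "(LINT z:ball 0 (r k)|lborel. f z * cnj z ^ n)
      = (deriv ^^ n) f 0 / fact n * of_real (pi * r k ^ (2 * n + 2) / (n + 1))" for k
    using f r by (intro taylor_coefficient_integral[of f 1]) (auto simp: bergman_def diskD_def)
  moreover have "(\<lambda>k. (deriv ^^ n) f 0 / fact n * of_real (pi * r k ^ (2 * n + 2) / (n + 1)))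
      \<longlonglongrightarrow> (deriv ^^ n) f 0 / fact n * of_real (pi * (1 - 0) ^ (2 * n + 2) / (n + 1))"
    by (intro tendsto_intros rlim) auto
  ultimately show ?thesis by (simp add: LIMSEQ_unique)
qed

lemma disk_symbol_cnj: "disk_symbol cnj"
  by (intro disk_symbol_cball continuous_intros)

text \<open>Pairing \<open>cnj z * f\<close> with \<open>z ^ n\<close> is pairing \<open>f\<close>
  with \<open>z ^ (n + 1)\<close>. As these monomials have squared norms \<open>1 / (n + 1)\<close>
  and \<open>1 / (n + 2)\<close>, the \<open>n\<close>-th coefficient of the projection is
  \<open>(n + 1) / (n + 2)\<close> times coefficient \<open>n + 1\<close> of \<open>f\<close>. The
  latter is \<open>n + 2\<close> times that of \<open>g\<close>, and what results is the coefficient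
  of \<open>deriv g\<close>.\<close>

lemma toeplitz_cnj_derivative:
  assumes f: "f \<in> bergman"
  obtains g where "g holomorphic_on diskD"
    "\<And>z. z \<in> diskD \<Longrightarrow> f z = g z + z * deriv g z"
    "\<And>z. z \<in> diskD \<Longrightarrow> toeplitz cnj f z = deriv g z"
proof -
  define k where "k = toeplitz cnj f"
  have opD: "open diskD" "convex diskD" "0 \<in> diskD" by (auto simp: diskD_def)
  have kB: "k \<in> bergman"
    using bounded_op_toeplitz[OF disk_symbol_cnj] f by (simp add: k_def bounded_op_def)
  have fh: "f holomorphic_on diskD" and kh: "k holomorphic_on diskD"
    using f kB by (auto simp: bergman_def)
  obtain F where F: "\<And>z. z \<in> diskD \<Longrightarrow> (F has_field_derivative f z) (at z within diskD)"
    by (rule holomorphic_convex_primitive'[OF opD(2,1) fh]) (rule that; assumption)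
  have Fd: "(F has_field_derivative f z) (at z)" if "z \<in> diskD" for z
    using F[OF that] unfolding at_within_open[OF that opD(1)] .
  have Fh: "F holomorphic_on diskD"
    using F by (auto simp: holomorphic_on_def field_differentiable_def)
  \<comment> \<open>\<open>g\<close> is the difference quotient at 0 of a primitive of
    \<open>f\<close>, so that \<open>z * g z\<close> is again a primitive.\<close>
  define g where "g z = (if z = 0 then deriv F 0 else (F z - F 0) / (z - 0))" for z
  have gh: "g holomorphic_on diskD"
    unfolding g_def by (rule pole_lemma_open[OF Fh opD(1)])
  have gF: "z * g z = F z - F 0" for z
    by (simp add: g_def)
  have gd: "(g has_field_derivative deriv g z) (at z)" if "z \<in> diskD" for z
    using gh opD(1) that by (rule holomorphic_derivI)
  have fg: "f z = deriv (\<lambda>z. z * g z) z" if "z \<in> diskD" for z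
    unfolding gF using Fd[OF that] by (auto intro!: DERIV_imp_deriv[symmetric] derivative_eq_intros)
  have fg': "f z = g z + z * deriv g z" if "z \<in> diskD" for z
  proof -
    have "((\<lambda>z. z * g z) has_field_derivative g z + z * deriv g z) (at z)"
      using gd[OF that] by (auto intro!: derivative_eq_intros)
    then show ?thesis using fg[OF that] DERIV_imp_deriv by simp
  qed
  define G where "G = fps_expansion g 0"
  have G: "g has_fps_expansion G"
    unfolding G_def using opD gh by (intro has_fps_expansion_fps_expansion)
  have "deriv (\<lambda>z. z * g z) has_fps_expansion fps_deriv (fps_X * G)"
    by (intro fps_expansion_intros G)
  moreover have "eventually (\<lambda>z. deriv (\<lambda>z. z * g z) z = f z) (nhds 0)"
    using eventually_nhds_in_open[OF opD(1,3)] by (rule eventually_mono) (simp add: fg)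
  ultimately have fe: "f has_fps_expansion fps_deriv (fps_X * G)"
    using has_fps_expansion_cong by blast
  have de: "deriv g has_fps_expansion fps_deriv G"
    by (intro fps_expansion_intros G)
  have coeff: "(deriv ^^ n) k 0 = (deriv ^^ n) (deriv g) 0" for n
  proof -
    have L: "L2_disk (\<lambda>z. cnj z * f z)"
      by (intro disk_symbol_mult_L2 disk_symbol_cnj bergman_L2 f)
    have "(LINT z|lborel. k z * cnj (monomial_disk n z)) = (LINT z|lborel. cnj z * f z * cnj (monomial_disk n z))"
      unfolding k_def toeplitz_def by (rule bergman_proj(2)[OF L monomial_disk_in_bergman, symmetric])
    also have "\<dots> = (LINT z|lborel. f z * cnj (monomial_disk (Suc n) z))"
      by (intro Bochner_Integration.integral_cong) (auto simp: monomial_disk_def)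
    finally have "(deriv ^^ n) k 0 / fact n * of_real (pi / (n + 1))
        = (deriv ^^ Suc n) f 0 / fact (Suc n) * of_real (pi / (Suc n + 1))"
      by (simp only: bergman_taylor_coefficient[OF kB] bergman_taylor_coefficient[OF f])
    also have "(deriv ^^ Suc n) f 0 / fact (Suc n) = fps_nth (fps_deriv (fps_X * G)) (Suc n)"
      by (rule fps_nth_fps_expansion[OF fe, symmetric])
    also have "\<dots> = of_nat (n + 2) * fps_nth G (Suc n)" by (simp add: algebra_simps)
    also have "of_nat (n + 2) * fps_nth G (Suc n) * of_real (pi / (Suc n + 1)) = of_real pi * fps_nth G (Suc n)"
    proof -
      have "(of_nat (n + 2) :: complex) \<noteq> 0" unfolding of_nat_eq_0_iff by simp
      then show ?thesis by (simp add: field_simps)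
    qed
    finally have "(deriv ^^ n) k 0 / fact n = of_nat (n + 1) * fps_nth G (Suc n)"
    proof -
      assume *: "(deriv ^^ n) k 0 / fact n * of_real (pi / (n + 1)) = of_real pi * fps_nth G (Suc n)"
      have n1: "(of_nat (n + 1) :: complex) \<noteq> 0" unfolding of_nat_eq_0_iff by simp
      define X where "X = (deriv ^^ n) k 0 / fact n"
      have "complex_of_real (pi / (n + 1)) = of_real pi / of_nat (n + 1)" by simp
      then have "X * (of_real pi / of_nat (n + 1)) * of_nat (n + 1) = of_real pi * fps_nth G (Suc n) * of_nat (n + 1)"
        using * by (simp only: X_def)
      then have "of_real pi * X = of_real pi * (of_nat (n + 1) * fps_nth G (Suc n))"
        using n1 by (simp add: mult_ac del: of_nat_add)
      then have "of_real pi * ((deriv ^^ n) k 0 / fact n) = of_real pi * (of_nat (n + 1) * fps_nth G (Suc n))"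
        by (simp only: X_def)
      then show ?thesis by (subst (asm) mult_cancel_left) auto
    qed
    also have "\<dots> = fps_nth (fps_deriv G) n" by simp
    also have "\<dots> = (deriv ^^ n) (deriv g) 0 / fact n" by (rule fps_nth_fps_expansion[OF de])
    finally show ?thesis by simp
  qed
  have "k z = deriv g z" if "z \<in> diskD" for z
    by (rule holomorphic_fun_eq_on_ball[of k 0 1])
       (use kh gh that coeff in \<open>auto simp: diskD_def intro!: holomorphic_deriv\<close>)
  then show ?thesis using that gh fg' by (simp add: k_def)
qed

text \<open>At a zero \<open>a\<close> of order \<open>n > 0\<close> of \<open>g\<close>, dividing the equation by \<open>(z - a)\<^sup>n\<close> and letting \<open>z \<longrightarrow> a\<close>
  gives the indicial equation \<open>n P'(a) + s(a) = 0\<close>.\<close>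
lemma linear_ode_zero_order:
  assumes S: "open S" "connected S" "a \<in> S"
    and hol: "P holomorphic_on S" "s holomorphic_on S" "g holomorphic_on S"
    and ode: "\<And>z. z \<in> S \<Longrightarrow> P z * deriv g z + s z * g z = 0"
    and nz: "z0 \<in> S" "g z0 \<noteq> 0" and ga: "g a = 0"
  shows "P a = 0" "\<exists>n::nat. n > 0 \<and> of_nat n * deriv P a = - s a"
proof -
  have nc: "\<not> g constant_on S" using nz ga S(3) unfolding constant_on_def by metis
  obtain g1 r n where n: "0 < (n::nat)" "0 < r" "ball a r \<subseteq> S" "g1 holomorphic_on ball a r"
    and gg: "\<And>w. w \<in> ball a r \<Longrightarrow> g w = (w - a) ^ n * g1 w"
    and g1: "\<And>w. w \<in> ball a r \<Longrightarrow> g1 w \<noteq> 0"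
    by (rule holomorphic_factor_zero_nonconstant[OF hol(3) S ga nc]) (rule that; assumption)
  have aB: "a \<in> ball a r" using n by simp
  \<comment> \<open>Dividing out only \<open>(w - a) ^ (n - 1)\<close> leaves an identity whose
    limit gives \<open>P a = 0\<close>. Only then does \<open>P w / (w - a)\<close> have a limit,
    and a second passage to the limit gives the indicial equation.\<close>
  have eq: "of_nat n * P w * g1 w + (w - a) * (P w * deriv g1 w + s w * g1 w) = 0"
    if w: "w \<in> ball a r" "w \<noteq> a" for w
  proof -
    obtain m where m: "n = Suc m" using n(1) by (cases n) auto
    have g1d: "(g1 has_field_derivative deriv g1 w) (at w)"
      using n(4) w(1) by (auto intro: holomorphic_derivI)
    have "((\<lambda>w. (w - a) ^ n * g1 w) has_field_derivative
        of_nat n * (w - a) ^ m * g1 w + (w - a) ^ n * deriv g1 w) (at w)"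
      by (rule derivative_eq_intros g1d refl)+ (simp add: m)
    then have "(g has_field_derivative of_nat n * (w - a) ^ m * g1 w + (w - a) ^ n * deriv g1 w) (at w)"
      by (rule has_field_derivative_transform_within_open[OF _ open_ball w(1)]) (simp add: gg)
    then have "deriv g w = of_nat n * (w - a) ^ m * g1 w + (w - a) ^ n * deriv g1 w"
      by (rule DERIV_imp_deriv)
    with ode[of w] w n(3) gg[OF w(1)]
    have "P w * (of_nat n * (w - a) ^ m * g1 w + (w - a) ^ n * deriv g1 w) + s w * ((w - a) ^ n * g1 w) = 0"
      by auto
    then have "(w - a) ^ m * (of_nat n * P w * g1 w + (w - a) * (P w * deriv g1 w + s w * g1 w)) = 0"
      by (simp add: m algebra_simps)
    then show ?thesis using w(2) by simp
  qed
  have lims: "(P \<longlongrightarrow> P a) (at a)" "(s \<longlongrightarrow> s a) (at a)" "(g1 \<longlongrightarrow> g1 a) (at a)" "(deriv g1 \<longlongrightarrow> deriv g1 a) (at a)"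
    using hol(1,2)[THEN holomorphic_on_imp_continuous_on] S(1,3)
      n(4)[THEN holomorphic_on_imp_continuous_on] aB
      holomorphic_deriv[OF n(4) open_ball, THEN holomorphic_on_imp_continuous_on]
    by (auto simp: continuous_on_eq_continuous_at isCont_def)
  have near: "eventually (\<lambda>w. w \<in> ball a r \<and> w \<noteq> a) (at a)"
    using eventually_at_ball'[OF n(2)] by (rule eventually_mono) auto
  have "((\<lambda>w. of_nat n * P w * g1 w + (w - a) * (P w * deriv g1 w + s w * g1 w))
      \<longlongrightarrow> of_nat n * P a * g1 a + (a - a) * (P a * deriv g1 a + s a * g1 a)) (at a)"
    by (intro tendsto_intros lims)
  moreover have "((\<lambda>w. of_nat n * P w * g1 w + (w - a) * (P w * deriv g1 w + s w * g1 w)) \<longlongrightarrow> 0) (at a)"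
    by (rule tendsto_eventually) (use near eq in \<open>auto elim: eventually_mono\<close>)
  ultimately have "of_nat n * P a * g1 a + (a - a) * (P a * deriv g1 a + s a * g1 a) = 0"
    using tendsto_unique[OF at_neq_bot] by blast
  then show Pa: "P a = 0" using g1[OF aB] n(1) by simp
  have "(P has_field_derivative deriv P a) (at a)"
    using hol(1) S by (auto intro: holomorphic_derivI)
  then have dP: "((\<lambda>w. P w / (w - a)) \<longlongrightarrow> deriv P a) (at a)"
    by (simp add: has_field_derivative_iff Pa)
  have "((\<lambda>w. of_nat n * (P w / (w - a)) * g1 w + (P w * deriv g1 w + s w * g1 w))
      \<longlongrightarrow> of_nat n * deriv P a * g1 a + (P a * deriv g1 a + s a * g1 a)) (at a)"
    by (intro tendsto_intros lims dP)
  moreover have "((\<lambda>w. of_nat n * (P w / (w - a)) * g1 w + (P w * deriv g1 w + s w * g1 w)) \<longlongrightarrow> 0) (at a)"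
  proof (rule tendsto_eventually, rule eventually_mono[OF near])
    fix w assume w: "w \<in> ball a r \<and> w \<noteq> a"
    then have "(w - a) * (of_nat n * (P w / (w - a)) * g1 w + (P w * deriv g1 w + s w * g1 w))
        = of_nat n * P w * g1 w + (w - a) * (P w * deriv g1 w + s w * g1 w)"
      by (simp add: distrib_left)
    then show "of_nat n * (P w / (w - a)) * g1 w + (P w * deriv g1 w + s w * g1 w) = 0"
      using eq[of w] w by simp
  qed
  ultimately have "of_nat n * deriv P a * g1 a + (P a * deriv g1 a + s a * g1 a) = 0"
    using tendsto_unique[OF at_neq_bot] by blast
  then have "(of_nat n * deriv P a + s a) * g1 a = 0" by (simp add: Pa algebra_simps)
  then have "of_nat n * deriv P a = - s a" using g1[OF aB] by (simp add: add_eq_0_iff2)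
  then show "\<exists>n::nat. n > 0 \<and> of_nat n * deriv P a = - s a" using n(1) by blast
qed

context disk_algebra_symbol
begin

lemma deriv_p:
  assumes "cmod z < 1"
  shows "deriv (p w) z = q z - w + z * deriv q z"
proof -
  have "(q has_field_derivative deriv q z) (at z)"
    using q_hol assms by (auto intro: holomorphic_derivI)
  then have "(p w has_field_derivative q z - w + z * deriv q z) (at z)"
    unfolding p_def[abs_def] by (auto intro!: derivative_eq_intros)
  then show ?thesis by (rule DERIV_imp_deriv)
qed

text \<open>With \<open>f = g + z g'\<close> the equation \<open>g' + (q - w) f = 0\<close> collects
  \<open>g'\<close> with the factor \<open>1 + z (q - w)\<close>, which is \<open>p w\<close>. The
  value at 0 is kept because it will determine the eigenvector.\<close>

lemma eigenvector_ode:
  assumes F: "TT (\<lambda>z. h z - w) F = 0" "F \<noteq> 0"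
  obtains g z0 where "g holomorphic_on diskD" "z0 \<in> diskD" "g z0 \<noteq> 0" "g 0 = bfun F 0"
    "\<And>z. z \<in> diskD \<Longrightarrow> p w z * deriv g z + (q z - w) * g z = 0"
proof -
  have fB: "bfun F \<in> bergman" by (rule bfun)
  obtain g where g: "g holomorphic_on diskD"
    "\<And>z. z \<in> diskD \<Longrightarrow> bfun F z = g z + z * deriv g z"
    "\<And>z. z \<in> diskD \<Longrightarrow> toeplitz cnj (bfun F) z = deriv g z"
    using toeplitz_cnj_derivative[OF fB] by blast
  have qs: "disk_symbol q" by (rule disk_symbol_cball[OF q_cont])
  have "bfun (TT (\<lambda>z. h z - w) F) = (\<lambda>z. 0)" using F(1) by (simp add: bfun_simps)
  then have "toeplitz h (bfun F) z - w * bfun F z = 0" for z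
    by (simp add: bfun_TT disk_symbol_diff_const h_sym toeplitz_diff_const fB fun_eq_iff)
  moreover have "toeplitz h (bfun F) = (\<lambda>z. toeplitz cnj (bfun F) z + q z * bfun F z)"
    unfolding h_def[abs_def]
    using toeplitz_add[OF disk_symbol_cnj qs fB] toeplitz_holomorphic[OF qs _ fB] q_hol
    by (simp add: diskD_def)
  ultimately have *: "toeplitz cnj (bfun F) z + (q z - w) * bfun F z = 0" for z
    by (simp add: algebra_simps)
  have ode: "p w z * deriv g z + (q z - w) * g z = 0" if "z \<in> diskD" for z
    using *[of z] g(2,3)[OF that] by (simp add: p_def algebra_simps)
  have "\<exists>z0\<in>diskD. g z0 \<noteq> 0"
  proof (rule ccontr)
    assume "\<not> ?thesis"
    then have 0: "\<And>z. z \<in> diskD \<Longrightarrow> g z = 0" by blast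
    have "deriv g z = 0" if z: "z \<in> diskD" for z
    proof -
      have "eventually (\<lambda>z. g z = 0) (nhds z)"
        by (rule eventually_mono[OF eventually_nhds_in_open[of diskD z]]) (use z 0 in \<open>auto simp: diskD_def\<close>)
      then have "(g has_field_derivative 0) (at z)"
        using DERIV_cong_ev[OF refl, of g "\<lambda>_. 0" z 0] by simp
      then show ?thesis by (rule DERIV_imp_deriv)
    qed
    then have "bfun F z = 0" for z
      using 0 g(2) bfun_outside by (cases "z \<in> diskD") auto
    then show False using F(2) by (simp add: bfun_inject[symmetric] bfun_simps fun_eq_iff)
  qed
  then obtain z0 where "z0 \<in> diskD" "g z0 \<noteq> 0" by blast
  then show ?thesis
    using that g(1) g(2)[of 0] ode by (auto simp: diskD_def)
qed

text \<open>At a zero of \<open>p w\<close> one has \<open>a * (q a - w) = -1\<close>, so the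
  equation forces \<open>g a = 0\<close> and the indicial equation applies. Multiplying it by
  \<open>a\<close> removes \<open>w\<close>; what is left is a condition on \<open>a\<close>
  alone.\<close>

lemma eigenvector_zero_order:
  assumes F: "TT (\<lambda>z. h z - w) F = 0" "F \<noteq> 0" and a: "cmod a < 1" "p w a = 0"
  shows "deriv (p w) a \<noteq> 0" "\<exists>n::nat. n > 0 \<and> of_nat n * (a\<^sup>2 * deriv q a - 1) = 1"
proof -
  obtain g z0 where g: "g holomorphic_on diskD" "z0 \<in> diskD" "g z0 \<noteq> 0"
    and ode: "\<And>z. z \<in> diskD \<Longrightarrow> p w z * deriv g z + (q z - w) * g z = 0"
    using eigenvector_ode[OF F] by blast
  have aD: "a \<in> diskD" using a by (simp add: diskD_def)
  have az: "a * (q a - w) = -1" using a(2) by (simp add: p_def add_eq_0_iff)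
  then have sa: "q a - w \<noteq> 0" "a \<noteq> 0" by auto
  have ga: "g a = 0" using ode[OF aD] a(2) sa by simp
  have "\<exists>n::nat. n > 0 \<and> of_nat n * deriv (p w) a = - (q a - w)"
  proof (rule linear_ode_zero_order(2)[OF _ _ aD _ _ g(1) ode g(2,3) ga])
    show "p w holomorphic_on diskD" "(\<lambda>z. q z - w) holomorphic_on diskD"
      using p_hol q_hol by (auto simp: diskD_def intro!: holomorphic_intros)
  qed (auto simp: diskD_def)
  then obtain n :: nat where n: "n > 0" "of_nat n * deriv (p w) a = - (q a - w)" by blast
  then show "deriv (p w) a \<noteq> 0" using sa by auto
  have "a * (of_nat n * deriv (p w) a) = 1" unfolding n(2) using az by (simp only: mult_minus_right) simp
  also have "a * (of_nat n * deriv (p w) a) = of_nat n * (a * (q a - w) + a\<^sup>2 * deriv q a)"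
    by (simp add: deriv_p[OF a(1)] algebra_simps power2_eq_square)
  finally have "of_nat n * (a\<^sup>2 * deriv q a - 1) = 1" unfolding az by simp
  then show "\<exists>n::nat. n > 0 \<and> of_nat n * (a\<^sup>2 * deriv q a - 1) = 1"
    using n(1) by blast
qed

text \<open>Since \<open>p w 0 = 1\<close>, the origin is a regular point of the differential
  equation, where a nonzero solution cannot vanish.\<close>

lemma eigenvector_at_0:
  assumes F: "TT (\<lambda>z. h z - w) F = 0" "F \<noteq> 0"
  shows "bfun F 0 \<noteq> 0"
proof
  assume 0: "bfun F 0 = 0"
  obtain g z0 where g: "g holomorphic_on diskD" "z0 \<in> diskD" "g z0 \<noteq> 0" "g 0 = bfun F 0"
    and ode: "\<And>z. z \<in> diskD \<Longrightarrow> p w z * deriv g z + (q z - w) * g z = 0"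
    using eigenvector_ode[OF F] by blast
  have 0: "g 0 = 0" using 0 g(4) by simp
  have "p w 0 = 0"
  proof (rule linear_ode_zero_order(1)[OF _ _ _ _ _ g(1) ode g(2,3) 0])
    show "p w holomorphic_on diskD" "(\<lambda>z. q z - w) holomorphic_on diskD"
      using p_hol q_hol by (auto simp: diskD_def intro!: holomorphic_intros)
  qed (auto simp: diskD_def)
  then show False by simp
qed

text \<open>Two eigenvectors have a nontrivial combination vanishing at 0, which is then
  zero.\<close>

lemma fin_dim_eigenspace: "fin_dim_C (eigenspace_op (toeplitz h) w)"
proof (cases "\<exists>F. F \<noteq> 0 \<and> TT (\<lambda>z. h z - w) F = 0")
  case True
  then obtain F where F: "F \<noteq> 0" "TT (\<lambda>z. h z - w) F = 0" by blast
  have sym: "disk_symbol (\<lambda>z. h z - w)" by (rule disk_symbol_diff_const[OF h_sym])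
  have F0: "bfun F 0 \<noteq> 0" using eigenvector_at_0 F by blast
  have "\<exists>c. f = (\<lambda>z. \<Sum>b\<in>{bfun F}. c b * b z)" if f: "f \<in> eigenspace_op (toeplitz h) w" for f
  proof -
    have fB: "f \<in> bergman" using f by (simp add: eigenspace_op_def)
    define c where "c = f 0 / bfun F 0"
    define d where "d = (\<lambda>z. 1 * f z + (- c) * bfun F z)"
    have dB: "d \<in> bergman" unfolding d_def by (intro bergman_lincomb fB bfun)
    have "toeplitz (\<lambda>z. h z - w) f = (\<lambda>z. 0)" "toeplitz (\<lambda>z. h z - w) (bfun F) = (\<lambda>z. 0)"
      using f F(2) by (auto simp: eigenspace_toeplitz_iff[OF h_sym fB] bfun_inject[symmetric] bfun_TT[OF sym]
          Bfun_inverse[OF fB] bfun_simps)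
    then have "toeplitz (\<lambda>z. h z - w) d = (\<lambda>z. 0)"
      using bounded_op_toeplitz[OF sym, unfolded bounded_op_def, THEN conjunct2, THEN conjunct1,
          rule_format, OF fB bfun[of F], of 1 "- c"]
      unfolding d_def by simp
    then have "TT (\<lambda>z. h z - w) (Bfun d) = 0"
      by (simp add: bfun_inject[symmetric] bfun_TT[OF sym] Bfun_inverse[OF dB] bfun_simps)
    moreover have "bfun (Bfun d) 0 = 0" unfolding Bfun_inverse[OF dB] using F0 by (simp add: d_def c_def)
    ultimately have "Bfun d = 0" using eigenvector_at_0 by blast
    then have "d z = 0" for z using Bfun_inverse[OF dB] by (metis bfun_simps(1))
    then have "f z = c * bfun F z" for z by (simp add: d_def)
    then show ?thesis by (intro exI[of _ "\<lambda>_. c"]) auto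
  qed
  then show ?thesis
    unfolding fin_dim_C_def by (intro exI[of _ "{bfun F}"]) simp
next
  case False
  have "f = (\<lambda>z. \<Sum>b\<in>{}. 0 * b z)" if "f \<in> eigenspace_op (toeplitz h) w" for f
  proof -
    have fB: "f \<in> bergman" using that by (simp add: eigenspace_op_def)
    then have "Bfun f = 0" using False that eigenspace_toeplitz_iff[OF h_sym fB] by blast
    then show ?thesis using Bfun_inverse[OF fB] by (simp add: bfun_simps)
  qed
  then show ?thesis unfolding fin_dim_C_def by (intro exI[of _ "{}"]) auto
qed

lemma eigenspace_nonzero_iff:
  "eigenspace_op (toeplitz h) w \<noteq> {\<lambda>z. 0} \<longleftrightarrow> (\<exists>F. F \<noteq> 0 \<and> TT (\<lambda>z. h z - w) F = 0)"
proof
  have "(\<lambda>z. 0) \<in> eigenspace_op (toeplitz h) w"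
  proof -
    have "Bfun (\<lambda>z. 0) = 0" by (simp add: zero_berg_def)
    then show ?thesis
      using bounded_linear_TT[OF disk_symbol_diff_const[OF h_sym], THEN bounded_linear.linear, THEN linear_0]
      by (simp add: eigenspace_toeplitz_iff[OF h_sym zero_in_bergman])
  qed
  moreover assume "eigenspace_op (toeplitz h) w \<noteq> {\<lambda>z. 0}"
  ultimately obtain f where f: "f \<in> eigenspace_op (toeplitz h) w" "f \<noteq> (\<lambda>z. 0)" by blast
  have fB: "f \<in> bergman" using f by (simp add: eigenspace_op_def)
  have "Bfun f \<noteq> 0" using f(2) Bfun_inverse[OF fB] by (auto simp: bfun_simps)
  then show "\<exists>F. F \<noteq> 0 \<and> TT (\<lambda>z. h z - w) F = 0"
    using f(1) eigenspace_toeplitz_iff[OF h_sym fB] by blast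
next
  assume "\<exists>F. F \<noteq> 0 \<and> TT (\<lambda>z. h z - w) F = 0"
  then obtain F where F: "F \<noteq> 0" "TT (\<lambda>z. h z - w) F = 0" by blast
  then have "bfun F \<in> eigenspace_op (toeplitz h) w"
    by (simp add: eigenspace_toeplitz_iff[OF h_sym bfun] bfun_inverse)
  moreover have "bfun F \<noteq> (\<lambda>z. 0)" using F(1) by (simp add: bfun_inject[symmetric] bfun_simps)
  ultimately show "eigenspace_op (toeplitz h) w \<noteq> {\<lambda>z. 0}" by blast
qed

end


subsection \<open>Weyl's theorem\<close>

context disk_algebra_symbol
begin

text \<open>A zero \<open>z\<close> gives back \<open>w\<close> as \<open>q z + 1 / z\<close>.
  Distinct parameters thus have no zero in common.\<close>

lemma p_zero_determines_w:
  assumes "p w z = 0" "p w' z = 0"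
  shows "w = w'"
proof -
  have "z * (w - w') = p w' z - p w z" by (simp add: p_def algebra_simps)
  moreover have "z \<noteq> 0" using assms(1) by auto
  ultimately show ?thesis using assms by simp
qed

text \<open>With index zero, such spectral points are eigenvalues. For a sequence of them the
  numbers \<open>1 / v (a n)\<close> are positive integers, the orders of vanishing. A convergent
  sequence of integers is eventually constant, and the identity theorem spreads this value from the
  zeros \<open>a n\<close> to the origin.\<close>

lemma isolated_outside_weyl_spectrum:
  assumes w0: "w0 \<in> op_spectrum (toeplitz h)" "w0 \<notin> weyl_spectrum (toeplitz h)"
  shows "\<not> w0 islimpt op_spectrum (toeplitz h)"
proof
  assume "w0 islimpt op_spectrum (toeplitz h)"
  then obtain x where x: "\<And>n. x n \<in> op_spectrum (toeplitz h) - {w0}" "x \<longlonglongrightarrow> w0"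
    unfolding islimpt_sequential by blast
  have ker: "\<exists>F. F \<noteq> 0 \<and> TT (\<lambda>z. h z - w) F = 0"
    if "w \<in> op_spectrum (toeplitz h)" "w \<notin> weyl_spectrum (toeplitz h)" for w
    using weyl_linear_inj_imp_iso[OF not_in_weyl_spectrum_imp_weyl_linear[OF h_sym that(2)]]
      that(1) op_spectrum_toeplitz_iff[OF h_sym] by blast
  have zero: "\<exists>a. cmod a < 1 \<and> p w a = 0" if w: "w \<notin> weyl_spectrum (toeplitz h)" for w
  proof -
    obtain z where z: "cmod z \<le> 1" "p w z = 0" using no_zero_in_weyl_spectrum w by blast
    then have "cmod z \<noteq> 1" using boundary_zero_in_weyl_spectrum w by blast
    then show ?thesis using z by (intro exI[of _ z]) simp
  qed
  define v where "v z = z\<^sup>2 * deriv q z - 1" for z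
  have order: "\<exists>m::nat. m > 0 \<and> of_nat m * v a = 1"
    if "w \<in> op_spectrum (toeplitz h)" "w \<notin> weyl_spectrum (toeplitz h)" "cmod a < 1" "p w a = 0" for w a
    using ker[OF that(1,2)] eigenvector_zero_order(2)[OF _ _ that(3,4)] unfolding v_def by blast
  obtain e where e: "e > 0" "\<And>w'. cmod (w' - w0) < e \<Longrightarrow> w' \<notin> weyl_spectrum (toeplitz h)"
    using weyl_spectrum_complement_open[OF h_sym w0(2)] by blast
  obtain N where N: "\<And>n. n \<ge> N \<Longrightarrow> cmod (x n - w0) < e" using LIMSEQ_D[OF x(2) e(1)] by blast
  define y where "y n = x (n + N)" for n
  have y: "y n \<in> op_spectrum (toeplitz h)" "y n \<noteq> w0" "y n \<notin> weyl_spectrum (toeplitz h)" for n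
    using x(1)[of "n + N"] e(2)[OF N[of "n + N"]] by (auto simp: y_def)
  have ylim: "y \<longlonglongrightarrow> w0"
    unfolding y_def using x(2) by (rule LIMSEQ_ignore_initial_segment)
  obtain a where a: "\<And>n. cmod (a n) < 1" "\<And>n. p (y n) (a n) = 0"
    using zero[OF y(3)] by metis
  have "\<forall>n. a n \<in> cball 0 1" using a(1) by (simp add: less_imp_le)
  then obtain c r where c: "c \<in> cball 0 1" and r: "strict_mono r" "(a \<circ> r) \<longlonglongrightarrow> c"
    using compact_cball[of "0::complex" 1] unfolding compact_def by blast
  have alim: "(\<lambda>n. a (r n)) \<longlonglongrightarrow> c" using r(2) by (simp add: o_def)
  have yr: "(\<lambda>n. y (r n)) \<longlonglongrightarrow> w0" using LIMSEQ_subseq_LIMSEQ[OF ylim r(1)] by (simp add: o_def)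
  have "(\<lambda>n. q (a (r n))) \<longlonglongrightarrow> q c"
    by (rule continuous_on_tendsto_compose[OF q_cont alim c]) (use a(1) in \<open>simp add: less_imp_le\<close>)
  then have "(\<lambda>n. p (y (r n)) (a (r n))) \<longlonglongrightarrow> p w0 c"
    unfolding p_def by (intro tendsto_intros alim yr)
  then have pc: "p w0 c = 0" by (simp add: a(2) LIMSEQ_const_iff)
  \<comment> \<open>The limit of the zeros must be interior, because \<open>deriv q\<close> in
    \<open>v\<close> is controlled only inside the disk.\<close>
  have "cmod c \<noteq> 1" using boundary_zero_in_weyl_spectrum pc w0(2) by blast
  then have c1: "cmod c < 1" using c by simp
  have vh: "v holomorphic_on ball 0 1"
    unfolding v_def by (intro holomorphic_intros holomorphic_deriv q_hol) auto
  have vlim: "(\<lambda>n. v (a (r n))) \<longlonglongrightarrow> v c"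
    by (rule continuous_on_tendsto_compose[OF holomorphic_on_imp_continuous_on[OF vh] alim])
       (use a(1) c1 in auto)
  obtain m0 :: nat where m0: "m0 > 0" "of_nat m0 * v c = 1"
    using order[OF w0 c1 pc] by blast
  obtain m :: "nat \<Rightarrow> nat" where m: "\<And>n. m n > 0" "\<And>n. of_nat (m n) * v (a n) = 1"
    using order[OF y(1,3) a] by metis
  have vc: "v c \<noteq> 0" using m0 by auto
  have "v (a n) \<noteq> 0" for n using m(2)[of n] by auto
  then have mn: "of_nat (m n) = inverse (v (a n))" "of_nat m0 = inverse (v c)" for n
    using m(2)[of n] m0(2) by (auto simp: field_simps vc)
  have "(\<lambda>n. inverse (v (a (r n)))) \<longlonglongrightarrow> inverse (v c)"
    by (intro tendsto_inverse vlim vc)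
  then have "(\<lambda>n. complex_of_nat (m (r n))) \<longlonglongrightarrow> of_nat m0" by (simp add: mn)
  from LIMSEQ_D[OF this, of 1] obtain N' where N': "\<And>n. n \<ge> N' \<Longrightarrow> cmod (of_nat (m (r n)) - of_nat m0) < 1"
    by auto
  have veq: "v (a (r n)) = v c" if "n \<ge> N'" for n
  proof -
    have "complex_of_nat (m (r n)) - of_nat m0 = of_int (int (m (r n)) - int m0)" by simp
    then have "\<bar>int (m (r n)) - int m0\<bar> < 1" using N'[OF that] by (simp only: norm_of_int)
    then have "m (r n) = m0" by simp
    then show ?thesis using mn by (metis inverse_inverse_eq)
  qed
  \<comment> \<open>As \<open>y n\<close> differs from \<open>w0\<close>, so do their zeros; hence
    \<open>c\<close> really is a limit point of the level set of \<open>v\<close>.\<close>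
  have ne: "a n \<noteq> c" for n
    using p_zero_determines_w[of "y n" "a n" w0] a(2)[of n] pc y(2)[of n] by auto
  have lim: "c islimpt {z \<in> ball 0 1. v z - v c = 0}"
    unfolding islimpt_sequential
  proof (intro exI conjI allI)
    show "a (r (n + N')) \<in> {z \<in> ball 0 1. v z - v c = 0} - {c}" for n
      using a(1) veq[of "n + N'"] ne by auto
    show "(\<lambda>n. a (r (n + N'))) \<longlonglongrightarrow> c"
      using alim by (rule LIMSEQ_ignore_initial_segment)
  qed
  have "(\<lambda>z. v z - v c) holomorphic_on ball 0 1" by (intro holomorphic_intros vh)
  then have "v 0 - v c = 0"
    by (rule analytic_continuation[OF _ open_ball connected_ball _ _ lim]) (use c1 in auto)
  then have "v c = -1" by (simp add: v_def)
  with m0(2) have "complex_of_nat m0 = - 1" by (simp add: minus_equation_iff)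
  then have "Re (complex_of_nat m0) = - 1" by simp
  then show False by simp
qed

section \<open>Nonisolated points of the spectrum\<close>

lemma image_circle_accumulates:
  assumes \<zeta>: "cmod \<zeta> = 1" "p w \<zeta> = 0"
  shows "w islimpt op_spectrum (toeplitz h)"
proof -
  have circ: "p u z = z * (h z - u)" if "cmod z = 1" for u z
    using complex_norm_square[of z] that by (simp add: p_def h_def algebra_simps)
  have sub: "h ` sphere 0 1 \<subseteq> op_spectrum (toeplitz h)"
  proof
    fix u assume "u \<in> h ` sphere 0 1"
    then obtain z where "cmod z = 1" "u = h z" by auto
    then have "u \<in> weyl_spectrum (toeplitz h)"
      using boundary_zero_in_weyl_spectrum[of z u] circ[of z u] by simp
    then show "u \<in> op_spectrum (toeplitz h)" using weyl_spectrum_subset[OF h_sym] by blast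
  qed
  have "w islimpt h ` sphere 0 1"
  proof (rule connected_imp_perfect)
    have "continuous_on (sphere 0 1) h" by (rule continuous_on_subset[OF h_cont]) auto
    then show "connected (h ` sphere 0 1)"
      by (intro connected_continuous_image connected_sphere) auto
    have "\<zeta> \<noteq> 0" using \<zeta> by auto
    then have "h \<zeta> = w" using circ[OF \<zeta>(1), of w] \<zeta>(2) by simp
    then show "w \<in> h ` sphere 0 1" using \<zeta>(1) by force
    \<comment> \<open>If \<open>h\<close> were constant on the circle, some \<open>p u\<close> would
      vanish there and, by the maximum principle, at 0 as well, where its value is 1.\<close>
    show "h ` sphere 0 1 \<noteq> {u}" for u
    proof
      assume "h ` sphere 0 1 = {u}"
      then have "h z = u" if "cmod z = 1" for z using that by auto
      then have "p u z = 0" if "cmod z = 1" for z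
        using circ[OF that, of u] that by simp
      then have "cmod (p u z) \<le> 0" if "z \<in> frontier (cball 0 1)" for z
        using that by (simp add: frontier_cball)
      then have "cmod (p u 0) \<le> 0"
        by (rule maximum_modulus_frontier[of "p u" "cball 0 1", rotated 3])
           (simp_all add: interior_cball p_hol p_cont)
      then show False by simp
    qed
  qed
  then show ?thesis using sub islimpt_subset by blast
qed

lemma open_subset_imp_islimpt:
  fixes w :: complex
  assumes "open U" "w \<in> U" "U \<subseteq> op_spectrum (toeplitz h)"
  shows "w islimpt op_spectrum (toeplitz h)"
  using assms interior_limit_point interior_maximal islimpt_subset by blast

text \<open>On the closed disk \<open>p u\<close> and \<open>p w\<close> differ by at most
  \<open>cmod (u - w)\<close>, so the minimum of \<open>cmod (p w z)\<close> is a radius within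
  which no zero can appear.\<close>

lemma no_zero_accumulates:
  assumes nz: "\<And>z. cmod z \<le> 1 \<Longrightarrow> p w z \<noteq> 0"
  shows "w islimpt op_spectrum (toeplitz h)"
proof -
  obtain z0 where z0: "z0 \<in> cball 0 1" "\<And>z. z \<in> cball 0 1 \<Longrightarrow> cmod (p w z0) \<le> cmod (p w z)"
    using continuous_attains_inf[OF compact_cball _ continuous_on_norm[OF p_cont[of w]]] by auto
  define c where "c = cmod (p w z0)"
  have c: "c > 0" using nz[of z0] z0(1) by (simp add: c_def)
  have "ball w c \<subseteq> op_spectrum (toeplitz h)"
  proof
    fix u assume u: "u \<in> ball w c"
    have "p u z \<noteq> 0" if z: "cmod z \<le> 1" for z
    proof
      assume "p u z = 0"
      then have "p w z = z * (u - w)" by (simp add: p_def algebra_simps)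
      then have "cmod (p w z) \<le> 1 * cmod (u - w)"
        unfolding \<open>p w z = z * (u - w)\<close> norm_mult using z by (intro mult_right_mono) auto
      moreover have "c \<le> cmod (p w z)" unfolding c_def using z by (intro z0(2)) simp
      ultimately show False using u by (simp add: dist_norm norm_minus_commute)
    qed
    then show "u \<in> op_spectrum (toeplitz h)"
      using no_zero_in_weyl_spectrum weyl_spectrum_subset[OF h_sym] by blast
  qed
  then show ?thesis using c by (intro open_subset_imp_islimpt[of "ball w c"]) auto
qed

text \<open>In the punctured disk the zeros of \<open>p w\<close> are the points where
  \<open>Q z = q z + 1 / z\<close> takes the value \<open>w\<close>. Two such points have disjoint
  neighbourhoods with open images, and every \<open>u\<close> in both images again has two
  zeros.\<close>

lemma two_zeros_accumulate:
  assumes a: "cmod a < 1" "p w a = 0" and b: "cmod b < 1" "p w b = 0" and ab: "a \<noteq> b"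
  shows "w islimpt op_spectrum (toeplitz h)"
proof -
  define S where "S = ball (0::complex) 1 - {0}"
  define Q where "Q z = q z + 1 / z" for z
  have S: "open S" "connected S"
    unfolding S_def by (auto intro!: connected_open_delete)
  have pQ: "p u z = z * (Q z - u)" if "z \<in> S" for u z
    using that by (simp add: S_def p_def Q_def algebra_simps)
  have Qh: "Q holomorphic_on S"
    unfolding Q_def S_def by (intro holomorphic_intros holomorphic_on_subset[OF q_hol]) auto
  have aS: "a \<in> S" and bS: "b \<in> S" using a b by (auto simp: S_def p_def)
  \<comment> \<open>A constant \<open>Q\<close> would make some \<open>p u\<close> vanish on the
    punctured disk and hence at 0.\<close>
  have nc: "\<not> Q constant_on S"
  proof
    assume "Q constant_on S"
    then obtain u where u: "\<And>z. z \<in> S \<Longrightarrow> Q z = u" unfolding constant_on_def by blast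
    have "p u z = 0" if "z \<in> S" for z using pQ[OF that] u[OF that] by simp
    moreover have "0 islimpt S"
    proof -
      have "(0::complex) islimpt ball 0 1" by (intro interior_limit_point) simp
      then show ?thesis unfolding S_def by (simp add: islimpt_punctured[symmetric])
    qed
    ultimately have "p u 0 = 0"
      by (intro analytic_continuation[OF p_hol open_ball connected_ball, of S 0 u 0]) (auto simp: S_def)
    then show False by simp
  qed
  obtain U V where UV: "open U" "open V" "a \<in> U" "b \<in> V" "U \<inter> V = {}"
    using separation_t2[of a b] ab by blast
  define O' where "O' = Q ` (U \<inter> S) \<inter> Q ` (V \<inter> S)"
  have "open O'"
    unfolding O'_def using UV S by (intro open_Int open_mapping_thm[OF Qh S _ _ nc]) auto
  moreover have "w \<in> O'"
  proof -
    have "Q a = w" "Q b = w"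
      using pQ[OF aS, of w] pQ[OF bS, of w] a b aS bS by (auto simp: S_def)
    then show ?thesis
      unfolding O'_def using aS bS UV(3,4) by (metis IntI image_eqI)
  qed
  moreover have "O' \<subseteq> op_spectrum (toeplitz h)"
  proof
    fix u assume "u \<in> O'"
    then obtain z1 z2 where z: "z1 \<in> U" "z1 \<in> S" "u = Q z1" "z2 \<in> V" "z2 \<in> S" "u = Q z2"
      by (auto simp: O'_def)
    then have "u \<in> weyl_spectrum (toeplitz h)"
      using UV(5) pQ[of z1 u] pQ[of z2 u]
      by (intro two_zeros_in_weyl_spectrum[of z1 u z2]) (auto simp: S_def)
    then show "u \<in> op_spectrum (toeplitz h)" using weyl_spectrum_subset[OF h_sym] by blast
  qed
  ultimately show ?thesis by (rule open_subset_imp_islimpt)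
qed

text \<open>Isolation leaves a single interior zero, possibly multiple. The eigenvector makes it
  simple.\<close>

lemma isolated_eigenvalue_outside_weyl_spectrum:
  assumes iso: "\<not> w islimpt op_spectrum (toeplitz h)" and F: "F \<noteq> 0" "TT (\<lambda>z. h z - w) F = 0"
  shows "w \<notin> weyl_spectrum (toeplitz h)"
proof -
  have nb: "cmod z \<noteq> 1" if "p w z = 0" for z using image_circle_accumulates that iso by blast
  obtain a where a: "cmod a \<le> 1" "p w a = 0" using no_zero_accumulates iso by blast
  then have a1: "cmod a < 1" using nb[of a] by simp
  have "z = a" if "cmod z \<le> 1" "p w z = 0" for z
  proof (rule ccontr)
    assume "z \<noteq> a"
    moreover have "cmod z < 1" using nb[of z] that by simp
    ultimately show False using two_zeros_accumulate[of z w a] that a a1 iso by blast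
  qed
  then show ?thesis
    by (rule one_simple_zero_not_in_weyl_spectrum[OF a1 a(2) eigenvector_zero_order(1)[OF F(2,1) a1 a(2)]])
qed

text \<open>Eigenspaces are finite-dimensional for every \<open>w\<close>, so membership in
  \<open>pi00\<close> reduces to being an isolated eigenvalue. Outside the Weyl spectrum a spectral
  point is an eigenvalue because injectivity would imply invertibility.\<close>

theorem weyl_theorem: "weyl_spectrum (toeplitz h) = op_spectrum (toeplitz h) - pi00 (toeplitz h)"
proof (intro equalityI subsetI)
  fix w assume w: "w \<in> weyl_spectrum (toeplitz h)"
  have "w \<notin> pi00 (toeplitz h)"
  proof
    assume "w \<in> pi00 (toeplitz h)"
    then have "\<not> w islimpt op_spectrum (toeplitz h)" "eigenspace_op (toeplitz h) w \<noteq> {\<lambda>z. 0}"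
      by (simp_all add: pi00_def)
    then obtain F where "F \<noteq> 0" "TT (\<lambda>z. h z - w) F = 0"
      unfolding eigenspace_nonzero_iff by (elim exE conjE) (rule that)
    then show False
      using isolated_eigenvalue_outside_weyl_spectrum \<open>\<not> w islimpt op_spectrum (toeplitz h)\<close> w by simp
  qed
  then show "w \<in> op_spectrum (toeplitz h) - pi00 (toeplitz h)"
    using w weyl_spectrum_subset[OF h_sym] by blast
next
  fix w assume w: "w \<in> op_spectrum (toeplitz h) - pi00 (toeplitz h)"
  show "w \<in> weyl_spectrum (toeplitz h)"
  proof (rule ccontr)
    assume nw: "w \<notin> weyl_spectrum (toeplitz h)"
    have "\<not> linear_iso (TT (\<lambda>z. h z - w))" using w op_spectrum_toeplitz_iff[OF h_sym] by blast
    then have "\<exists>F. F \<noteq> 0 \<and> TT (\<lambda>z. h z - w) F = 0"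
      using weyl_linear_inj_imp_iso[OF not_in_weyl_spectrum_imp_weyl_linear[OF h_sym nw]] by blast
    then have "w \<in> pi00 (toeplitz h)"
      unfolding pi00_def mem_Collect_eq eigenspace_nonzero_iff
      using w isolated_outside_weyl_spectrum[OF _ nw] fin_dim_eigenspace by simp
    then show False using w by blast
  qed
qed

end

theorem theorem5p1:
  fixes q :: "complex \<Rightarrow> complex"
  assumes "q holomorphic_on ball 0 1"
    and "continuous_on (cball 0 1) q"
  shows "weyl_spectrum (toeplitz (\<lambda>z. cnj z + q z)) =
         op_spectrum (toeplitz (\<lambda>z. cnj z + q z)) - pi00 (toeplitz (\<lambda>z. cnj z + q z))"
proof -
  interpret disk_algebra_symbol q using assms by unfold_locales
  show ?thesis using weyl_theorem unfolding h_def[abs_def] .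
qed

end
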